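(* Let $p$ be an odd prime, $k$ an algebraically closed field of characteristic $p$, and $G=SL_2$ over $k$. For all integers $0\le n\le 2p-3$ and $m\ge 0$, $$\dim \mathrm{H}^n(G,V(m))\le F(n+1),$$ where $F(n+1)$ is the $(n+1)$-th Fibonacci number.
   Context: Dominant weights of $SL_2$ are identified with $\mathbb N=\{0,1,2,\dots\}$. $V(m)=\mathrm{ind}_B^G(m)^*$ is the Weyl module of highest weight $m$, where $B$ is a Borel subgroup (corresponding to the negative root). $\mathrm{H}^n(G,M)=\mathrm{Ext}^n_G(k,M)$ is rational cohomology. Fibonacci numbers: $F(1)=F(2)=1$ and $F(n)=F(n-1)+F(n-2)$ for $n\ge3$. *)

theory Defs
  imports
    "HOL-Analysis.Analysis"
    "HOL-Library.Function_Algebras"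
    "HOL-Library.Extended_Nat"
    "HOL-Computational_Algebra.Polynomial"
    "HOL-Computational_Algebra.Primes"
    "HOL-Number_Theory.Fib"
begin

section \<open>The group \<open>SL\<^sub>2\<close> and its coordinate ring\<close>

typedef (overloaded) 'k sl2 = "{A :: 'k::field^2^2. det A = 1}"
  by (rule exI[of _ "mat 1"]) simp

instantiation sl2 :: (field) "{monoid_mult, inverse}"
begin

definition one_sl2 :: "'a sl2" where
  "1 = Abs_sl2 (mat 1)"

definition times_sl2 :: "'a sl2 \<Rightarrow> 'a sl2 \<Rightarrow> 'a sl2" where
  "g * h = Abs_sl2 (Rep_sl2 g ** Rep_sl2 h)"

definition inverse_sl2 :: "'a sl2 \<Rightarrow> 'a sl2" where
  "inverse g = Abs_sl2 (matrix_inv (Rep_sl2 g))"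

definition divide_sl2 :: "'a sl2 \<Rightarrow> 'a sl2 \<Rightarrow> 'a sl2" where
  "g div h = g * inverse h" for g h :: "'a sl2"

lemma Rep_sl2_one: "Rep_sl2 1 = mat 1"
  by (simp add: one_sl2_def Abs_sl2_inverse)

lemma Rep_sl2_times: "Rep_sl2 (g * h) = Rep_sl2 g ** Rep_sl2 h"
  using Rep_sl2[of g] Rep_sl2[of h] by (simp add: times_sl2_def Abs_sl2_inverse det_mul)

instance
  by standard (simp_all add: Rep_sl2_inject[symmetric] Rep_sl2_times Rep_sl2_one matrix_mul_assoc)

end

lemma sl2_inverse:
  fixes g :: "'k::field sl2"
  shows "g * inverse g = 1" "inverse g * g = 1"
proof -
  let ?A = "Rep_sl2 g"
  have det: "det ?A = 1"
    using Rep_sl2[of g] by simp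
  then have "invertible ?A"
    by (simp add: invertible_det_nz)
  then have inv: "?A ** matrix_inv ?A = mat 1" "matrix_inv ?A ** ?A = mat 1"
    unfolding invertible_def matrix_inv_def by (auto intro: someI2_ex)
  have "det ?A * det (matrix_inv ?A) = 1"
    by (metis det_I det_mul inv(1))
  with det have "Rep_sl2 (inverse g) = matrix_inv ?A"
    by (simp add: inverse_sl2_def Abs_sl2_inverse)
  with inv show "g * inverse g = 1" "inverse g * g = 1"
    by (simp_all add: Rep_sl2_inject[symmetric] Rep_sl2_times Rep_sl2_one)
qed

text \<open>
  Over an algebraically closed field the smooth group scheme \<open>SL\<^sub>2\<close> is determined by its group of
  \<open>k\<close>-points, and \<open>k[G]\<close> is the algebra of functions on these points generated by the matrix
  entries.
\<close>

inductive_set coordinate_ring :: "('k::field sl2 \<Rightarrow> 'k) set" where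
  const: "(\<lambda>_. c) \<in> coordinate_ring"
| entry: "(\<lambda>g. Rep_sl2 g $ i $ j) \<in> coordinate_ring"
| add: "\<lbrakk>f \<in> coordinate_ring; h \<in> coordinate_ring\<rbrakk> \<Longrightarrow> (\<lambda>g. f g + h g) \<in> coordinate_ring"
| mult: "\<lbrakk>f \<in> coordinate_ring; h \<in> coordinate_ring\<rbrakk> \<Longrightarrow> (\<lambda>g. f g * h g) \<in> coordinate_ring"

text \<open>The Borel subgroup of the negative root consists of the lower triangular matrices.\<close>

definition borel_subgroup :: "'k::field sl2 set" where
  "borel_subgroup = {b. Rep_sl2 b $ 1 $ 2 = 0}"


section \<open>Rational modules\<close>

text \<open>
  The underlying space of a module is a subspace of a space of functions \<open>'i \<Rightarrow> 'k\<close> with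
  pointwise operations; up to isomorphism every \<open>k\<close>-vector space is of this form.
\<close>

definition fscale :: "'k::field \<Rightarrow> ('i \<Rightarrow> 'k) \<Rightarrow> 'i \<Rightarrow> 'k" where
  "fscale c v = (\<lambda>i. c * v i)"

global_interpretation fun_space: vector_space fscale
  by standard (simp_all add: fscale_def fun_eq_iff algebra_simps)

record (overloaded) ('k, 'i) gmodule =
  gcarrier :: "('i \<Rightarrow> 'k) set"
  gact :: "'k sl2 \<Rightarrow> ('i \<Rightarrow> 'k) \<Rightarrow> ('i \<Rightarrow> 'k)"

text \<open>
  The last clause says that the orbit map of \<open>v\<close> comes from an element \<open>\<Sum>i<n. w i \<otimes> f i\<close> of
  \<open>M \<otimes> k[G]\<close>: the action is locally finite with regular matrix coefficients.
\<close>

definition rational_module :: "('k::field, 'i) gmodule \<Rightarrow> bool" where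
  "rational_module M \<longleftrightarrow>
     fun_space.subspace (gcarrier M) \<and>
     (\<forall>g. \<forall>v\<in>gcarrier M. gact M g v \<in> gcarrier M) \<and>
     (\<forall>g. \<forall>u\<in>gcarrier M. \<forall>v\<in>gcarrier M. gact M g (u + v) = gact M g u + gact M g v) \<and>
     (\<forall>g c. \<forall>v\<in>gcarrier M. gact M g (fscale c v) = fscale c (gact M g v)) \<and>
     (\<forall>v\<in>gcarrier M. gact M 1 v = v) \<and>
     (\<forall>g h. \<forall>v\<in>gcarrier M. gact M (g * h) v = gact M g (gact M h v)) \<and>
     (\<forall>v\<in>gcarrier M. \<exists>(n::nat) w f.
        (\<forall>i<n. w i \<in> gcarrier M \<and> f i \<in> coordinate_ring) \<and>
        (\<forall>g. gact M g v = (\<Sum>i<n. fscale (f i g) (w i))))"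

text \<open>
  A homomorphism is extended by zero outside the carrier of its domain, so that homomorphisms
  are equal as functions iff they agree on the carrier.
\<close>

definition Hom_G :: "('k::field, 'i) gmodule \<Rightarrow> ('k, 'j) gmodule \<Rightarrow> (('i \<Rightarrow> 'k) \<Rightarrow> ('j \<Rightarrow> 'k)) set" where
  "Hom_G M N = {\<phi>.
     (\<forall>v\<in>gcarrier M. \<phi> v \<in> gcarrier N) \<and>
     (\<forall>u\<in>gcarrier M. \<forall>v\<in>gcarrier M. \<phi> (u + v) = \<phi> u + \<phi> v) \<and>
     (\<forall>c. \<forall>v\<in>gcarrier M. \<phi> (fscale c v) = fscale c (\<phi> v)) \<and>
     (\<forall>g. \<forall>v\<in>gcarrier M. \<phi> (gact M g v) = gact N g (\<phi> v)) \<and>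
     (\<forall>v. v \<notin> gcarrier M \<longrightarrow> \<phi> v = 0)}"

definition trivial_module :: "('k::field, unit) gmodule" where
  "trivial_module = \<lparr>gcarrier = UNIV, gact = (\<lambda>_ v. v)\<rparr>"

text \<open>Functionals are likewise extended by zero outside the carrier of \<open>M\<close>.\<close>

definition dual_module :: "('k::field, 'i) gmodule \<Rightarrow> ('k, 'i \<Rightarrow> 'k) gmodule" where
  "dual_module M = \<lparr>
     gcarrier = {\<phi>.
       (\<forall>u\<in>gcarrier M. \<forall>v\<in>gcarrier M. \<phi> (u + v) = \<phi> u + \<phi> v) \<and>
       (\<forall>c. \<forall>v\<in>gcarrier M. \<phi> (fscale c v) = c * \<phi> v) \<and>
       (\<forall>v. v \<notin> gcarrier M \<longrightarrow> \<phi> v = 0)},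
     gact = (\<lambda>g \<phi> v. if v \<in> gcarrier M then \<phi> (gact M (inverse g) v) else 0)\<rparr>"

text \<open>
  The weight \<open>m\<close> is the character \<open>b \<mapsto> b\<^sub>1\<^sub>1\<^sup>m\<close> of the Borel subgroup, and
  \<open>ind\<^sub>B\<^sup>G(m) = {f \<in> k[G]. f(gb) = m(b)\<^sup>-\<^sup>1 f(g)}\<close> carries the left regular action.
\<close>

definition induced_module :: "nat \<Rightarrow> ('k::field, 'k sl2) gmodule" where
  "induced_module m = \<lparr>
     gcarrier = {f \<in> coordinate_ring.
       \<forall>g. \<forall>b\<in>borel_subgroup. f (g * b) = inverse ((Rep_sl2 b $ 1 $ 1) ^ m) * f g},
     gact = (\<lambda>g f x. f (inverse g * x))\<rparr>"

definition weyl_module :: "nat \<Rightarrow> ('k::field, 'k sl2 \<Rightarrow> 'k) gmodule" where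
  "weyl_module m = dual_module (induced_module m)"


section \<open>Ext groups\<close>

text \<open>
  Injective resolutions are taken in the category of rational modules on subspaces of \<open>k\<^sup>\<nat>\<close>.
  It contains, up to isomorphism, all rational modules of countable dimension, hence has an
  injective resolution of every finite-dimensional module (e.g. by copies of \<open>k[G]\<close>). Since
  rational modules are locally finite, an object that is injective here has the extension
  property for all rational modules.
\<close>

definition injective_module :: "('k::field, nat) gmodule \<Rightarrow> bool" where
  "injective_module Q \<longleftrightarrow> rational_module Q \<and>
     (\<forall>(M :: ('k, nat) gmodule) (N :: ('k, nat) gmodule).
        rational_module M \<longrightarrow> rational_module N \<longrightarrow>
        (\<forall>\<iota>\<in>Hom_G M N. inj_on \<iota> (gcarrier M) \<longrightarrow>
           (\<forall>\<phi>\<in>Hom_G M Q. \<exists>\<psi>\<in>Hom_G N Q. \<forall>v\<in>gcarrier M. \<psi> (\<iota> v) = \<phi> v)))"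

text \<open>\<open>0 \<longrightarrow> M \<longrightarrow> I 0 \<longrightarrow> I 1 \<longrightarrow> \<dots>\<close> is exact with all \<open>I n\<close> injective.\<close>

definition injective_resolution ::
  "('k::field, 'i) gmodule \<Rightarrow> (('i \<Rightarrow> 'k) \<Rightarrow> (nat \<Rightarrow> 'k)) \<Rightarrow>
   (nat \<Rightarrow> ('k, nat) gmodule) \<Rightarrow> (nat \<Rightarrow> (nat \<Rightarrow> 'k) \<Rightarrow> (nat \<Rightarrow> 'k)) \<Rightarrow> bool" where
  "injective_resolution M \<epsilon> I d \<longleftrightarrow>
     (\<forall>n. injective_module (I n)) \<and>
     \<epsilon> \<in> Hom_G M (I 0) \<and> inj_on \<epsilon> (gcarrier M) \<and>
     (\<forall>n. d n \<in> Hom_G (I n) (I (Suc n))) \<and>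
     \<epsilon> ` gcarrier M = {v \<in> gcarrier (I 0). d 0 v = 0} \<and>
     (\<forall>n. d n ` gcarrier (I n) = {v \<in> gcarrier (I (Suc n)). d (Suc n) v = 0})"

definition hom_scale ::
  "'k::field \<Rightarrow> (('j \<Rightarrow> 'k) \<Rightarrow> ('i \<Rightarrow> 'k)) \<Rightarrow> (('j \<Rightarrow> 'k) \<Rightarrow> ('i \<Rightarrow> 'k))" where
  "hom_scale c \<phi> = (\<lambda>v. fscale c (\<phi> v))"

global_interpretation hom_space: vector_space hom_scale
  by standard (simp_all add: hom_scale_def fscale_def fun_eq_iff algebra_simps)

text \<open>
  For subspaces \<open>B \<subseteq> Z\<close>, a set \<open>S \<subseteq> Z\<close> maps bijectively to a basis of \<open>Z / B\<close> iff it is a basis of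
  a complement of \<open>B\<close> in \<open>Z\<close>. The dimension is \<open>\<infinity>\<close> if there is no finite such \<open>S\<close>.
\<close>

definition quotient_basis ::
  "(('j \<Rightarrow> 'k::field) \<Rightarrow> ('i \<Rightarrow> 'k)) set \<Rightarrow> (('j \<Rightarrow> 'k) \<Rightarrow> ('i \<Rightarrow> 'k)) set \<Rightarrow>
   (('j \<Rightarrow> 'k) \<Rightarrow> ('i \<Rightarrow> 'k)) set \<Rightarrow> bool" where
  "quotient_basis Z B S \<longleftrightarrow>
     S \<subseteq> Z \<and> \<not> hom_space.dependent S \<and>
     hom_space.span S \<inter> B = {0} \<and> hom_space.span (S \<union> B) = Z"

definition quotient_dim ::
  "(('j \<Rightarrow> 'k::field) \<Rightarrow> ('i \<Rightarrow> 'k)) set \<Rightarrow> (('j \<Rightarrow> 'k) \<Rightarrow> ('i \<Rightarrow> 'k)) set \<Rightarrow> enat" where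
  "quotient_dim Z B =
     (if \<exists>S. finite S \<and> quotient_basis Z B S
      then enat (card (SOME S. finite S \<and> quotient_basis Z B S)) else \<infinity>)"

text \<open>
  \<open>Ext\<^sup>n\<^sub>G(L, M)\<close> is the \<open>n\<close>-th cohomology of the complex \<open>Hom\<^sub>G(L, I 0) \<longrightarrow> Hom\<^sub>G(L, I 1) \<longrightarrow> \<dots>\<close>,
  where \<open>(I, d)\<close> is an injective resolution of \<open>M\<close>; postcomposing with \<open>d n\<close> preserves extension by
  zero because \<open>d n 0 = 0\<close>.
\<close>

definition Ext_cocycles ::
  "('k::field, 'j) gmodule \<Rightarrow> (nat \<Rightarrow> ('k, nat) gmodule) \<Rightarrow>
   (nat \<Rightarrow> (nat \<Rightarrow> 'k) \<Rightarrow> (nat \<Rightarrow> 'k)) \<Rightarrow> nat \<Rightarrow> (('j \<Rightarrow> 'k) \<Rightarrow> (nat \<Rightarrow> 'k)) set" where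
  "Ext_cocycles L I d n = {\<phi> \<in> Hom_G L (I n). d n \<circ> \<phi> = 0}"

fun Ext_coboundaries ::
  "('k::field, 'j) gmodule \<Rightarrow> (nat \<Rightarrow> ('k, nat) gmodule) \<Rightarrow>
   (nat \<Rightarrow> (nat \<Rightarrow> 'k) \<Rightarrow> (nat \<Rightarrow> 'k)) \<Rightarrow> nat \<Rightarrow> (('j \<Rightarrow> 'k) \<Rightarrow> (nat \<Rightarrow> 'k)) set" where
  "Ext_coboundaries L I d 0 = {0}"
| "Ext_coboundaries L I d (Suc n) = (\<lambda>\<phi>. d n \<circ> \<phi>) ` Hom_G L (I n)"

definition Ext_dim ::
  "('k::field, 'j) gmodule \<Rightarrow> (nat \<Rightarrow> ('k, nat) gmodule) \<Rightarrow>
   (nat \<Rightarrow> (nat \<Rightarrow> 'k) \<Rightarrow> (nat \<Rightarrow> 'k)) \<Rightarrow> nat \<Rightarrow> enat" where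
  "Ext_dim L I d n = quotient_dim (Ext_cocycles L I d n) (Ext_coboundaries L I d n)"

text \<open>\<open>H\<^sup>n(G, M) = Ext\<^sup>n\<^sub>G(k, M)\<close>, computed from an injective resolution \<open>(I, d)\<close> of \<open>M\<close>.\<close>

definition cohomology_dim ::
  "(nat \<Rightarrow> ('k::field, nat) gmodule) \<Rightarrow> (nat \<Rightarrow> (nat \<Rightarrow> 'k) \<Rightarrow> (nat \<Rightarrow> 'k)) \<Rightarrow> nat \<Rightarrow> enat" where
  "cohomology_dim I d n = Ext_dim (trivial_module :: ('k, unit) gmodule) I d n"

end

theory Submission
  imports Defs
begin

text \<open>
  On a rational module \<open>M\<close> of the Borel subgroup \<open>B\<close> of lower triangular matrices the divided powers
  \<open>X\<^sub>i\<close> of order \<open>p^i\<close> of the root operator commute and satisfy \<open>X\<^sub>i^p = 0\<close>. Tensoring the periodic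
  resolutions of the algebras \<open>k[X\<^sub>i]/(X\<^sub>i^p)\<close> gives a complex \<open>K\<close>, with one copy of \<open>M\<close> for each
  monomial in exterior generators of degree 1 and polynomial generators of degree 2, which computes
  the cohomology of the unipotent radical; its part of weight \<open>w\<close>, written \<open>K\<^sub>w\<close>, computes the
  \<open>B\<close>-cohomology of \<open>M \<otimes> k\<^bsub>-w\<^esub>\<close>. Three facts give the theorem.

  First, \<open>K\<^sub>0(Q)\<close> is acyclic in positive degrees for an injective \<open>G\<close>-module \<open>Q\<close>, and \<open>K\<^sub>1(M)\<close> is acyclic
  in all degrees for every \<open>G\<close>-module \<open>M\<close>. Both reduce to the modules \<open>M \<otimes> k[G]\<close>, where one
  works separately on the open cell and on its complement; on each of them the unipotent radical acts freely.
  Hence dimension shifting along the resolution identifies the cohomology of \<open>V(m)\<close> with that of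
  \<open>K\<^sub>0(V(m))\<close>.

  Secondly, multiplication by a matrix entry embeds \<open>ind(m)\<close> into \<open>ind(m + 1)\<close> and dually maps
  \<open>V(m + 1)\<close> onto \<open>V(m)\<close>, with a one-dimensional kernel \<open>L\<close> of weight \<open>-(m + 1)\<close> and a shift of weights by
  1. As \<open>K\<^sub>1(V(m + 1))\<close> is acyclic, \<open>dim H\<^sup>n(G, V(m))\<close> is at most the dimension of the \<open>(n + 1)\<close>-st
  cohomology of \<open>K\<^sub>1(L)\<close>, hence at most the number of monomials of degree \<open>n + 1\<close> whose weight is
  \<open>(m + 2)/2\<close> times the root.

  Thirdly, splitting off the generators belonging to the lowest \<open>p\<close>-adic digit of the weight shows that
  in degrees up to \<open>2p - 2\<close> these numbers satisfy the Fibonacci recursion as an upper bound.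
\<close>

text \<open>No dimension of a cohomology group is formed until the very end: a bound b is carried as
  a linear relation, modulo coboundaries, among any b + 1 cocycles. In this form it passes through
  connecting maps by plain diagram chases.

  The restriction to weights w \<le> 1 in the acyclicity of M tensor k[G] comes from the closed
  locus d = 0. An invariant function of weight w' on it is b^(-w') times a constant vector, which
  extends to G when w' \<le> 0; division by d turns this into w \<le> 1. Weight 1 is the borderline
  case, and there H^0 of a G-module vanishes too, since a line bundle of degree -1 on the projective
  line has no sections.

  Injectivity is tested only against modules on subspaces of k^nat, whereas M tensor k[G] consists
  of functions on G times an index set. It is therefore moved into k^nat by evaluation at a
  countable dense set of points of G.

  The range n \<le> 2p - 3 enters through the count alone: in degree n + 1 \<le> 2p - 2 the lowest
  p-adic digit of a weight is reached without a carry.\<close>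

lemma sum_fun_apply: "(\<Sum>a\<in>A. f a) x = (\<Sum>a\<in>A. f a x)"
  by (induction A rule: infinite_finite_induct) auto

text \<open>Linearity is relative to a subspace, since actions are arbitrary and homomorphisms are
  zero outside the carrier.\<close>

definition lin_on :: "('i \<Rightarrow> 'k::field) set \<Rightarrow> (('i \<Rightarrow> 'k) \<Rightarrow> ('j \<Rightarrow> 'k)) \<Rightarrow> bool" where
  "lin_on V f \<longleftrightarrow> (\<forall>u\<in>V. \<forall>v\<in>V. f (u + v) = f u + f v) \<and>
     (\<forall>c. \<forall>v\<in>V. f (fscale c v) = fscale c (f v))"

context
  fixes V :: "('i \<Rightarrow> 'k::field) set" and f :: "('i \<Rightarrow> 'k) \<Rightarrow> ('j \<Rightarrow> 'k)"
  assumes V: "fun_space.subspace V" and f: "lin_on V f"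
begin

lemma lin_on_add: "u \<in> V \<Longrightarrow> v \<in> V \<Longrightarrow> f (u + v) = f u + f v"
  using f by (auto simp: lin_on_def)

lemma lin_on_scale: "v \<in> V \<Longrightarrow> f (fscale c v) = fscale c (f v)"
  using f by (auto simp: lin_on_def)

lemma lin_on_0: "f 0 = 0"
  using lin_on_scale[of 0 0] fun_space.subspace_0[OF V] by simp

lemma lin_on_diff: "u \<in> V \<Longrightarrow> v \<in> V \<Longrightarrow> f (u - v) = f u - f v"
  using lin_on_add[of "u - v" v] fun_space.subspace_diff[OF V, of u v] by simp

lemma lin_on_sum: "(\<And>a. a \<in> A \<Longrightarrow> g a \<in> V) \<Longrightarrow> f (\<Sum>a\<in>A. g a) = (\<Sum>a\<in>A. f (g a))"
proof (induction A rule: infinite_finite_induct)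
  case (insert a A)
  then have "f (g a + sum g A) = f (g a) + (\<Sum>a\<in>A. f (g a))"
    using lin_on_add[of "g a" "sum g A"] fun_space.subspace_sum[OF V, of A g] by simp
  then show ?case
    by (simp only: sum.insert[OF insert.hyps])
qed (simp_all add: lin_on_0)

lemma lin_on_sum_scale:
  "(\<And>a. a \<in> A \<Longrightarrow> g a \<in> V) \<Longrightarrow> f (\<Sum>a\<in>A. fscale (c a) (g a)) = (\<Sum>a\<in>A. fscale (c a) (f (g a)))"
  using lin_on_sum[of A "\<lambda>a. fscale (c a) (g a)"] fun_space.subspace_scale[OF V]
  by (simp add: lin_on_scale cong: sum.cong)

end

lemma lin_on_subset: "lin_on V f \<Longrightarrow> U \<subseteq> V \<Longrightarrow> lin_on U f"
  unfolding lin_on_def by blast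

lemma lin_on_comp: "lin_on V f \<Longrightarrow> lin_on U g \<Longrightarrow> f ` V \<subseteq> U \<Longrightarrow> lin_on V (g \<circ> f)"
  unfolding lin_on_def by (simp add: image_subset_iff)

lemma finite_uniform_bound:
  assumes "finite F" "\<And>e. e \<in> F \<Longrightarrow> \<exists>r::nat. \<forall>i\<ge>r. P e i"
  shows "\<exists>r. \<forall>e\<in>F. \<forall>i\<ge>r. P e i"
proof -
  obtain r where r: "\<And>e. e \<in> F \<Longrightarrow> \<forall>i\<ge>r e. P e i"
    using assms(2) by metis
  have "r e \<le> Max (r ` F)" if "e \<in> F" for e
    using assms(1) that by simp
  then show ?thesis
    using r by (meson order_trans)
qed


section \<open>The cochain complex\<close>

text \<open>
  A finitely supported \<open>e\<close> encodes the monomial with factors \<open>x\<^sub>i^(e i mod 2) y\<^sub>i^(e i div 2)\<close>, where \<open>x\<^sub>i\<close> is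
  exterior of degree 1 and \<open>y\<^sub>i\<close> is polynomial of degree 2. Their weights \<open>p\<^sup>i\<close> and \<open>p^(i + 1)\<close> are counted in
  multiples of the root, which is 2 in terms of weights of the torus; hence the factor 2 in \<open>cochains\<close>.
\<close>

definition cell_wt :: "nat \<Rightarrow> nat \<Rightarrow> nat \<Rightarrow> int" where
  "cell_wt p i h = int p ^ i * int (h mod 2) + int p ^ Suc i * int (h div 2)"

definition wt :: "nat \<Rightarrow> (nat \<Rightarrow> nat) \<Rightarrow> int" where
  "wt p e = (\<Sum>i | e i \<noteq> 0. cell_wt p i (e i))"

definition deg :: "(nat \<Rightarrow> nat) \<Rightarrow> nat" where
  "deg e = (\<Sum>i | e i \<noteq> 0. e i)"

definition dn :: "(nat \<Rightarrow> nat) \<Rightarrow> nat \<Rightarrow> nat \<Rightarrow> nat" where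
  "dn e i = e(i := e i - 1)"

definition up :: "(nat \<Rightarrow> nat) \<Rightarrow> nat \<Rightarrow> nat \<Rightarrow> nat" where
  "up e i = e(i := Suc (e i))"

text \<open>The Koszul sign for moving the differential of factor \<open>i\<close> past the factors
  below \<open>i\<close>; \<open>e j\<close> is the degree of the \<open>j\<close>-th
  factor.\<close>

definition sg :: "(nat \<Rightarrow> nat) \<Rightarrow> nat \<Rightarrow> 'k::field" where
  "sg e i = (-1) ^ (\<Sum>j<i. e j)"

text \<open>The weight of the map into cell \<open>h\<close> of factor \<open>i\<close>: p^i for
  X_i, and (p-1) p^i for X_i^(p-1).\<close>

definition wt_inc :: "nat \<Rightarrow> nat \<Rightarrow> nat \<Rightarrow> int" where
  "wt_inc p i h = (if odd h then int p ^ i else int (p - 1) * int p ^ i)"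

lemma cell_wt_0 [simp]: "cell_wt p i 0 = 0"
  by (simp add: cell_wt_def)

lemma cell_wt_Suc:
  assumes "p > 0"
  shows "cell_wt p i (Suc h) = cell_wt p i h + wt_inc p i (Suc h)"
proof (cases "even h")
  case True
  then obtain a where "h = 2 * a" by (elim evenE)
  then show ?thesis by (simp add: cell_wt_def wt_inc_def)
next
  case False
  then have "h mod 2 = 1" "Suc h mod 2 = 0" "Suc h div 2 = Suc (h div 2)"
    by presburger+
  with False show ?thesis
    using assms by (simp add: cell_wt_def wt_inc_def algebra_simps of_nat_diff)
qed

lemma wt_superset: "finite S \<Longrightarrow> {i. e i \<noteq> 0} \<subseteq> S \<Longrightarrow> wt p e = (\<Sum>i\<in>S. cell_wt p i (e i))"
  unfolding wt_def by (rule sum.mono_neutral_left) auto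

lemma deg_superset: "finite S \<Longrightarrow> {i. e i \<noteq> 0} \<subseteq> S \<Longrightarrow> deg e = (\<Sum>i\<in>S. e i)"
  unfolding deg_def by (rule sum.mono_neutral_left) auto

lemma supp_dn: "{j. dn e i j \<noteq> 0} \<subseteq> {j. e j \<noteq> 0}"
  by (auto simp: dn_def split: if_splits)

lemma wt_dn:
  assumes "p > 0" "finite {i. e i \<noteq> 0}" "e i \<noteq> 0"
  shows "wt p e = wt p (dn e i) + wt_inc p i (e i)"
proof -
  let ?S = "{i. e i \<noteq> 0}"
  have "wt p (dn e i) = (\<Sum>j\<in>?S. cell_wt p j (dn e i j))"
    using assms supp_dn by (intro wt_superset)
  also have "\<dots> = cell_wt p i (e i - 1) + (\<Sum>j\<in>?S - {i}. cell_wt p j (e j))"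
    using assms by (subst sum.remove[of _ i]) (auto simp: dn_def intro!: sum.cong)
  finally have "wt p (dn e i) + wt_inc p i (e i) = cell_wt p i (e i) + (\<Sum>j\<in>?S - {i}. cell_wt p j (e j))"
    using cell_wt_Suc[OF assms(1), of i "e i - 1"] assms(3) by simp
  then show ?thesis
    using assms sum.remove[of ?S i "\<lambda>j. cell_wt p j (e j)"] unfolding wt_def by force
qed

lemma deg_dn:
  assumes "finite {i. e i \<noteq> 0}" "e i \<noteq> 0"
  shows "deg e = Suc (deg (dn e i))"
proof -
  let ?S = "{i. e i \<noteq> 0}"
  have "deg (dn e i) = (\<Sum>j\<in>?S. dn e i j)"
    using assms supp_dn by (intro deg_superset)
  also have "\<dots> = (e i - 1) + (\<Sum>j\<in>?S - {i}. e j)"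
    using assms by (subst sum.remove[of _ i]) (auto simp: dn_def intro!: sum.cong)
  finally show ?thesis
    using assms sum.remove[of ?S i e] unfolding deg_def by force
qed

lemma finite_supp_dn: "finite {j. e j \<noteq> 0} \<Longrightarrow> finite {j. dn e i j \<noteq> 0}"
  by (rule finite_subset[OF supp_dn])

lemma finite_supp_dnD:
  assumes "finite {j. dn e i j \<noteq> 0}"
  shows "finite {j. e j \<noteq> 0}"
proof (rule finite_subset)
  show "{j. e j \<noteq> 0} \<subseteq> insert i {j. dn e i j \<noteq> 0}"
    by (auto simp: dn_def)
qed (use assms in simp)

lemma dn_up [simp]: "dn (up e i) i = e"
  by (simp add: dn_def up_def)

lemma up_dn: "e i \<noteq> 0 \<Longrightarrow> up (dn e i) i = e"
  by (simp add: dn_def up_def)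

lemma dn_comm: "i \<noteq> j \<Longrightarrow> dn (dn e i) j = dn (dn e j) i"
  by (auto simp: dn_def fun_eq_iff)

lemma sg_dn_ge: "i \<ge> j \<Longrightarrow> sg (dn e i) j = sg e j"
  by (auto simp: sg_def dn_def intro!: arg_cong[of _ _ "power (-1)"] sum.cong)

lemma sg_dn_less:
  assumes "i < j" "e i \<noteq> 0"
  shows "sg (dn e i) j = - (sg e j :: 'k::field)"
proof -
  have "(\<Sum>l<j. e l) = e i + (\<Sum>l\<in>{..<j} - {i}. e l)"
    using assms by (subst sum.remove[of _ i]) auto
  moreover have "(\<Sum>l<j. dn e i l) = (e i - 1) + (\<Sum>l\<in>{..<j} - {i}. e l)"
    using assms by (subst sum.remove[of _ i]) (auto simp: dn_def intro!: sum.cong)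
  ultimately have "(\<Sum>l<j. e l) = Suc (\<Sum>l<j. dn e i l)"
    using assms(2) by simp
  then show ?thesis by (simp add: sg_def)
qed

lemma sg_sq [simp]: "sg e i * sg e i = (1::'k::field)"
  by (simp add: sg_def flip: power_add mult_2)

text \<open>The maps of the periodic resolution of k[X]/(X^p) alternate between X and X^(p-1);
  \<open>h\<close> is the degree of the target.\<close>

definition Dop :: "nat \<Rightarrow> (nat \<Rightarrow> 'v \<Rightarrow> 'v) \<Rightarrow> nat \<Rightarrow> nat \<Rightarrow> 'v \<Rightarrow> 'v" where
  "Dop p X i h = (if odd h then X i else X i ^^ (p - 1))"

text \<open>The total differential of the tensor product of the periodic complexes. For
  \<open>e\<close> of infinite support the sum is 0 by convention, as it should be for
  cochains.\<close>

definition dl :: "nat \<Rightarrow> (nat \<Rightarrow> ('i \<Rightarrow> 'k) \<Rightarrow> ('i \<Rightarrow> 'k)) \<Rightarrow>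
    ((nat \<Rightarrow> nat) \<Rightarrow> ('i \<Rightarrow> 'k::field)) \<Rightarrow> (nat \<Rightarrow> nat) \<Rightarrow> ('i \<Rightarrow> 'k)" where
  "dl p X \<phi> e = (\<Sum>i | e i \<noteq> 0. fscale (sg e i) (Dop p X i (e i) (\<phi> (dn e i))))"

text \<open>The coefficient has weight \<open>w - 2 * wt p e\<close>, so that together with the
  monomial the total weight is \<open>w\<close>. Supports are finite because only finitely many X_i
  act nontrivially on a given vector.\<close>

definition cochains :: "nat \<Rightarrow> (int \<Rightarrow> ('i \<Rightarrow> 'k::field) set) \<Rightarrow> nat \<Rightarrow> int \<Rightarrow>
    ((nat \<Rightarrow> nat) \<Rightarrow> ('i \<Rightarrow> 'k)) set" where
  "cochains p W n w = {\<phi>. (\<forall>e. \<phi> e \<in> W (w - 2 * wt p e)) \<and>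
     (\<forall>e. \<phi> e \<noteq> 0 \<longrightarrow> finite {i. e i \<noteq> 0} \<and> deg e = n) \<and> finite {e. \<phi> e \<noteq> 0}}"

definition cobounds :: "nat \<Rightarrow> (nat \<Rightarrow> ('i \<Rightarrow> 'k) \<Rightarrow> ('i \<Rightarrow> 'k)) \<Rightarrow> (int \<Rightarrow> ('i \<Rightarrow> 'k::field) set) \<Rightarrow>
    nat \<Rightarrow> int \<Rightarrow> ((nat \<Rightarrow> nat) \<Rightarrow> ('i \<Rightarrow> 'k)) set" where
  "cobounds p X W n w = (if n = 0 then {0} else dl p X ` cochains p W (n - 1) w)"

definition acyclic_at :: "nat \<Rightarrow> (nat \<Rightarrow> ('i \<Rightarrow> 'k) \<Rightarrow> ('i \<Rightarrow> 'k)) \<Rightarrow> (int \<Rightarrow> ('i \<Rightarrow> 'k::field) set) \<Rightarrow>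
    nat \<Rightarrow> int \<Rightarrow> bool" where
  "acyclic_at p X W n w \<longleftrightarrow>
     (\<forall>\<xi>\<in>cochains p W n w. dl p X \<xi> = 0 \<longrightarrow> \<xi> \<in> cobounds p X W n w)"

text \<open>A weight-graded module over the algebra of commuting X_i with X_i^p = 0.
  \<open>X_fin\<close> makes the differential preserve finite supports; \<open>two_neq_0\<close>
  serves the sign argument for its square.\<close>

locale xmodule =
  fixes p :: nat and X :: "nat \<Rightarrow> ('i \<Rightarrow> 'k::field) \<Rightarrow> ('i \<Rightarrow> 'k)"
    and W :: "int \<Rightarrow> ('i \<Rightarrow> 'k) set"
  assumes p_ge_2: "p \<ge> 2" and two_neq_0: "(2::'k) \<noteq> 0"
    and sub: "fun_space.subspace (W w)"
    and X_W: "v \<in> W w \<Longrightarrow> X i v \<in> W (w - 2 * int p ^ i)"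
    and X_lin: "lin_on (W w) (X i)"
    and X_comm: "v \<in> W w \<Longrightarrow> X i (X j v) = X j (X i v)"
    and X_pow: "v \<in> W w \<Longrightarrow> (X i ^^ p) v = 0"
    and X_fin: "v \<in> W w \<Longrightarrow> \<exists>r. \<forall>i\<ge>r. X i v = 0"
begin

lemma Xpow_W: "v \<in> W w \<Longrightarrow> (X i ^^ n) v \<in> W (w - 2 * (int n * int p ^ i))"
proof (induction n)
  case (Suc n)
  then show ?case
    using X_W[of "(X i ^^ n) v" "w - 2 * (int n * int p ^ i)" i] by (simp add: algebra_simps)
qed simp

lemma Xpow_lin: "lin_on (W w) (X i ^^ n)"
proof (induction n)
  case (Suc n)
  then show ?case
    using lin_on_comp[OF Suc X_lin[of "w - 2 * (int n * int p ^ i)" i]] Xpow_W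
    by (auto simp: image_subset_iff comp_def)
qed (simp add: lin_on_def)

lemma Xpow_X_comm: "v \<in> W w \<Longrightarrow> (X i ^^ n) (X j v) = X j ((X i ^^ n) v)"
proof (induction n)
  case (Suc n)
  then show ?case using X_comm[OF Xpow_W[OF Suc.prems]] by simp
qed simp

lemma Xpow_comm: "v \<in> W w \<Longrightarrow> (X i ^^ n) ((X j ^^ m) v) = (X j ^^ m) ((X i ^^ n) v)"
proof (induction m)
  case (Suc m)
  then show ?case using Xpow_X_comm[OF Xpow_W[OF Suc.prems]] by simp
qed simp

lemma Dop_W: "v \<in> W w \<Longrightarrow> Dop p X i h v \<in> W (w - 2 * wt_inc p i h)"
  using X_W Xpow_W[where n = "p - 1" and i = i] by (auto simp: Dop_def wt_inc_def)

lemma Dop_lin: "lin_on (W w) (Dop p X i h)"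
  using X_lin Xpow_lin by (simp add: Dop_def)

lemma Dop_X_comm: "v \<in> W w \<Longrightarrow> X j (Dop p X i h v) = Dop p X i h (X j v)"
  using X_comm Xpow_X_comm by (auto simp: Dop_def)

lemma Dop_comm: "v \<in> W w \<Longrightarrow> Dop p X i h (Dop p X j l v) = Dop p X j l (Dop p X i h v)"
  using X_comm Xpow_X_comm Xpow_comm by (auto simp: Dop_def)

lemma Dop_Dop: "v \<in> W w \<Longrightarrow> Dop p X i (Suc (Suc h)) (Dop p X i (Suc h) v) = 0"
proof -
  assume v: "v \<in> W w"
  have "X i ((X i ^^ (p - 1)) v) = 0"
    using X_pow[OF v, of i] p_ge_2 by (cases p) auto
  then show ?thesis using Xpow_X_comm[OF v] by (simp add: Dop_def)
qed

lemma Dop_0 [simp]: "Dop p X i h 0 = 0"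
  using lin_on_0[OF sub Dop_lin] by blast

lemma X_0 [simp]: "X i 0 = 0"
  using lin_on_0[OF sub X_lin] by blast

abbreviation "K \<equiv> cochains p W"
abbreviation "\<delta> \<equiv> dl p X"

lemma K_W: "\<phi> \<in> K n w \<Longrightarrow> \<phi> e \<in> W (w - 2 * wt p e)"
  by (simp add: cochains_def)

lemma K_D: "\<phi> \<in> K n w \<Longrightarrow> \<phi> e \<noteq> 0 \<Longrightarrow> finite {i. e i \<noteq> 0} \<and> deg e = n"
  by (simp add: cochains_def)

lemma K_fin: "\<phi> \<in> K n w \<Longrightarrow> finite {e. \<phi> e \<noteq> 0}"
  by (simp add: cochains_def)

lemma dl_term_W:
  assumes "\<phi> \<in> K n w" "finite {i. e i \<noteq> 0}" "e i \<noteq> 0"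
  shows "Dop p X i (e i) (\<phi> (dn e i)) \<in> W (w - 2 * wt p e)"
  using Dop_W[OF K_W[OF assms(1)], of i "e i" "dn e i"] wt_dn[of p e i] assms p_ge_2
  by (simp add: algebra_simps)

lemma K_0: "0 \<in> K n w"
  using fun_space.subspace_0[OF sub] by (simp add: cochains_def)

lemma K_lincomb:
  assumes "finite A" "\<And>a. a \<in> A \<Longrightarrow> z a \<in> K n w"
  shows "(\<lambda>e. \<Sum>a\<in>A. fscale (c a) (z a e)) \<in> K n w"
proof -
  let ?y = "\<lambda>e. \<Sum>a\<in>A. fscale (c a) (z a e)"
  have *: "\<exists>a\<in>A. z a e \<noteq> 0" if "?y e \<noteq> 0" for e
  proof (rule ccontr)
    assume "\<not> (\<exists>a\<in>A. z a e \<noteq> 0)"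
    then have "?y e = 0" by (intro sum.neutral) auto
    with that show False by simp
  qed
  have "finite (\<Union>a\<in>A. {e. z a e \<noteq> 0})"
    using assms K_fin by auto
  then have "finite {e. ?y e \<noteq> 0}"
    by (rule rev_finite_subset) (use * in auto)
  moreover have "?y e \<in> W (w - 2 * wt p e)" for e
    using K_W[OF assms(2)] by (intro fun_space.subspace_sum[OF sub] fun_space.subspace_scale[OF sub])
  moreover have "finite {i. e i \<noteq> 0} \<and> deg e = n" if "?y e \<noteq> 0" for e
    using *[OF that] K_D assms(2) by blast
  ultimately show ?thesis unfolding cochains_def by blast
qed

lemma K_add: "x \<in> K n w \<Longrightarrow> y \<in> K n w \<Longrightarrow> x + y \<in> K n w"
  using K_lincomb[of "{0,1::nat}" "\<lambda>a. if a = 0 then x else y" n w "\<lambda>_. 1"]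
  by (simp add: plus_fun_def)

lemma K_diff: "x \<in> K n w \<Longrightarrow> y \<in> K n w \<Longrightarrow> x - y \<in> K n w"
  using K_lincomb[of "{0,1::nat}" "\<lambda>a. if a = 0 then x else y" n w "\<lambda>a. if a = 0 then 1 else -1"]
  by (simp add: fun_diff_def)

lemma dl_lincomb:
  assumes "finite A" "\<And>a. a \<in> A \<Longrightarrow> z a \<in> K n w"
  shows "\<delta> (\<lambda>e. \<Sum>a\<in>A. fscale (c a) (z a e)) = (\<lambda>e. \<Sum>a\<in>A. fscale (c a) (\<delta> (z a) e))"
proof
  fix e
  have "\<delta> (\<lambda>e. \<Sum>a\<in>A. fscale (c a) (z a e)) e =
    (\<Sum>i | e i \<noteq> 0. \<Sum>a\<in>A. fscale (c a) (fscale (sg e i) (Dop p X i (e i) (z a (dn e i)))))"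
    unfolding dl_def
    by (intro sum.cong refl, subst lin_on_sum_scale[OF sub Dop_lin])
      (use K_W[OF assms(2)] in \<open>auto simp: fun_space.scale_sum_right mult.commute\<close>)
  also have "\<dots> = (\<Sum>a\<in>A. fscale (c a) (\<delta> (z a) e))"
    unfolding dl_def fun_space.scale_sum_right by (rule sum.swap)
  finally show "\<delta> (\<lambda>e. \<Sum>a\<in>A. fscale (c a) (z a e)) e = (\<Sum>a\<in>A. fscale (c a) (\<delta> (z a) e))" .
qed

lemma dl_add: "x \<in> K n w \<Longrightarrow> y \<in> K n w \<Longrightarrow> \<delta> (x + y) = \<delta> x + \<delta> y"
  using dl_lincomb[of "{0,1::nat}" "\<lambda>a. if a = 0 then x else y" n w "\<lambda>_. 1"]
  by (simp add: plus_fun_def)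

lemma dl_diff: "x \<in> K n w \<Longrightarrow> y \<in> K n w \<Longrightarrow> \<delta> (x - y) = \<delta> x - \<delta> y"
  using dl_lincomb[of "{0,1::nat}" "\<lambda>a. if a = 0 then x else y" n w "\<lambda>a. if a = 0 then 1 else -1"]
  by (simp add: fun_diff_def)

lemma dl_0 [simp]: "\<delta> 0 = 0"
  by (rule ext) (simp add: dl_def)

lemma dl_nonzeroD:
  assumes "\<delta> \<phi> e \<noteq> 0"
  obtains i where "finite {i. e i \<noteq> 0}" "e i \<noteq> 0" "Dop p X i (e i) (\<phi> (dn e i)) \<noteq> 0"
proof -
  have "finite {i. e i \<noteq> 0}"
    using assms by (auto simp: dl_def intro: ccontr)
  moreover have "\<exists>i. e i \<noteq> 0 \<and> Dop p X i (e i) (\<phi> (dn e i)) \<noteq> 0"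
  proof (rule ccontr)
    assume "\<not> ?thesis"
    then have "\<delta> \<phi> e = 0" 
      unfolding dl_def
      by (intro sum.neutral ballI) (metis (mono_tags) fun_space.scale_zero_right mem_Collect_eq)
    with assms show False by simp
  qed
  ultimately show ?thesis using that by blast
qed

lemma X_fin_uniform:
  assumes "\<phi> \<in> K n w"
  shows "\<exists>r. \<forall>e. \<forall>i\<ge>r. X i (\<phi> e) = 0"
proof -
  have "\<exists>r. \<forall>e\<in>{e. \<phi> e \<noteq> 0}. \<forall>i\<ge>r. X i (\<phi> e) = 0"
    using X_fin K_W[OF assms] by (intro finite_uniform_bound K_fin[OF assms]) blast
  then show ?thesis by (metis X_0 mem_Collect_eq)
qed

lemma Dop_eq_0: "v \<in> W w \<Longrightarrow> X i v = 0 \<Longrightarrow> Dop p X i h v = 0"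
proof -
  assume v: "v \<in> W w" "X i v = 0"
  obtain m where "p - 1 = Suc m" using p_ge_2 by (metis Suc_diff_Suc Suc_1 Suc_le_lessD)
  moreover have "(X i ^^ Suc m) v = 0"
    using v lin_on_0[OF sub Xpow_lin[where i = i and n = m]] by (simp add: funpow_swap1)
  ultimately show ?thesis using v by (simp add: Dop_def)
qed

lemma dl_K:
  assumes \<phi>: "\<phi> \<in> K n w"
  shows "\<delta> \<phi> \<in> K (Suc n) w"
proof -
  obtain r where r: "\<And>e i. i \<ge> r \<Longrightarrow> X i (\<phi> e) = 0"
    using X_fin_uniform[OF \<phi>] by blast
  \<comment> \<open>A nonzero coefficient of the differential arises by raising a cell of
    \<open>\<phi>\<close> at an index below \<open>r\<close>; there are finitely many such
    cells.\<close>
  have nz: "\<exists>i<r. e = up (dn e i) i \<and> \<phi> (dn e i) \<noteq> 0 \<and> finite {i. e i \<noteq> 0} \<and> deg e = Suc n"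
    if ne: "\<delta> \<phi> e \<noteq> 0" for e
  proof -
    obtain i where i: "finite {i. e i \<noteq> 0}" "e i \<noteq> 0" "Dop p X i (e i) (\<phi> (dn e i)) \<noteq> 0"
      using dl_nonzeroD[OF ne] .
    have "i < r"
      using i(3) Dop_eq_0[OF K_W[OF \<phi>]] r by (meson not_le)
    moreover have "\<phi> (dn e i) \<noteq> 0" using i(3) by auto
    ultimately show ?thesis using i up_dn[of e i] deg_dn[of e i] K_D[OF \<phi>] by metis
  qed
  have "finite ((\<lambda>(i, e). up e i) ` ({..<r} \<times> {e. \<phi> e \<noteq> 0}))"
    using K_fin[OF \<phi>] by auto
  then have "finite {e. \<delta> \<phi> e \<noteq> 0}"
    by (rule rev_finite_subset) (use nz in force)
  moreover have "\<delta> \<phi> e \<in> W (w - 2 * wt p e)" for e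
  proof (cases "finite {i. e i \<noteq> 0}")
    case True
    then show ?thesis unfolding dl_def
      using dl_term_W[OF \<phi>] by (intro fun_space.subspace_sum[OF sub] fun_space.subspace_scale[OF sub]) auto
  next
    case False
    then show ?thesis using fun_space.subspace_0[OF sub] by (simp add: dl_def)
  qed
  ultimately show ?thesis
    using nz by (auto simp: cochains_def)
qed

text \<open>Mixed terms cancel in pairs by commutativity and the Koszul sign, diagonal ones die
  because X_i^p = 0. The double sum \<open>T\<close> thus equals its own negative, and 2 is
  invertible.\<close>

lemma dl_dl:
  assumes \<phi>: "\<phi> \<in> K n w"
  shows "\<delta> (\<delta> \<phi>) = 0"
proof
  fix e
  show "\<delta> (\<delta> \<phi>) e = 0 e"
  proof (cases "finite {i. e i \<noteq> 0}")
    case False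
    then show ?thesis by (simp add: dl_def)
  next
    case fin: True
    let ?S = "{i. e i \<noteq> 0}"
    \<comment> \<open>Zero is inserted when the exponent at \<open>j\<close> is used up, so that
      both sums range over the support of \<open>e\<close> and can be swapped.\<close>
    define g where "g i j = (if dn e i j = 0 then 0 else
       fscale (sg e i * sg (dn e i) j) (Dop p X i (e i) (Dop p X j (dn e i j) (\<phi> (dn (dn e i) j)))))" for i j
    have dd: "\<delta> (\<delta> \<phi>) e = (\<Sum>i\<in>?S. \<Sum>j\<in>?S. g i j)"
    proof -
      have "fscale (sg e i) (Dop p X i (e i) (\<delta> \<phi> (dn e i))) = (\<Sum>j\<in>?S. g i j)" if "e i \<noteq> 0" for i
      proof -
        have f: "finite {j. dn e i j \<noteq> 0}" using finite_supp_dn[OF fin] .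
        have "Dop p X i (e i) (\<delta> \<phi> (dn e i)) = (\<Sum>j | dn e i j \<noteq> 0. fscale (sg (dn e i) j)
            (Dop p X i (e i) (Dop p X j (dn e i j) (\<phi> (dn (dn e i) j)))))"
          unfolding dl_def
          by (rule lin_on_sum_scale[OF sub Dop_lin]) (use dl_term_W[OF \<phi> f] in auto)
        then have "fscale (sg e i) (Dop p X i (e i) (\<delta> \<phi> (dn e i))) = (\<Sum>j | dn e i j \<noteq> 0. g i j)"
          by (auto simp: fun_space.scale_sum_right g_def intro!: sum.cong)
        also have "\<dots> = (\<Sum>j\<in>?S. g i j)"
          by (rule sum.mono_neutral_left[OF fin supp_dn]) (auto simp: g_def)
        finally show ?thesis .
      qed
      then show ?thesis unfolding dl_def[of p X "\<delta> \<phi>"] by (intro sum.cong) auto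
    qed
    have anti: "g i j = - g j i" if ij: "i \<in> ?S" "j \<in> ?S" for i j
    proof (cases "i = j")
      case True
      show ?thesis
      proof (cases "e i = 1")
        case False
        then obtain h where h: "e i = Suc (Suc h)" using ij by (cases "e i"; cases "e i - 1") auto
        then have "g i i = 0"
          using Dop_Dop[OF K_W[OF \<phi>]] by (simp add: g_def dn_def)
        then show ?thesis using True by simp
      qed (use True in \<open>simp add: g_def dn_def\<close>)
    next
      case False
      then have *: "dn e i j = e j" "dn e j i = e i" by (auto simp: dn_def)
      have "sg e i * sg (dn e i) j = - (sg e j * sg (dn e j) i :: 'k)"
        using False ij
        by (cases "i < j") (auto simp: sg_dn_less sg_dn_ge mult.commute)
      then show ?thesis
        using ij False unfolding g_def * 
        by (simp add: dn_comm[OF False] Dop_comm[OF K_W[OF \<phi>], of i])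
    qed
    define T where "T = (\<Sum>i\<in>?S. \<Sum>j\<in>?S. g i j)"
    have "T = (\<Sum>i\<in>?S. \<Sum>j\<in>?S. - g j i)"
      unfolding T_def by (intro sum.cong refl anti)
    also have "\<dots> = - (\<Sum>i\<in>?S. \<Sum>j\<in>?S. g j i)" by (simp only: sum_negf)
    also have "(\<Sum>i\<in>?S. \<Sum>j\<in>?S. g j i) = T" unfolding T_def by (rule sum.swap)
    finally have T: "T = - T" .
    have "fscale 2 T = fscale 1 T + fscale 1 T"
      unfolding fun_space.scale_left_distrib[symmetric] by simp
    also have "\<dots> = T + - T" using T by simp
    finally have "T = 0" using two_neq_0 by simp
    with dd show ?thesis by (simp add: T_def)
  qed
qed

end

section \<open>Exactness of the single factors implies acyclicity\<close>

context xmodule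
begin

text \<open>
  Exactness of each single periodic complex, on the vectors killed by all \<open>X\<^sub>i\<close> with \<open>i > q\<close>; this is
  what an induction on the largest index occurring in a cocycle needs.
\<close>

definition free :: bool where
  "free \<longleftrightarrow> (\<forall>q w v h. h \<ge> 1 \<longrightarrow> v \<in> W w \<longrightarrow> (\<forall>i>q. X i v = 0) \<longrightarrow> Dop p X q (Suc h) v = 0 \<longrightarrow>
     (\<exists>u \<in> W (w + 2 * wt_inc p q h). (\<forall>i>q. X i u = 0) \<and> Dop p X q h u = v))"

lemma freeD:
  assumes "free" "h \<ge> 1" "v \<in> W w" "\<And>i. i > q \<Longrightarrow> X i v = 0" "Dop p X q (Suc h) v = 0"
  obtains u where "u \<in> W (w + 2 * wt_inc p q h)" "\<And>i. i > q \<Longrightarrow> X i u = 0" "Dop p X q h u = v"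
  using assms unfolding free_def by blast

lemma K_supp: "\<phi> \<in> K n w \<Longrightarrow> \<phi> e \<noteq> 0 \<Longrightarrow> finite {i. e i \<noteq> 0}"
  and K_deg: "\<phi> \<in> K n w \<Longrightarrow> \<phi> e \<noteq> 0 \<Longrightarrow> deg e = n"
  using K_D by blast+

lemma up_at: "up e i i = Suc (e i)"
  by (simp add: up_def)

lemma dl_up:
  assumes "\<phi> \<in> K n w" "\<And>j. j \<noteq> q \<Longrightarrow> e j \<noteq> 0 \<Longrightarrow> \<phi> (dn e j) = 0" "e q \<noteq> 0" "finite {i. e i \<noteq> 0}"
  shows "\<delta> \<phi> e = fscale (sg e q) (Dop p X q (e q) (\<phi> (dn e q)))"
proof -
  have "\<delta> \<phi> e = (\<Sum>i\<in>{q}. fscale (sg e i) (Dop p X i (e i) (\<phi> (dn e i))))"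
    unfolding dl_def using assms by (intro sum.mono_neutral_right) auto
  then show ?thesis by simp
qed

text \<open>Outer induction on the number of indices involved, inner induction on the largest
  exponent at the top index \<open>q\<close>. The coefficients of largest exponent are cocycles of
  the \<open>q\<close>-th periodic complex, hence boundaries there by \<open>free\<close>;
  subtracting the boundary of their preimages lowers that exponent. The preimages are killed by X_i
  for i > q, so no larger index appears.\<close>

lemma cocycle_is_boundary_bounded:
  assumes free
  shows "\<xi> \<in> K (Suc n) w \<Longrightarrow> \<delta> \<xi> = 0 \<Longrightarrow> (\<And>e i. i \<ge> r \<Longrightarrow> X i (\<xi> e) = 0) \<Longrightarrow>
    (\<And>e i. \<xi> e \<noteq> 0 \<Longrightarrow> i \<ge> r \<Longrightarrow> e i = 0) \<Longrightarrow> \<exists>\<eta>\<in>K n w. \<delta> \<eta> = \<xi>"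
proof (induction r arbitrary: \<xi>)
  \<comment> \<open>Only the zero cell could carry a coefficient, and it has degree 0 rather than
    \<open>Suc n\<close>.\<close>
  case 0
  have "\<xi> e = 0" for e
  proof (rule ccontr)
    assume e: "\<xi> e \<noteq> 0"
    then have "deg e = Suc n" using K_D[OF 0(1)] by blast
    moreover have "e = (\<lambda>_. 0)" using 0(4)[OF e] by auto
    ultimately show False by (simp add: deg_def)
  qed
  then have "\<xi> = 0" by (simp add: fun_eq_iff)
  then show ?case using K_0 dl_0 by blast
next
  case (Suc q)
  have inner: "\<exists>\<eta>\<in>K n w. \<delta> \<eta> = \<xi>"
    if "\<xi> \<in> K (Suc n) w" "\<delta> \<xi> = 0" "\<And>e i. i \<ge> Suc q \<Longrightarrow> X i (\<xi> e) = 0"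
      "\<And>e i. \<xi> e \<noteq> 0 \<Longrightarrow> i \<ge> Suc q \<Longrightarrow> e i = 0" "\<And>e. \<xi> e \<noteq> 0 \<Longrightarrow> e q \<le> h" for \<xi> h
    using that
  proof (induction h arbitrary: \<xi>)
    case 0
    \<comment> \<open>With no exponent left at \<open>q\<close>, the cell \<open>up e q\<close>
      receives from \<open>\<xi>\<close> only the term X_q; so \<open>q\<close> drops out and the
      outer hypothesis applies.\<close>
    have Xq: "X q (\<xi> e) = 0" for e
    proof (cases "\<xi> e = 0")
      case False
      let ?e = "up e q"
      have eq: "e q = 0" using 0(5)[OF False] by simp
      have "finite {i. dn ?e q i \<noteq> 0}" using K_D[OF 0(1), OF False] by simp
      then have fin: "finite {i. ?e i \<noteq> 0}"
        by (rule finite_supp_dnD)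
      have "\<delta> \<xi> ?e = fscale (sg ?e q) (Dop p X q (?e q) (\<xi> (dn ?e q)))"
      proof (rule dl_up[OF 0(1)])
        fix j assume "j \<noteq> q"
        then have "dn ?e j q \<noteq> 0" by (simp add: dn_def up_def)
        then show "\<xi> (dn ?e j) = 0" using 0(5)[of "dn ?e j"] by (metis le_zero_eq)
      qed (use fin in \<open>auto simp: up_def\<close>)
      then have "fscale (sg ?e q) (Dop p X q 1 (\<xi> e)) = 0"
        unfolding 0(2) zero_fun_apply by (simp only: up_at eq dn_up One_nat_def)
      then have "fscale (sg ?e q * sg ?e q) (Dop p X q 1 (\<xi> e)) = 0"
        by (metis fun_space.scale_scale fun_space.scale_zero_right)
      then show ?thesis by (simp add: Dop_def)
    qed simp
    show ?case
    proof (rule Suc.IH[OF 0(1,2)])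
      show "X i (\<xi> e) = 0" if "i \<ge> q" for e i
        using that Xq 0(3) by (metis Suc_leI le_neq_implies_less)
      show "e i = 0" if "\<xi> e \<noteq> 0" "i \<ge> q" for e i
        using that 0(4)[OF that(1)] 0(5)[OF that(1)] by (metis Suc_leI le_neq_implies_less le_zero_eq)
    qed
  next
    case (Suc h \<xi>)
    have "\<exists>u\<in>W (w - 2 * wt p e + 2 * wt_inc p q (Suc h)). (\<forall>i>q. X i u = 0) \<and> Dop p X q (Suc h) u = \<xi> e"
      if eq: "e q = Suc h" and nz: "\<xi> e \<noteq> 0" for e
    proof -
      let ?e = "up e q"
      have "finite {i. dn ?e q i \<noteq> 0}" using K_D[OF Suc.prems(1), OF nz] by simp
      then have fin: "finite {i. ?e i \<noteq> 0}"
        by (rule finite_supp_dnD)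
      have "\<delta> \<xi> ?e = fscale (sg ?e q) (Dop p X q (?e q) (\<xi> (dn ?e q)))"
      proof (rule dl_up[OF Suc.prems(1)])
        fix j assume "j \<noteq> q"
        then have "dn ?e j q = Suc (Suc h)" using eq by (simp add: dn_def up_def)
        then show "\<xi> (dn ?e j) = 0" using Suc.prems(5)[of "dn ?e j"] by (metis Suc_n_not_le_n le_Suc_eq)
      qed (use fin in \<open>auto simp: up_def\<close>)
      then have "fscale (sg ?e q) (Dop p X q (Suc (Suc h)) (\<xi> e)) = 0"
        unfolding Suc.prems(2) zero_fun_apply by (simp only: up_at eq dn_up)
      then have "fscale (sg ?e q * sg ?e q) (Dop p X q (Suc (Suc h)) (\<xi> e)) = 0"
        by (metis fun_space.scale_scale fun_space.scale_zero_right)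
      \<comment> \<open>In the cell \<open>up e q\<close> all other terms would come from exponent h
        + 2 at \<open>q\<close>, which exceeds the maximum.\<close>
      then have D: "Dop p X q (Suc (Suc h)) (\<xi> e) = 0" by simp
      have Xi: "X i (\<xi> e) = 0" if "i > q" for i
        using Suc.prems(3)[OF Suc_leI[OF that]] .
      obtain u where "u \<in> W (w - 2 * wt p e + 2 * wt_inc p q (Suc h))"
        "\<And>i. i > q \<Longrightarrow> X i u = 0" "Dop p X q (Suc h) u = \<xi> e"
        using freeD[OF \<open>free\<close> _ K_W[OF Suc.prems(1)] Xi D] by auto
      then show ?thesis by blast
    qed
    then obtain u where u: "\<And>e. e q = Suc h \<Longrightarrow> \<xi> e \<noteq> 0 \<Longrightarrow> u e \<in> W (w - 2 * wt p e + 2 * wt_inc p q (Suc h))"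
      "\<And>e i. e q = Suc h \<Longrightarrow> \<xi> e \<noteq> 0 \<Longrightarrow> i > q \<Longrightarrow> X i (u e) = 0"
      "\<And>e. e q = Suc h \<Longrightarrow> \<xi> e \<noteq> 0 \<Longrightarrow> Dop p X q (Suc h) (u e) = \<xi> e"
      by metis
    \<comment> \<open>The preimages are placed one step below in direction \<open>q\<close>; the
      sign cancels the one in the differential, as its square is 1.\<close>
    define \<eta> where "\<eta> e = (if e q = h \<and> \<xi> (up e q) \<noteq> 0 then fscale (sg (up e q) q) (u (up e q)) else 0)" for e
    have \<eta>D: "e q = h" "\<xi> (up e q) \<noteq> 0" "up e q q = Suc h" if "\<eta> e \<noteq> 0" for e
      using that by (auto simp: \<eta>_def up_def split: if_splits)
    have X\<eta>: "X i (\<eta> e) = 0" if "i > q" for i e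
    proof (cases "\<eta> e = 0")
      case False
      note d = \<eta>D[OF False]
      show ?thesis
        using d u(1,2)[OF d(3,2)] that lin_on_scale[OF sub X_lin] by (simp add: \<eta>_def)
    qed simp
    have \<eta>K: "\<eta> \<in> K n w"
    proof -
      have "{e. \<eta> e \<noteq> 0} \<subseteq> (\<lambda>e. dn e q) ` {e. \<xi> e \<noteq> 0}"
      proof
        fix e assume "e \<in> {e. \<eta> e \<noteq> 0}"
        then have "\<xi> (up e q) \<noteq> 0" using \<eta>D(2) by blast
        then show "e \<in> (\<lambda>e. dn e q) ` {e. \<xi> e \<noteq> 0}"
          by (intro image_eqI[of _ _ "up e q"]) simp_all
      qed
      then have "finite {e. \<eta> e \<noteq> 0}"
        using finite_imageI[OF K_fin[OF Suc.prems(1)]] by (rule finite_subset)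
      moreover have "finite {i. e i \<noteq> 0} \<and> deg e = n" if "\<eta> e \<noteq> 0" for e
      proof -
        note d = \<eta>D[OF that]
        have "finite {i. up e q i \<noteq> 0}" "deg (up e q) = Suc n"
          by (rule K_supp[OF Suc.prems(1), OF d(2)], rule K_deg[OF Suc.prems(1), OF d(2)])
        then show ?thesis
          using deg_dn[of "up e q" q] finite_supp_dn[of "up e q" q] d(3) by simp
      qed
      moreover have "\<eta> e \<in> W (w - 2 * wt p e)" for e
      proof (cases "\<eta> e = 0")
        case True
        then show ?thesis using fun_space.subspace_0[OF sub] by simp
      next
        case False
        note d = \<eta>D[OF False]
        have "wt p (up e q) = wt p e + wt_inc p q (Suc h)"
          using wt_dn[of p "up e q" q] K_supp[OF Suc.prems(1), OF d(2)] d(3) p_ge_2 by simp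
        then show ?thesis
          using u(1)[OF d(3,2)] d fun_space.subspace_scale[OF sub] by (simp add: \<eta>_def)
      qed
      ultimately show ?thesis by (simp add: cochains_def)
    qed
    have d\<eta>K: "\<delta> \<eta> \<in> K (Suc n) w" using dl_K[OF \<eta>K] .
    have X_dl: "X i (\<delta> \<eta> e) = 0" if "i > q" for i e
    proof (cases "finite {i. e i \<noteq> 0}")
      case True
      have "X i (\<delta> \<eta> e) = (\<Sum>j | e j \<noteq> 0. fscale (sg e j) (X i (Dop p X j (e j) (\<eta> (dn e j)))))"
        unfolding dl_def using dl_term_W[OF \<eta>K True] by (intro lin_on_sum_scale[OF sub X_lin]) auto
      also have "\<dots> = 0"
        using Dop_X_comm[OF K_W[OF \<eta>K]] X\<eta>[OF that] by simp
      finally show ?thesis .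
    qed (simp add: dl_def)
    \<comment> \<open>\<open>\<eta>\<close> has no exponents above \<open>q\<close>, so one in its
      boundary would come from raising index i > q, that is from X_i or its power, which kill
      \<open>\<eta>\<close>.\<close>
    have supp_dl: "e i = 0" if ne: "\<delta> \<eta> e \<noteq> 0" and i: "i \<ge> Suc q" for e i
    proof (rule ccontr)
      assume ei: "e i \<noteq> 0"
      obtain j where j: "finite {i. e i \<noteq> 0}" "e j \<noteq> 0" "Dop p X j (e j) (\<eta> (dn e j)) \<noteq> 0"
        using dl_nonzeroD[OF ne] .
      then have "\<eta> (dn e j) \<noteq> 0" by auto
      note d = \<eta>D[OF this]
      have "up (dn e j) q i = 0" using Suc.prems(4)[OF d(2) i] .
      then have "dn e j i = 0" using i by (simp add: up_def)
      then have "j = i" using ei by (auto simp: dn_def split: if_splits)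
      have "X i (\<eta> (dn e i)) = 0" using X\<eta> i by simp
      from Dop_eq_0[OF K_W[OF \<eta>K] this] show False
        using j(3) \<open>j = i\<close> by simp
    qed
    \<comment> \<open>\<open>\<eta>\<close> lives at exponent \<open>h\<close> only, so a cell with
      a larger exponent is reached only in direction \<open>q\<close>.\<close>
    have dl_high: "\<delta> \<eta> e = \<xi> e" if eq: "e q \<ge> Suc h" for e
    proof (cases "finite {i. e i \<noteq> 0}")
      case False
      have "\<delta> \<eta> e = 0" using False by (simp add: dl_def)
      moreover have "\<xi> e = 0" using False K_supp[OF Suc.prems(1), of e] by blast
      ultimately show ?thesis by metis
    next
      case fin: True
      have 1: "\<eta> (dn e j) = 0" if "j \<noteq> q" for j
        using \<eta>D[of "dn e j"] that eq by (force simp: dn_def)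
      have *: "\<delta> \<eta> e = fscale (sg e q) (Dop p X q (e q) (\<eta> (dn e q)))"
        using eq by (intro dl_up[OF \<eta>K 1 _ fin]) auto
      have up: "up (dn e q) q = e" using eq by (intro up_dn) auto
      show ?thesis
      proof (cases "e q = Suc h \<and> \<xi> e \<noteq> 0")
        case True
        then have "\<eta> (dn e q) = fscale (sg e q) (u e)"
          by (simp add: \<eta>_def up) (simp add: dn_def)
        then have "\<delta> \<eta> e = fscale (sg e q * sg e q) (Dop p X q (Suc h) (u e))"
          using True lin_on_scale[OF sub Dop_lin u(1)] by (simp add: *)
        then show ?thesis using u(3) True by simp
      next
        case False
        moreover have "dn e q q = e q - 1" by (simp add: dn_def)
        ultimately have "\<not> (dn e q q = h \<and> \<xi> (up (dn e q) q) \<noteq> 0)"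
          unfolding up using eq by linarith
        then have "\<eta> (dn e q) = 0"
          unfolding \<eta>_def by (rule if_not_P)
        moreover have "\<xi> e = 0"
          using False eq Suc.prems(5)[of e] by (metis le_antisym)
        ultimately show ?thesis unfolding * by (simp only: Dop_0 fun_space.scale_zero_right)
      qed
    qed
    have "\<exists>\<eta>'\<in>K n w. \<delta> \<eta>' = \<xi> - \<delta> \<eta>"
    proof (rule Suc.IH)
      show "\<xi> - \<delta> \<eta> \<in> K (Suc n) w" using K_diff[OF Suc.prems(1) d\<eta>K] .
      show "\<delta> (\<xi> - \<delta> \<eta>) = 0"
        unfolding dl_diff[OF Suc.prems(1) d\<eta>K] Suc.prems(2) dl_dl[OF \<eta>K] by (rule diff_self)
      show "X i ((\<xi> - \<delta> \<eta>) e) = 0" if "i \<ge> Suc q" for e i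
        using that X_dl Suc.prems(3)
          lin_on_diff[OF sub X_lin K_W[OF Suc.prems(1)] K_W[OF d\<eta>K], of i e]
        by (metis Suc_le_lessD diff_self fun_diff_def)
      show "e i = 0" if "(\<xi> - \<delta> \<eta>) e \<noteq> 0" "i \<ge> Suc q" for e i
        using that supp_dl Suc.prems(4) by (metis diff_self fun_diff_def)
      show "e q \<le> h" if "(\<xi> - \<delta> \<eta>) e \<noteq> 0" for e
        using that dl_high[of e] by (metis diff_self fun_diff_def not_less_eq_eq)
    qed
    then obtain \<eta>' where \<eta>': "\<eta>' \<in> K n w" "\<delta> \<eta>' = \<xi> - \<delta> \<eta>" by blast
    have "\<delta> (\<eta>' + \<eta>) = \<xi>"
      unfolding dl_add[OF \<eta>'(1) \<eta>K] \<eta>'(2) by (rule diff_add_cancel)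
    then show ?case using K_add[OF \<eta>'(1) \<eta>K] by blast
  qed
  have "\<exists>h. \<forall>e\<in>{e. \<xi> e \<noteq> 0}. \<forall>i\<ge>h. e q \<le> i"
    by (intro finite_uniform_bound K_fin[OF Suc.prems(1)]) auto
  then obtain h where "\<And>e. \<xi> e \<noteq> 0 \<Longrightarrow> e q \<le> h" by auto
  then show ?case using inner[of \<xi> h] Suc.prems by blast
qed

lemma free_acyclic:
  assumes free
  shows "acyclic_at p X W (Suc n) w"
  unfolding acyclic_at_def
proof (intro ballI impI)
  fix \<xi> assume \<xi>: "\<xi> \<in> K (Suc n) w" "\<delta> \<xi> = 0"
  obtain r1 where r1: "\<And>e i. i \<ge> r1 \<Longrightarrow> X i (\<xi> e) = 0" using X_fin_uniform[OF \<xi>(1)] by blast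
  have "\<exists>r. \<forall>e\<in>{e. \<xi> e \<noteq> 0}. \<forall>i\<ge>r. e i = 0"
  proof (rule finite_uniform_bound[OF K_fin[OF \<xi>(1)]])
    fix e assume "e \<in> {e. \<xi> e \<noteq> 0}"
    then have "finite {i. e i \<noteq> 0}" using K_supp[OF \<xi>(1)] by blast
    then show "\<exists>r. \<forall>i\<ge>r. e i = 0" 
      by (metis (mono_tags, lifting) finite_nat_set_iff_bounded mem_Collect_eq not_le)
  qed
  then obtain r2 where r2: "\<And>e i. \<xi> e \<noteq> 0 \<Longrightarrow> i \<ge> r2 \<Longrightarrow> e i = 0" by auto
  have "\<exists>\<eta>\<in>K n w. \<delta> \<eta> = \<xi>"
    using r1 r2 by (intro cocycle_is_boundary_bounded[OF assms \<xi>, of "max r1 r2"]) auto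
  then show "\<xi> \<in> cobounds p X W (Suc n) w" by (auto simp: cobounds_def)
qed

end

text \<open>Coefficients are lifted one by one; choosing 0 over 0 keeps the support finite.\<close>

lemma cochain_lift:
  assumes \<psi>: "\<psi> \<in> cochains p W' n w'" and "g 0 = 0"
    and sub: "\<And>w. fun_space.subspace (W w)"
    and ex: "\<And>e. \<exists>u\<in>W (w - 2 * wt p e). g u = \<psi> e"
  shows "\<exists>\<phi>\<in>cochains p W n w. \<forall>e. g (\<phi> e) = \<psi> e"
proof -
  obtain u where u: "\<And>e. u e \<in> W (w - 2 * wt p e)" "\<And>e. g (u e) = \<psi> e"
    using ex by metis
  define \<phi> where "\<phi> e = (if \<psi> e = 0 then 0 else u e)" for e
  have nz: "\<psi> e \<noteq> 0" if "\<phi> e \<noteq> 0" for e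
    using that by (metis \<phi>_def)
  have "finite {e. \<psi> e \<noteq> 0}" using \<psi> by (simp add: cochains_def)
  then have "finite {e. \<phi> e \<noteq> 0}"
    by (rule rev_finite_subset) (use nz in blast)
  moreover have "\<phi> e \<in> W (w - 2 * wt p e)" for e
    using u(1) fun_space.subspace_0[OF sub] by (simp add: \<phi>_def)
  moreover have "finite {i. e i \<noteq> 0} \<and> deg e = n" if "\<phi> e \<noteq> 0" for e
    using nz[OF that] \<psi> unfolding cochains_def by blast
  moreover have "g (\<phi> e) = \<psi> e" for e
    using u(2) \<open>g 0 = 0\<close> by (simp add: \<phi>_def)
  ultimately show ?thesis
    unfolding cochains_def by blast
qed

text \<open>This says that the cohomology of degree \<open>n\<close> and weight \<open>w\<close> has dimension at most \<open>b\<close>.\<close>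

definition dep_at :: "nat \<Rightarrow> (nat \<Rightarrow> ('i \<Rightarrow> 'k) \<Rightarrow> ('i \<Rightarrow> 'k)) \<Rightarrow> (int \<Rightarrow> ('i \<Rightarrow> 'k::field) set) \<Rightarrow>
    nat \<Rightarrow> int \<Rightarrow> nat \<Rightarrow> bool" where
  "dep_at p X W n w b \<longleftrightarrow>
     (\<forall>z. (\<forall>i\<le>b. z i \<in> cochains p W n w \<and> dl p X (z i) = 0) \<longrightarrow>
       (\<exists>c. (\<exists>i\<le>b. c i \<noteq> 0) \<and> (\<lambda>e. \<Sum>i\<le>b. fscale (c i) (z i e)) \<in> cobounds p X W n w))"

section \<open>Morphisms with a weight shift, connecting maps and dimension shifting\<close>

locale xmodule_hom = Y: xmodule p X W + Z: xmodule p X' W'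
  for p and X :: "nat \<Rightarrow> ('i \<Rightarrow> 'k::field) \<Rightarrow> ('i \<Rightarrow> 'k)" and W
    and X' :: "nat \<Rightarrow> ('j \<Rightarrow> 'k) \<Rightarrow> ('j \<Rightarrow> 'k)" and W' +
  fixes f :: "('i \<Rightarrow> 'k) \<Rightarrow> ('j \<Rightarrow> 'k)" and k :: int
  assumes f_W: "v \<in> W w \<Longrightarrow> f v \<in> W' (w - k)"
    and f_lin: "lin_on (W w) f"
    and f_X: "v \<in> W w \<Longrightarrow> f (X i v) = X' i (f v)"
begin

lemma f_0 [simp]: "f 0 = 0"
  using lin_on_0[OF Y.sub f_lin] .

lemma f_Xpow: "v \<in> W w \<Longrightarrow> f ((X i ^^ n) v) = (X' i ^^ n) (f v)"
proof (induction n)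
  case (Suc n)
  then show ?case using f_X[OF Y.Xpow_W[OF Suc.prems]] by simp
qed simp

lemma f_Dop: "v \<in> W w \<Longrightarrow> f (Dop p X i h v) = Dop p X' i h (f v)"
  using f_X f_Xpow by (simp add: Dop_def)

lemma hom_K:
  assumes "\<phi> \<in> Y.K n w"
  shows "(\<lambda>e. f (\<phi> e)) \<in> Z.K n (w - k)"
proof -
  have nz: "\<phi> e \<noteq> 0" if "f (\<phi> e) \<noteq> 0" for e using that f_0 by metis
  have "finite {e. f (\<phi> e) \<noteq> 0}"
    using Y.K_fin[OF assms] by (rule rev_finite_subset) (use nz in blast)
  moreover have "f (\<phi> e) \<in> W' (w - k - 2 * wt p e)" for e
    using f_W[OF Y.K_W[OF assms], of e] by (simp add: algebra_simps)
  ultimately show ?thesis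
    unfolding cochains_def using nz Y.K_D[OF assms] by blast
qed

lemma hom_dl:
  assumes "\<phi> \<in> Y.K n w"
  shows "Z.\<delta> (\<lambda>e. f (\<phi> e)) = (\<lambda>e. f (Y.\<delta> \<phi> e))"
proof
  fix e
  show "Z.\<delta> (\<lambda>e. f (\<phi> e)) e = f (Y.\<delta> \<phi> e)"
  proof (cases "finite {i. e i \<noteq> 0}")
    case True
    have "f (Y.\<delta> \<phi> e) = (\<Sum>i | e i \<noteq> 0. fscale (sg e i) (f (Dop p X i (e i) (\<phi> (dn e i)))))"
      unfolding dl_def
      by (rule lin_on_sum_scale[OF Y.sub f_lin]) (use Y.dl_term_W[OF assms True] in auto)
    then show ?thesis
      by (simp only: dl_def f_Dop[OF Y.K_W[OF assms]])
  qed (simp add: dl_def)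
qed

end

locale xmodule_epi = xmodule_hom +
  assumes f_surj: "z \<in> W' (w - k) \<Longrightarrow> \<exists>y\<in>W w. f y = z"
begin

lemma lift_K:
  assumes "\<psi> \<in> Z.K n (w - k)"
  shows "\<exists>\<phi>\<in>Y.K n w. (\<lambda>e. f (\<phi> e)) = \<psi>"
proof -
  have "\<exists>u\<in>W (w - 2 * wt p e). f u = \<psi> e" for e
    using f_surj[of "\<psi> e" "w - 2 * wt p e"] Z.K_W[OF assms, of e] by (simp add: algebra_simps)
  then obtain \<phi> where "\<phi> \<in> Y.K n w" "\<And>e. f (\<phi> e) = \<psi> e"
    using cochain_lift[where g = f and W = W and w = w, OF assms f_0 Y.sub] by blast
  then show ?thesis by blast
qed

definition kerW :: "int \<Rightarrow> ('a \<Rightarrow> 'b) set" where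
  "kerW w = {v \<in> W w. f v = 0}"

lemma xmodule_kerW: "xmodule p X kerW"
proof
  show "fun_space.subspace (kerW w)" for w
    using Y.sub[of w] lin_on_add[OF Y.sub f_lin] lin_on_scale[OF Y.sub f_lin]
    by (auto simp: fun_space.subspace_def kerW_def)
  show "lin_on (kerW w) (X i)" for w i
    by (rule lin_on_subset[OF Y.X_lin]) (auto simp: kerW_def)
qed (use Y.p_ge_2 Y.two_neq_0 Y.X_W Y.X_comm Y.X_pow Y.X_fin f_X in \<open>auto simp: kerW_def\<close>)

lemma kerW_K:
  assumes "\<phi> \<in> Y.K n w" "\<And>e. f (\<phi> e) = 0"
  shows "\<phi> \<in> cochains p kerW n w"
  using assms by (simp add: cochains_def kerW_def)

lemma K_kerW: "\<phi> \<in> cochains p kerW n w \<Longrightarrow> \<phi> \<in> Y.K n w"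
  by (simp add: cochains_def kerW_def)

lemma f_K_kerW: "\<phi> \<in> cochains p kerW n w \<Longrightarrow> f (\<phi> e) = 0"
  by (simp add: cochains_def kerW_def)

text \<open>The chase behind the connecting homomorphism: boundaries of lifts of the
  \<open>z i\<close> lie in the kernel, where the dependence hypothesis gives a relation among them
  modulo coboundaries.\<close>

lemma connecting:
  assumes dep: "dep_at p X kerW (Suc n) w b"
    and z: "\<And>i. i \<le> b \<Longrightarrow> z i \<in> Z.K n (w - k)" "\<And>i. i \<le> b \<Longrightarrow> Z.\<delta> (z i) = 0"
  shows "\<exists>c. (\<exists>i\<le>b. c i \<noteq> 0) \<and>
    (\<exists>y\<in>Y.K n w. Y.\<delta> y = 0 \<and> (\<lambda>e. f (y e)) = (\<lambda>e. \<Sum>i\<le>b. fscale (c i) (z i e)))"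
proof -
  obtain y where y: "\<And>i. i \<le> b \<Longrightarrow> y i \<in> Y.K n w" "\<And>i. i \<le> b \<Longrightarrow> (\<lambda>e. f (y i e)) = z i"
    using lift_K[OF z(1)] by metis
  have ker: "Y.\<delta> (y i) \<in> cochains p kerW (Suc n) w" if "i \<le> b" for i
  proof (rule kerW_K[OF Y.dl_K[OF y(1)[OF that]]])
    show "f (Y.\<delta> (y i) e) = 0" for e
      using fun_cong[OF hom_dl[OF y(1)[OF that]], of e] unfolding y(2)[OF that] z(2)[OF that]
      by (metis zero_fun_apply)
  qed
  have "\<forall>i\<le>b. Y.\<delta> (y i) \<in> cochains p kerW (Suc n) w \<and> dl p X (Y.\<delta> (y i)) = 0"
    using ker Y.dl_dl[OF y(1)] by blast
  then obtain c where c: "\<exists>i\<le>b. c i \<noteq> 0"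
    and "(\<lambda>e. \<Sum>i\<le>b. fscale (c i) (Y.\<delta> (y i) e)) \<in> cobounds p X kerW (Suc n) w"
    using dep[unfolded dep_at_def, rule_format, of "\<lambda>i. Y.\<delta> (y i)"] by blast
  then obtain x where x: "x \<in> cochains p kerW n w"
    "(\<lambda>e. \<Sum>i\<le>b. fscale (c i) (Y.\<delta> (y i) e)) = Y.\<delta> x"
    by (auto simp: cobounds_def)
  \<comment> \<open>\<open>s\<close> and the kernel cochain \<open>x\<close> have the same boundary,
    so \<open>s - x\<close> is a cocycle over the same combination of the
    \<open>z i\<close>.\<close>
  define s where "s = (\<lambda>e. \<Sum>i\<le>b. fscale (c i) (y i e))"
  have s: "s \<in> Y.K n w" unfolding s_def using y(1) by (intro Y.K_lincomb) auto
  have ds: "Y.\<delta> s = Y.\<delta> x"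
    unfolding s_def x(2)[symmetric] using y(1) by (intro Y.dl_lincomb) auto
  have "Y.\<delta> (s - x) = 0"
    unfolding Y.dl_diff[OF s K_kerW[OF x(1)]] ds by (rule diff_self)
  moreover have "f ((s - x) e) = (\<Sum>i\<le>b. fscale (c i) (z i e))" for e
  proof -
    have "f ((s - x) e) = f (s e) - f (x e)"
      by (rule trans[OF arg_cong[of _ _ f, OF minus_apply]],
          rule lin_on_diff[OF Y.sub f_lin Y.K_W[OF s] Y.K_W[OF K_kerW[OF x(1)]]])
    also have "\<dots> = f (s e)" unfolding f_K_kerW[OF x(1)] by (rule diff_0_right)
    also have "\<dots> = (\<Sum>i\<le>b. fscale (c i) (f (y i e)))"
      unfolding s_def using Y.K_W[OF y(1)] by (intro lin_on_sum_scale[OF Y.sub f_lin]) auto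
    also have "\<dots> = (\<Sum>i\<le>b. fscale (c i) (z i e))"
      by (intro sum.cong refl) (metis y(2) atMost_iff)
    finally show ?thesis .
  qed
  ultimately show ?thesis
    using c Y.K_diff[OF s K_kerW[OF x(1)]] by blast
qed

text \<open>When the middle term has no cohomology in degree \<open>n\<close>, the connecting map
  from degree \<open>n\<close> of the quotient to degree \<open>Suc n\<close> of the kernel is
  injective, so bounds pass back along it.\<close>

lemma dep_transfer:
  assumes dep: "dep_at p X kerW (Suc n) w b" and ac: "acyclic_at p X W n w"
  shows "dep_at p X' W' n (w - k) b"
  unfolding dep_at_def
proof (intro allI impI)
  fix z assume z: "\<forall>i\<le>b. z i \<in> Z.K n (w - k) \<and> Z.\<delta> (z i) = 0"
  obtain c y where c: "\<exists>i\<le>b. c i \<noteq> 0" and y: "y \<in> Y.K n w" "Y.\<delta> y = 0"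
    "(\<lambda>e. f (y e)) = (\<lambda>e. \<Sum>i\<le>b. fscale (c i) (z i e))"
    using connecting[OF dep, of z] z by blast
  have "(\<lambda>e. f (y e)) \<in> cobounds p X' W' n (w - k)"
  proof (cases n)
    case 0
    then have "y = 0" using ac y by (simp add: acyclic_at_def cobounds_def)
    then have "(\<lambda>e. f (y e)) = 0" by (simp only: zero_fun_apply f_0) (rule zero_fun_def[symmetric])
    then show ?thesis using 0 by (simp add: cobounds_def)
  next
    case (Suc m)
    then obtain u where u: "u \<in> Y.K m w" "y = Y.\<delta> u"
      using ac y by (auto simp: acyclic_at_def cobounds_def)
    then have "(\<lambda>e. f (y e)) = Z.\<delta> (\<lambda>e. f (u e))" using hom_dl[OF u(1)] by simp
    then show ?thesis using Suc hom_K[OF u(1)] unfolding cobounds_def by simp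
  qed
  then show "\<exists>c. (\<exists>i\<le>b. c i \<noteq> 0) \<and> (\<lambda>e. \<Sum>i\<le>b. fscale (c i) (z i e)) \<in> cobounds p X' W' n (w - k)"
    using c unfolding y(3) by blast
qed

text \<open>The difference of \<open>\<eta>\<close> and \<open>\<kappa>\<close> dies in the
  quotient, so it comes from a cochain of the submodule, and injectivity identifies the boundary of
  that cochain with \<open>\<xi>\<close>. The shift \<open>j\<close> is 0 for orbit maps and 1 for
  multiplication by d.\<close>

lemma divide_boundary:
  assumes "xmodule_hom p XM WM X W \<iota> j"
    and inj: "\<And>v w. v \<in> WM w \<Longrightarrow> \<iota> v = 0 \<Longrightarrow> v = 0"
    and ex: "\<And>v w. v \<in> W (w - j) \<Longrightarrow> f v = 0 \<Longrightarrow> \<exists>u\<in>WM w. \<iota> u = v"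
    and \<xi>: "\<xi> \<in> cochains p WM (Suc n) w"
    and \<eta>: "\<eta> \<in> Y.K n (w - j)" "Y.\<delta> \<eta> = (\<lambda>e. \<iota> (\<xi> e))"
    and \<kappa>: "\<kappa> \<in> Y.K n (w - j)" "Y.\<delta> \<kappa> = 0" "\<And>e. f (\<kappa> e) = f (\<eta> e)"
  shows "\<exists>\<mu>\<in>cochains p WM n w. dl p XM \<mu> = \<xi>"
proof -
  interpret M: xmodule_hom p XM WM X W \<iota> j by fact
  have D: "\<eta> - \<kappa> \<in> Y.K n (w - j)" using Y.K_diff[OF \<eta>(1) \<kappa>(1)] .
  have dD: "Y.\<delta> (\<eta> - \<kappa>) = (\<lambda>e. \<iota> (\<xi> e))"
    unfolding Y.dl_diff[OF \<eta>(1) \<kappa>(1)] \<kappa>(2) \<eta>(2) by (rule diff_0_right)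
  have "f ((\<eta> - \<kappa>) e) = 0" for e
  proof -
    have "f ((\<eta> - \<kappa>) e) = f (\<eta> e) - f (\<kappa> e)"
      by (rule trans[OF arg_cong[of _ _ f, OF minus_apply]],
          rule lin_on_diff[OF Y.sub f_lin Y.K_W[OF \<eta>(1)] Y.K_W[OF \<kappa>(1)]])
    then show ?thesis unfolding \<kappa>(3) by (simp only: diff_self)
  qed
  then have "\<exists>u\<in>WM (w - 2 * wt p e). \<iota> u = (\<eta> - \<kappa>) e" for e
    using ex[of "(\<eta> - \<kappa>) e" "w - 2 * wt p e"] Y.K_W[OF D, of e] by (simp add: algebra_simps)
  then obtain \<mu> where \<mu>: "\<mu> \<in> M.Y.K n w" "\<And>e. \<iota> (\<mu> e) = (\<eta> - \<kappa>) e"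
    using cochain_lift[where g = \<iota> and W = WM and w = w, OF D M.f_0 M.Y.sub] by blast
  have \<iota>\<mu>: "(\<lambda>e. \<iota> (\<mu> e)) = \<eta> - \<kappa>" using \<mu>(2) by (rule ext)
  have "M.Y.\<delta> \<mu> = \<xi>"
  proof
    fix e
    have "\<iota> (M.Y.\<delta> \<mu> e) = \<iota> (\<xi> e)"
      using fun_cong[OF M.hom_dl[OF \<mu>(1)], of e] fun_cong[OF dD, of e] unfolding \<iota>\<mu> by metis
    then have "\<iota> (M.Y.\<delta> \<mu> e - \<xi> e) = 0"
      using lin_on_diff[OF M.Y.sub M.f_lin M.Y.K_W[OF M.Y.dl_K[OF \<mu>(1)]] M.Y.K_W[OF \<xi>], of e]
      by (metis diff_self)
    moreover have "M.Y.\<delta> \<mu> e - \<xi> e \<in> WM (w - 2 * wt p e)"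
      by (rule fun_space.subspace_diff[OF M.Y.sub M.Y.K_W[OF M.Y.dl_K[OF \<mu>(1)]] M.Y.K_W[OF \<xi>]])
    ultimately show "M.Y.\<delta> \<mu> e = \<xi> e" using inj by (metis eq_iff_diff_eq_0)
  qed
  then show ?thesis using \<mu>(1) by blast
qed

text \<open>The piece H^n(quotient) -> H^(n+1)(sub) -> H^(n+1)(middle) of the long exact sequence,
  with both outer terms zero.\<close>

lemma acyclic_shift:
  assumes \<iota>: "xmodule_hom p XM WM X W \<iota> 0"
    and inj: "\<And>v w. v \<in> WM w \<Longrightarrow> \<iota> v = 0 \<Longrightarrow> v = 0"
    and f\<iota>: "\<And>v w. v \<in> WM w \<Longrightarrow> f (\<iota> v) = 0"
    and ex: "\<And>v w. v \<in> W w \<Longrightarrow> f v = 0 \<Longrightarrow> \<exists>u\<in>WM w. \<iota> u = v"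
    and acZ: "acyclic_at p X' W' n (w - k)" and acY: "acyclic_at p X W (Suc n) w"
  shows "acyclic_at p XM WM (Suc n) w"
  unfolding acyclic_at_def
proof (intro ballI impI)
  interpret M: xmodule_hom p XM WM X W \<iota> 0 by fact
  fix \<xi> assume \<xi>: "\<xi> \<in> M.Y.K (Suc n) w" "M.Y.\<delta> \<xi> = 0"
  have \<iota>\<xi>: "(\<lambda>e. \<iota> (\<xi> e)) \<in> Y.K (Suc n) w" using M.hom_K[OF \<xi>(1)] by simp
  have "Y.\<delta> (\<lambda>e. \<iota> (\<xi> e)) = 0"
    unfolding M.hom_dl[OF \<xi>(1)] \<xi>(2) by (rule ext) (simp only: zero_fun_apply M.f_0)
  then obtain \<eta> where \<eta>: "\<eta> \<in> Y.K n w" "Y.\<delta> \<eta> = (\<lambda>e. \<iota> (\<xi> e))"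
    using acY \<iota>\<xi> by (fastforce simp: acyclic_at_def cobounds_def)
  have f\<eta>: "Z.\<delta> (\<lambda>e. f (\<eta> e)) = 0"
    unfolding hom_dl[OF \<eta>(1)] \<eta>(2) f\<iota>[OF M.Y.K_W[OF \<xi>(1)]] by (rule zero_fun_def[symmetric])
  \<comment> \<open>The image of \<open>\<eta>\<close> in the quotient is a boundary of some
    \<open>\<theta>\<close>; the boundary of a lift of \<open>\<theta>\<close> serves as
    \<open>\<kappa>\<close>. In degree 0 the image vanishes and \<open>\<kappa>\<close> is
    0.\<close>
  have "\<exists>\<kappa>\<in>Y.K n w. Y.\<delta> \<kappa> = 0 \<and> (\<forall>e. f (\<kappa> e) = f (\<eta> e))"
  proof (cases n)
    case 0
    then have "(\<lambda>e. f (\<eta> e)) = 0"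
      using acZ f\<eta> hom_K[OF \<eta>(1)] by (simp add: acyclic_at_def cobounds_def)
    then have "f (\<eta> e) = f (0 e)" for e unfolding zero_fun_apply f_0 by (metis zero_fun_apply)
    then show ?thesis using Y.K_0 Y.dl_0 by metis
  next
    case (Suc m)
    obtain \<theta> where \<theta>: "\<theta> \<in> Z.K m (w - k)" "(\<lambda>e. f (\<eta> e)) = Z.\<delta> \<theta>"
      using acZ f\<eta> hom_K[OF \<eta>(1)] Suc by (auto simp: acyclic_at_def cobounds_def)
    obtain \<theta>' where \<theta>': "\<theta>' \<in> Y.K m w" "(\<lambda>e. f (\<theta>' e)) = \<theta>"
      using lift_K[OF \<theta>(1)] by blast
    have "Y.\<delta> \<theta>' \<in> Y.K n w" using Y.dl_K[OF \<theta>'(1)] Suc by simp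
    moreover have "f (Y.\<delta> \<theta>' e) = f (\<eta> e)" for e
      using hom_dl[OF \<theta>'(1)] \<theta>(2) \<theta>'(2) by metis
    ultimately show ?thesis using Y.dl_dl[OF \<theta>'(1)] by blast
  qed
  then obtain \<kappa> where \<kappa>: "\<kappa> \<in> Y.K n w" "Y.\<delta> \<kappa> = 0" "\<And>e. f (\<kappa> e) = f (\<eta> e)" by blast
  have "\<exists>\<mu>\<in>cochains p WM n w. dl p XM \<mu> = \<xi>"
    by (rule divide_boundary[OF \<iota> inj _ \<xi>(1), where \<eta> = \<eta> and \<kappa> = \<kappa>]) (use ex \<eta> \<kappa> in simp_all)
  then show "\<xi> \<in> cobounds p XM WM (Suc n) w"
    by (auto simp: cobounds_def)
qed

end

section \<open>Divided powers and weights\<close>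

text \<open>Over a finite field, 1 plus the product of all x - a has no root.\<close>

lemma infinite_UNIV_alg_closed: "infinite (UNIV :: 'k::alg_closed_field set)"
proof
  assume fin: "finite (UNIV :: 'k set)"
  let ?P = "(\<Prod>a\<in>(UNIV :: 'k set). [:- a, 1:]) + 1"
  have "poly ?P x = 1" for x
    using fin by (simp add: poly_prod)
  moreover have "degree ?P > 0"
  proof -
    have "degree (\<Prod>a\<in>(UNIV :: 'k set). [:- a, 1:]) = card (UNIV :: 'k set)"
      by (subst degree_prod_eq_sum_degree) auto
    moreover have "card (UNIV :: 'k set) > 0" using fin by (simp add: card_gt_0_iff)
    ultimately show ?thesis by (simp add: degree_add_eq_left)
  qed
  ultimately show False
    using alg_closed_imp_poly_has_root[of ?P] by auto
qed

text \<open>A case of the theorem of Lucas. Replacing n by n + p^i adds 1 to both sides: on the left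
  by Vandermonde, where the inner binomials C(p^i, k) vanish modulo p.\<close>

lemma of_nat_choose_char:
  assumes p: "prime p" "CHAR('k::field) = p"
  shows "(of_nat (n choose (p ^ i)) :: 'k) = of_nat (n div (p ^ i))"
proof -
  let ?P = "p ^ i"
  have P: "?P > 0" using prime_gt_0_nat[OF p(1)] by simp
  have dvd: "p dvd (?P choose k)" if k: "0 < k" "k < ?P" for k
  proof (rule ccontr)
    assume "\<not> p dvd (?P choose k)"
    then have "coprime (?P choose k) ?P"
      using p(1) by (simp add: prime_imp_coprime coprime_commute)
    moreover have "?P dvd k * (?P choose k)"
      using times_binomial_minus1_eq[of k ?P] k by simp
    ultimately have "?P dvd k" by (simp add: coprime_dvd_mult_left_iff coprime_commute)
    with k show False using dvd_imp_le by fastforce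
  qed
  have step: "(of_nat ((n + ?P) choose ?P) :: 'k) = of_nat (n choose ?P) + 1" for n
  proof -
    have "(of_nat ((n + ?P) choose ?P) :: 'k) =
        (\<Sum>k\<le>?P. of_nat (?P choose k) * of_nat (n choose (?P - k)))"
      using vandermonde[where m = ?P and n = n and r = ?P]
      by (metis (no_types, lifting) add.commute of_nat_mult of_nat_sum sum.cong)
    also have "\<dots> = (\<Sum>k\<in>{0, ?P}. of_nat (?P choose k) * of_nat (n choose (?P - k)))"
    proof (rule sum.mono_neutral_right)
      show "\<forall>k\<in>{..?P} - {0, ?P}. of_nat (?P choose k) * of_nat (n choose (?P - k)) = (0::'k)"
        using dvd p(2) by (auto simp: of_nat_eq_0_iff_char_dvd)
    qed auto
    also have "\<dots> = of_nat (n choose ?P) + 1" using P by simp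
    finally show ?thesis .
  qed
  show ?thesis
  proof (induction n rule: less_induct)
    case (less n)
    show ?case
    proof (cases "n < ?P")
      case False
      then obtain m where m: "n = m + ?P" by (metis add.commute le_iff_add not_less)
      then have "m < n" using P by simp
      then show ?thesis using less[of m] step[of m] P m by simp
    qed (simp add: binomial_eq_0)
  qed
qed

lemma vec_coeff_zero:
  fixes a :: "nat \<Rightarrow> 'i \<Rightarrow> 'k::alg_closed_field"
  assumes "\<And>s. s \<noteq> 0 \<Longrightarrow> (\<Sum>n<N. fscale (s ^ n) (a n)) = 0" "n < N"
  shows "a n = 0"
proof
  fix x
  define P where "P = (\<Sum>n<N. monom (a n x) n)"
  have "poly P s = 0" if "s \<noteq> 0" for s
  proof -
    have "poly P s = (\<Sum>n<N. fscale (s ^ n) (a n)) x"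
      by (simp add: P_def poly_sum poly_monom sum_fun_apply fscale_def mult.commute)
    then show ?thesis using assms(1)[OF that] by simp
  qed
  then have "UNIV - {0} \<subseteq> {s. poly P s = 0}" by auto
  then have "P = 0"
    using poly_roots_finite[of P] infinite_UNIV_alg_closed[where 'k = 'k]
    by (metis finite_Diff_insert finite_subset finite.emptyI Diff_empty)
  moreover have "coeff P n = a n x"
    using assms(2) by (simp add: P_def coeff_sum)
  ultimately show "a n x = 0 x" by simp
qed

lemma sum_fscale_extend:
  fixes N :: nat
  assumes "\<And>n. n \<ge> N \<Longrightarrow> w n = 0" "N \<le> N'"
  shows "(\<Sum>n<N'. fscale (c n) (w n)) = (\<Sum>n<N. fscale (c n) (w n))"
  using assms by (intro sum.mono_neutral_right) auto

lemma vec_coeff_unique: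
  fixes a b :: "nat \<Rightarrow> 'i \<Rightarrow> 'k::alg_closed_field"
  assumes eq: "\<And>s. s \<noteq> 0 \<Longrightarrow> (\<Sum>n<N. fscale (s ^ n) (a n)) = (\<Sum>n<M. fscale (s ^ n) (b n))"
    and a: "\<And>n. n \<ge> N \<Longrightarrow> a n = 0" and b: "\<And>n. n \<ge> M \<Longrightarrow> b n = 0"
  shows "a n = b n"
proof -
  let ?L = "max (Suc n) (max N M)"
  have "(\<Sum>n<?L. fscale (s ^ n) (a n - b n)) = 0" if "s \<noteq> 0" for s
  proof -
    have "(\<Sum>n<?L. fscale (s ^ n) (a n - b n)) =
        (\<Sum>n<?L. fscale (s ^ n) (a n)) - (\<Sum>n<?L. fscale (s ^ n) (b n))"
      by (simp only: fun_space.scale_right_diff_distrib sum_subtractf)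
    also have "(\<Sum>n<?L. fscale (s ^ n) (a n)) = (\<Sum>n<N. fscale (s ^ n) (a n))"
      by (rule sum_fscale_extend[OF a]) auto
    also have "(\<Sum>n<?L. fscale (s ^ n) (b n)) = (\<Sum>n<M. fscale (s ^ n) (b n))"
      by (rule sum_fscale_extend[OF b]) auto
    finally show ?thesis unfolding eq[OF that] by (simp only: diff_self)
  qed
  then have "a n - b n = 0" by (rule vec_coeff_zero) auto
  then show ?thesis by (metis eq_iff_diff_eq_0)
qed

text \<open>The n-th divided power of the root vector, read off as the coefficient of t^n in the
  orbit of \<open>v\<close>. Over an infinite field the choice is unambiguous by
  \<open>vec_coeff_unique\<close>.\<close>

definition dpow :: "('k::field \<Rightarrow> ('i \<Rightarrow> 'k) \<Rightarrow> ('i \<Rightarrow> 'k)) \<Rightarrow> nat \<Rightarrow> ('i \<Rightarrow> 'k) \<Rightarrow> ('i \<Rightarrow> 'k)" where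
  "dpow U n v = (SOME w. \<exists>N. (\<forall>n\<ge>N. w n = 0) \<and> (\<forall>t. U t v = (\<Sum>n<N. fscale (t ^ n) (w n)))) n"

lemma dpow_eq:
  fixes U :: "'k::alg_closed_field \<Rightarrow> ('i \<Rightarrow> 'k) \<Rightarrow> ('i \<Rightarrow> 'k)"
  assumes "\<And>n. n \<ge> N \<Longrightarrow> w n = 0" "\<And>t. U t v = (\<Sum>n<N. fscale (t ^ n) (w n))"
  shows "dpow U n v = w n"
proof -
  let ?Q = "\<lambda>w. \<exists>N. (\<forall>n\<ge>N. w n = 0) \<and> (\<forall>t. U t v = (\<Sum>n<N. fscale (t ^ n) (w n)))"
  define w' where "w' = (SOME w. ?Q w)"
  have "?Q w'"
    unfolding w'_def using assms by (intro someI[where P = ?Q and x = w]) blast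
  then obtain M where M: "\<And>n. n \<ge> M \<Longrightarrow> w' n = 0" "\<And>t. U t v = (\<Sum>n<M. fscale (t ^ n) (w' n))"
    by blast
  have "w' n = w n"
    by (rule vec_coeff_unique[where N = M and M = N]) (use M assms in metis)+
  then show ?thesis unfolding dpow_def w'_def .
qed

definition wsp :: "('i \<Rightarrow> 'k::field) set \<Rightarrow> ('k \<Rightarrow> ('i \<Rightarrow> 'k) \<Rightarrow> ('i \<Rightarrow> 'k)) \<Rightarrow> int \<Rightarrow> ('i \<Rightarrow> 'k) set" where
  "wsp C H w = {v \<in> C. \<forall>s. s \<noteq> 0 \<longrightarrow> H s v = fscale (s powi w) v}"

text \<open>
  \<open>U t\<close> and \<open>H s\<close> are the actions of the lower unitriangular matrix with entry \<open>t\<close> and of the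
  diagonal matrix with entries \<open>s\<close> and \<open>1/s\<close>.
\<close>

locale bmodule =
  fixes C :: "('i \<Rightarrow> 'k::alg_closed_field) set"
    and U H :: "'k \<Rightarrow> ('i \<Rightarrow> 'k) \<Rightarrow> ('i \<Rightarrow> 'k)"
  assumes C_sub: "fun_space.subspace C"
    and U_lin: "lin_on C (U t)"
    and H_lin: "s \<noteq> 0 \<Longrightarrow> lin_on C (H s)"
    and U_0: "v \<in> C \<Longrightarrow> U 0 v = v"
    and U_add: "v \<in> C \<Longrightarrow> U s (U t v) = U (s + t) v"
    and H_1: "v \<in> C \<Longrightarrow> H 1 v = v"
    and H_mult: "v \<in> C \<Longrightarrow> s \<noteq> 0 \<Longrightarrow> r \<noteq> 0 \<Longrightarrow> H s (H r v) = H (s * r) v"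
    and H_U: "v \<in> C \<Longrightarrow> s \<noteq> 0 \<Longrightarrow> H s (U t v) = U (t / s\<^sup>2) (H s v)"
    and U_poly: "v \<in> C \<Longrightarrow> \<exists>N w. (\<forall>n. w n \<in> C) \<and> (\<forall>n\<ge>N. w n = 0) \<and>
      (\<forall>t. U t v = (\<Sum>n<N. fscale (t ^ n) (w n)))"
    and H_poly: "v \<in> C \<Longrightarrow> \<exists>A a. finite A \<and> (\<forall>i\<in>A. a i \<in> C) \<and>
      (\<forall>s. s \<noteq> 0 \<longrightarrow> H s v = (\<Sum>i\<in>A. fscale (s powi i) (a i)))"
begin

abbreviation "E \<equiv> dpow U"
abbreviation "W \<equiv> wsp C H"

lemma E_ex:
  assumes "v \<in> C"
  shows "\<exists>N. (\<forall>n\<ge>N. E n v = 0) \<and> (\<forall>t. U t v = (\<Sum>n<N. fscale (t ^ n) (E n v)))"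
proof -
  obtain N w where w: "\<forall>n\<ge>N. w n = 0" "\<forall>t. U t v = (\<Sum>n<N. fscale (t ^ n) (w n))"
    using U_poly[OF assms] by blast
  then have "E n v = w n" for n by (intro dpow_eq) auto
  then show ?thesis using w by auto
qed

lemma E_C: "v \<in> C \<Longrightarrow> E n v \<in> C"
proof -
  assume "v \<in> C"
  then obtain N w where w: "\<forall>n. w n \<in> C" "\<forall>n\<ge>N. w n = 0" "\<forall>t. U t v = (\<Sum>n<N. fscale (t ^ n) (w n))"
    using U_poly by blast
  then have "E n v = w n" by (intro dpow_eq) auto
  then show ?thesis using w(1) by simp
qed

lemma E_expand:
  assumes "v \<in> C"
  obtains N where "\<And>n. n \<ge> N \<Longrightarrow> E n v = 0"
    "\<And>t N'. N' \<ge> N \<Longrightarrow> U t v = (\<Sum>n<N'. fscale (t ^ n) (E n v))"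
proof -
  obtain N where N: "\<forall>n\<ge>N. E n v = 0" "\<forall>t. U t v = (\<Sum>n<N. fscale (t ^ n) (E n v))"
    using E_ex[OF assms] by blast
  then have "U t v = (\<Sum>n<N'. fscale (t ^ n) (E n v))" if "N' \<ge> N" for t N'
    using sum_fscale_extend[of N "\<lambda>n. E n v" N' "\<lambda>n. t ^ n"] that by simp
  with N(1) show ?thesis using that by blast
qed

lemma H_C: "v \<in> C \<Longrightarrow> s \<noteq> 0 \<Longrightarrow> H s v \<in> C"
proof -
  assume v: "v \<in> C" and s: "s \<noteq> 0"
  obtain A a where a: "\<forall>i\<in>A. a i \<in> C" "H s v = (\<Sum>i\<in>A. fscale (s powi i) (a i))"
    using H_poly[OF v] s by metis
  show ?thesis
    unfolding a(2)
    using a(1) by (intro fun_space.subspace_sum[OF C_sub] fun_space.subspace_scale[OF C_sub]) auto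
qed

lemma E_lin: "lin_on C (E n)"
  unfolding lin_on_def
proof (intro conjI ballI allI)
  fix u v assume u: "u \<in> C" and v: "v \<in> C"
  obtain N where N: "\<And>n. n \<ge> N \<Longrightarrow> E n u = 0"
    "\<And>t N'. N' \<ge> N \<Longrightarrow> U t u = (\<Sum>n<N'. fscale (t ^ n) (E n u))" using E_expand[OF u] by blast
  obtain M where M: "\<And>n. n \<ge> M \<Longrightarrow> E n v = 0"
    "\<And>t N'. N' \<ge> M \<Longrightarrow> U t v = (\<Sum>n<N'. fscale (t ^ n) (E n v))" using E_expand[OF v] by blast
  show "E n (u + v) = E n u + E n v"
  proof (rule dpow_eq[where N = "max N M" and w = "\<lambda>n. E n u + E n v"])
    show "U t (u + v) = (\<Sum>n<max N M. fscale (t ^ n) (E n u + E n v))" for t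
      unfolding lin_on_add[OF C_sub U_lin u v] N(2)[OF max.cobounded1[of N M]] M(2)[OF max.cobounded2[of M N]]
        fun_space.scale_right_distrib sum.distrib by (rule refl)
  qed (use N(1) M(1) in simp)
next
  fix c v assume v: "v \<in> C"
  obtain M where M: "\<And>n. n \<ge> M \<Longrightarrow> E n v = 0"
    "\<And>t N'. N' \<ge> M \<Longrightarrow> U t v = (\<Sum>n<N'. fscale (t ^ n) (E n v))" using E_expand[OF v] by blast
  show "E n (fscale c v) = fscale c (E n v)"
  proof (rule dpow_eq[where N = M and w = "\<lambda>n. fscale c (E n v)"])
    show "U t (fscale c v) = (\<Sum>n<M. fscale (t ^ n) (fscale c (E n v)))" for t
      unfolding lin_on_scale[OF C_sub U_lin v] M(2)[OF order_refl] fun_space.scale_sum_right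
      by (intro sum.cong refl) (simp add: mult.commute)
  qed (use M(1) in simp)
qed

text \<open>Comparison of the coefficients of s^m t^n in U(s) U(t) = U(s + t).\<close>

lemma E_E:
  assumes v: "v \<in> C"
  shows "E m (E n v) = fscale (of_nat (m + n choose m)) (E (m + n) v)"
proof -
  obtain N where N: "\<And>n. n \<ge> N \<Longrightarrow> E n v = 0"
    "\<And>t N'. N' \<ge> N \<Longrightarrow> U t v = (\<Sum>n<N'. fscale (t ^ n) (E n v))" using E_expand[OF v] by blast
  have 1: "E m (U t v) = (\<Sum>n<N. fscale (t ^ n) (fscale (of_nat (m + n choose m)) (E (m + n) v)))" for t
  proof -
    have "E m (U t v) = (\<Sum>l<N. fscale (of_nat (l choose m) * t ^ (l - m)) (E l v))"
    proof (rule dpow_eq[where N = N and w = "\<lambda>m. \<Sum>l<N. fscale (of_nat (l choose m) * t ^ (l - m)) (E l v)"])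
      fix s
      have "U s (U t v) = (\<Sum>l<N. fscale ((s + t) ^ l) (E l v))"
        using U_add[OF v] N(2)[OF order_refl] by simp
      also have "\<dots> = (\<Sum>l<N. \<Sum>m<N. fscale (s ^ m) (fscale (of_nat (l choose m) * t ^ (l - m)) (E l v)))"
      proof (rule sum.cong[OF refl])
        fix l assume "l \<in> {..<N}"
        then have "(s + t) ^ l = (\<Sum>m<N. of_nat (l choose m) * s ^ m * t ^ (l - m))"
          unfolding binomial_ring by (intro sum.mono_neutral_left) (auto simp: not_le binomial_eq_0)
        then show "fscale ((s + t) ^ l) (E l v) =
          (\<Sum>m<N. fscale (s ^ m) (fscale (of_nat (l choose m) * t ^ (l - m)) (E l v)))"
          by (simp add: fun_space.scale_sum_left mult_ac)
      qed
      also have "\<dots> = (\<Sum>m<N. fscale (s ^ m) (\<Sum>l<N. fscale (of_nat (l choose m) * t ^ (l - m)) (E l v)))"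
        unfolding fun_space.scale_sum_right by (rule sum.swap)
      finally show "U s (U t v) = \<dots>" .
    next
      fix n assume "n \<ge> N"
      then show "(\<Sum>l<N. fscale (of_nat (l choose n) * t ^ (l - n)) (E l v)) = 0"
        by (intro sum.neutral) (auto simp: binomial_eq_0)
    qed
    also have "\<dots> = (\<Sum>l\<in>{m..<N+m}. fscale (of_nat (l choose m) * t ^ (l - m)) (E l v))"
      by (rule sum.mono_neutral_cong) (auto simp: N(1) binomial_eq_0)
    also have "\<dots> = (\<Sum>n<N. fscale (t ^ n) (fscale (of_nat (m + n choose m)) (E (m + n) v)))"
      by (rule sum.reindex_bij_witness[where i = "\<lambda>n. m + n" and j = "\<lambda>l. l - m"]) (auto simp: mult.commute)
    finally show ?thesis .
  qed
  have 2: "E m (U t v) = (\<Sum>n<N. fscale (t ^ n) (E m (E n v)))" for t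
    unfolding N(2)[OF order_refl] by (rule lin_on_sum_scale[OF C_sub E_lin]) (rule E_C[OF v])
  show ?thesis
  proof (rule vec_coeff_unique[where N = N and M = N and n = n and a = "\<lambda>n. E m (E n v)"
        and b = "\<lambda>n. fscale (of_nat (m + n choose m)) (E (m + n) v)"])
    show "(\<Sum>n<N. fscale (s ^ n) (E m (E n v))) =
      (\<Sum>n<N. fscale (s ^ n) (fscale (of_nat (m + n choose m)) (E (m + n) v)))" for s
      using 1 2 by metis
  qed (use N(1) lin_on_0[OF C_sub E_lin] in auto)
qed

lemma W_sub: "fun_space.subspace (W w)"
  using C_sub lin_on_0[OF C_sub H_lin] lin_on_add[OF C_sub H_lin] lin_on_scale[OF C_sub H_lin]
  by (auto simp: wsp_def fun_space.subspace_def fun_space.scale_right_distrib mult.commute)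

lemma E_W:
  assumes v: "v \<in> W w"
  shows "E n v \<in> W (w - 2 * int n)"
proof -
  have vC: "v \<in> C" using v by (simp add: wsp_def)
  obtain N where N: "\<And>n. n \<ge> N \<Longrightarrow> E n v = 0"
    "\<And>t N'. N' \<ge> N \<Longrightarrow> U t v = (\<Sum>n<N'. fscale (t ^ n) (E n v))" using E_expand[OF vC] by blast
  have "H s (E n v) = fscale (s powi (w - 2 * int n)) (E n v)" if s: "s \<noteq> 0" for s
  proof (rule vec_coeff_unique[where N = N and M = N and n = n and a = "\<lambda>n. H s (E n v)"
        and b = "\<lambda>n. fscale (s powi (w - 2 * int n)) (E n v)"])
    fix t :: 'k
    have "(\<Sum>n<N. fscale (t ^ n) (H s (E n v))) = H s (U t v)"
      unfolding N(2)[OF order_refl] by (rule lin_on_sum_scale[OF C_sub H_lin[OF s], symmetric]) (rule E_C[OF vC])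
    also have "\<dots> = U (t / s\<^sup>2) (fscale (s powi w) v)"
      using H_U[OF vC s] v s by (simp add: wsp_def)
    also have "\<dots> = (\<Sum>n<N. fscale (s powi w * (t / s\<^sup>2) ^ n) (E n v))"
      unfolding lin_on_scale[OF C_sub U_lin vC] N(2)[OF order_refl] fun_space.scale_sum_right by simp
    also have "\<dots> = (\<Sum>n<N. fscale (t ^ n) (fscale (s powi (w - 2 * int n)) (E n v)))"
    proof (rule sum.cong[OF refl])
      fix n
      have "s powi w * (t / s\<^sup>2) ^ n = t ^ n * s powi (w - 2 * int n)"
        using s power_int_of_nat[of s "2 * n"] by (simp add: power_int_diff power_divide power_mult)
      then show "fscale (s powi w * (t / s\<^sup>2) ^ n) (E n v) = fscale (t ^ n) (fscale (s powi (w - 2 * int n)) (E n v))"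
        by simp
    qed
    finally show "(\<Sum>n<N. fscale (t ^ n) (H s (E n v))) = \<dots>" .
  qed (use N(1) lin_on_0[OF C_sub H_lin[OF s]] in auto)
  then show ?thesis using E_C[OF vC] by (simp add: wsp_def)
qed

end

text \<open>Multiplication by s^M clears the negative exponents and reduces to polynomials.\<close>

lemma laurent_zero:
  fixes a :: "int \<Rightarrow> 'i \<Rightarrow> 'k::alg_closed_field"
  assumes A: "finite A" and eq: "\<And>s. s \<noteq> 0 \<Longrightarrow> (\<Sum>i\<in>A. fscale (s powi i) (a i)) = 0" and i: "i \<in> A"
  shows "a i = 0"
proof -
  define M where "M = Suc (Max ((\<lambda>i. nat \<bar>i\<bar>) ` A))"
  have M: "nat \<bar>j\<bar> < M" if "j \<in> A" for j
    using A that by (auto simp: M_def less_Suc_eq_le)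
  define y where "y n = (if int n - int M \<in> A then a (int n - int M) else 0)" for n
  have "(\<Sum>n<2 * M. fscale (s ^ n) (y n)) = 0" if s: "s \<noteq> 0" for s
  proof -
    have "(\<Sum>n<2 * M. fscale (s ^ n) (y n)) =
        (\<Sum>n\<in>{n. int n - int M \<in> A}. fscale (s ^ n) (a (int n - int M)))"
    proof (rule sum.mono_neutral_cong_right)
      show "{n. int n - int M \<in> A} \<subseteq> {..<2 * M}"
        using M by force
    qed (auto simp: y_def)
    also have "\<dots> = (\<Sum>j\<in>A. fscale (s ^ M) (fscale (s powi j) (a j)))"
    proof (rule sum.reindex_bij_witness[where i = "\<lambda>j. nat (j + int M)" and j = "\<lambda>n. int n - int M"])
      fix n assume "n \<in> {n. int n - int M \<in> A}"
      have "s ^ M * s powi (int n - int M) = s ^ n"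
        using s by (simp add: power_int_diff)
      then show "fscale (s ^ M) (fscale (s powi (int n - int M)) (a (int n - int M))) =
          fscale (s ^ n) (a (int n - int M))" by simp
    qed (use M in force)+
    also have "\<dots> = fscale (s ^ M) (\<Sum>j\<in>A. fscale (s powi j) (a j))"
      by (rule fun_space.scale_sum_right[symmetric])
    finally show ?thesis using eq[OF s] by simp
  qed
  then have "y (nat (i + int M)) = 0"
    by (rule vec_coeff_zero) (use M[OF i] in auto)
  moreover have "int (nat (i + int M)) - int M = i" using M[OF i] by auto
  ultimately show ?thesis using i by (simp add: y_def)
qed

definition dX :: "nat \<Rightarrow> ('k::field \<Rightarrow> ('i \<Rightarrow> 'k) \<Rightarrow> ('i \<Rightarrow> 'k)) \<Rightarrow> nat \<Rightarrow> ('i \<Rightarrow> 'k) \<Rightarrow> ('i \<Rightarrow> 'k)" where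
  "dX p U i = dpow U (p ^ i)"

lemma of_nat_fact_neq_0:
  assumes "prime p" "CHAR('k::field) = p" "j < p"
  shows "(of_nat (fact j) :: 'k) \<noteq> 0"
  using assms prime_dvd_fact_iff[of p j] of_nat_eq_0_iff_char_dvd[where ?'a = 'k and n = "fact j"] by simp

context bmodule
begin

lemma W_C: "v \<in> W w \<Longrightarrow> v \<in> C"
  by (simp add: wsp_def)

lemma W_H: "v \<in> W w \<Longrightarrow> s \<noteq> 0 \<Longrightarrow> H s v = fscale (s powi w) v"
  by (simp add: wsp_def)

text \<open>The Laurent coefficients of s -> H(s) v are the weight components: expand H(r) H(s) v =
  H(rs) v in s. At s = 1 they sum to \<open>v\<close>.\<close>

lemma weight_decomp:
  assumes v: "v \<in> C"
  obtains A x where "finite A" "\<And>i. i \<in> A \<Longrightarrow> x i \<in> W i" "v = (\<Sum>i\<in>A. x i)"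
proof -
  obtain A a where *: "finite A \<and> (\<forall>i\<in>A. a i \<in> C) \<and>
      (\<forall>s. s \<noteq> 0 \<longrightarrow> H s v = (\<Sum>i\<in>A. fscale (s powi i) (a i)))"
    using H_poly[OF v] by (elim exE)
  then have A: "finite A" "\<And>i. i \<in> A \<Longrightarrow> a i \<in> C"
    and a: "\<And>s. s \<noteq> 0 \<Longrightarrow> H s v = (\<Sum>i\<in>A. fscale (s powi i) (a i))"
    by simp_all
  have "a i \<in> W i" if i: "i \<in> A" for i
  proof -
    have "H r (a i) = fscale (r powi i) (a i)" if r: "r \<noteq> 0" for r
    proof -
      have "H r (a i) - fscale (r powi i) (a i) = 0"
      proof (rule laurent_zero[OF A(1) _ i, where a = "\<lambda>i. H r (a i) - fscale (r powi i) (a i)"])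
        fix s :: 'k assume s: "s \<noteq> 0"
        have "(\<Sum>i\<in>A. fscale (s powi i) (H r (a i))) = H r (H s v)"
          unfolding a[OF s] by (rule lin_on_sum_scale[OF C_sub H_lin[OF r], symmetric]) (rule A(2))
        also have "\<dots> = (\<Sum>i\<in>A. fscale (s powi i) (fscale (r powi i) (a i)))"
          using H_mult[OF v r s] a[of "r * s"] r s by (simp add: power_int_mult_distrib mult.commute)
        finally show "(\<Sum>i\<in>A. fscale (s powi i) (H r (a i) - fscale (r powi i) (a i))) = 0"
          unfolding fun_space.scale_right_diff_distrib sum_subtractf by (metis diff_self)
      qed
      then show ?thesis by (metis eq_iff_diff_eq_0)
    qed
    then show ?thesis using A(2)[OF i] by (simp add: wsp_def)
  qed
  moreover have "v = (\<Sum>i\<in>A. a i)"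
    using a[of 1] H_1[OF v] by simp
  ultimately show ?thesis using A(1) that by blast
qed

lemma E_0: "v \<in> C \<Longrightarrow> E 0 v = v"
proof -
  assume v: "v \<in> C"
  obtain N where "\<And>n. n \<ge> N \<Longrightarrow> E n v = 0"
    and N: "\<And>t N'. N' \<ge> N \<Longrightarrow> U t v = (\<Sum>n<N'. fscale (t ^ n) (E n v))"
    using E_expand[OF v] by blast
  have "v = (\<Sum>n<Suc N. fscale (0 ^ n) (E n v))" using N[of "Suc N" 0] U_0[OF v] by simp
  also have "\<dots> = (\<Sum>n\<in>{0}. fscale (0 ^ n) (E n v))"
    by (rule sum.mono_neutral_right) auto
  finally show ?thesis by simp
qed

context
  fixes p :: nat
  assumes p: "prime p" "CHAR('k) = p"
begin

text \<open>Each further X_i contributes the binomial C((j+1) p^i, p^i), which is j + 1 in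
  characteristic p. At j = p the factorial vanishes, which gives X_i^p = 0.\<close>

lemma dX_pow: "v \<in> C \<Longrightarrow> (dX p U i ^^ j) v = fscale (of_nat (fact j)) (E (j * p ^ i) v)"
proof (induction j)
  case (Suc j)
  have "p ^ i > 0" using prime_gt_0_nat[OF p(1)] by simp
  then have "(p ^ i + j * p ^ i) div p ^ i = Suc j" by simp
  then have "(of_nat ((p ^ i + j * p ^ i) choose (p ^ i)) :: 'k) = of_nat (Suc j)"
    using of_nat_choose_char[OF p, of "p ^ i + j * p ^ i" i] by simp
  then have "E (p ^ i) (E (j * p ^ i) v) = fscale (of_nat (Suc j)) (E (Suc j * p ^ i) v)"
    using E_E[OF Suc.prems, of "p ^ i" "j * p ^ i"] by simp
  moreover have "(dX p U i ^^ Suc j) v = fscale (of_nat (fact j)) (E (p ^ i) (E (j * p ^ i) v))"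
    using Suc lin_on_scale[OF C_sub E_lin E_C[OF Suc.prems]] by (simp add: dX_def)
  moreover have "(of_nat (fact j) * of_nat (Suc j) :: 'k) = of_nat (fact (Suc j))"
    by (simp add: algebra_simps)
  ultimately show ?case by (simp only: fun_space.scale_scale)
qed (simp add: E_0)

text \<open>For p^i \<le> n < p^(i+1) the leading digit makes C(n, p^i) invertible, so
  \<open>E n\<close> factors through X_i, and i \<ge> r.\<close>

lemma E_high:
  assumes v: "v \<in> C" "\<And>i. i \<ge> r \<Longrightarrow> dX p U i v = 0" and n: "n \<ge> p ^ r"
  shows "E n v = 0"
proof -
  have p1: "p > 1" using prime_gt_1_nat[OF p(1)] .
  have "n > 0" using n p1 by (metis gr0I le_zero_eq not_one_less_zero power_eq_0_iff)
  then obtain i where i: "p ^ i \<le> n" "n < p ^ Suc i"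
    using ex_power_ivl1[of p n] p1 by auto
  have "i \<ge> r"
  proof (rule ccontr)
    assume "\<not> i \<ge> r"
    then have "p ^ Suc i \<le> p ^ r" using p1 by (intro power_increasing) auto
    then show False using i n by simp
  qed
  have "n div p ^ i < p" using i(2) by (simp add: less_mult_imp_div_less)
  moreover have "n div p ^ i > 0" using i(1) p1 by (simp add: div_greater_zero_iff)
  ultimately have "(of_nat (n div p ^ i) :: 'k) \<noteq> 0"
    using p(2) by (simp add: of_nat_eq_0_iff_char_dvd nat_dvd_not_less)
  then have c: "(of_nat (n choose (p ^ i)) :: 'k) \<noteq> 0"
    using of_nat_choose_char[OF p] by simp
  have "E (n - p ^ i) (E (p ^ i) v) = fscale (of_nat (n choose (n - p ^ i))) (E n v)"
    using E_E[OF v(1), of "n - p ^ i" "p ^ i"] i(1) by simp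
  moreover have "E (p ^ i) v = 0" using v(2)[OF \<open>i \<ge> r\<close>] by (simp add: dX_def)
  moreover have "n choose (n - p ^ i) = n choose (p ^ i)"
    using binomial_symmetric[OF i(1)] by simp
  ultimately have "fscale (of_nat (n choose (p ^ i))) (E n v) = 0"
    using lin_on_0[OF C_sub E_lin] by metis
  then show ?thesis using c by simp
qed

lemma U_invariant:
  assumes v: "v \<in> C" "\<And>i. dX p U i v = 0"
  shows "U t v = v"
proof -
  have E: "E n v = 0" if "n > 0" for n
    using E_high[OF v(1), of 0 n] v(2) that by simp
  obtain N where "\<And>n. n \<ge> N \<Longrightarrow> E n v = 0"
    and N: "\<And>t N'. N' \<ge> N \<Longrightarrow> U t v = (\<Sum>n<N'. fscale (t ^ n) (E n v))"
    using E_expand[OF v(1)] by blast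
  have "U t v = (\<Sum>n<Suc N. fscale (t ^ n) (E n v))" by (rule N) simp
  also have "\<dots> = (\<Sum>n\<in>{0}. fscale (t ^ n) (E n v))"
    by (rule sum.mono_neutral_right) (auto simp: E)
  finally show ?thesis using E_0[OF v(1)] by simp
qed

lemma dX_invariant:
  assumes "\<And>t. U t v = v"
  shows "dX p U i v = 0"
proof -
  have "p > 0" using prime_gt_0_nat[OF p(1)] .
  then show ?thesis
    unfolding dX_def
    using dpow_eq[where N = 1 and w = "\<lambda>n. if n = 0 then v else 0" and U = U and v = v and n = "p ^ i"] assms by simp
qed

lemma xmodule:
  assumes "odd p"
  shows "xmodule p (dX p U) W"
proof
  show "p \<ge> 2" using prime_ge_2_nat[OF p(1)] .
  have "\<not> p dvd 2"
    using assms prime_ge_2_nat[OF p(1)] dvd_imp_le[of p 2] by fastforce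
  then show "(2::'k) \<noteq> 0"
    using of_nat_eq_0_iff_char_dvd[where ?'a = 'k and n = 2] p(2) by simp
  show "dX p U i v \<in> W (w - 2 * int p ^ i)" if "v \<in> W w" for v w i
    using E_W[OF that, of "p ^ i"] by (simp add: dX_def)
  show "lin_on (W w) (dX p U i)" for w i
    unfolding dX_def by (rule lin_on_subset[OF E_lin]) (auto simp: wsp_def)
  show "dX p U i (dX p U j v) = dX p U j (dX p U i v)" if "v \<in> W w" for v w i j
  proof -
    have "p ^ i + p ^ j choose p ^ i = p ^ j + p ^ i choose p ^ j"
      using binomial_symmetric[of "p ^ i" "p ^ i + p ^ j"] by (simp add: add.commute)
    then show ?thesis
      unfolding dX_def E_E[OF W_C[OF that]] by (simp add: add.commute)
  qed
  show "(dX p U i ^^ p) v = 0" if "v \<in> W w" for v w i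
  proof -
    have "p dvd fact p" using prime_gt_0_nat[OF p(1)] by (intro dvd_fact) auto
    then have "(of_nat (fact p) :: 'k) = 0"
      using p(2) of_nat_eq_0_iff_char_dvd[where ?'a = 'k and n = "fact p"] by simp
    then show ?thesis unfolding dX_pow[OF W_C[OF that]] by simp
  qed
  show "\<exists>r. \<forall>i\<ge>r. dX p U i v = 0" if v: "v \<in> W w" for v w
  proof -
    obtain N where N: "\<forall>n\<ge>N. E n v = 0" using E_ex[OF W_C[OF v]] by blast
    have "dX p U i v = 0" if "i \<ge> N" for i
    proof -
      have "i < p ^ i" using power_gt_expt[of p i] prime_gt_1_nat[OF p(1)] by simp
      then have "N \<le> p ^ i" using that by linarith
      then show ?thesis unfolding dX_def using N by blast
    qed
    then show ?thesis by blast
  qed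
qed (rule W_sub)

end

end

text \<open>The factor s^k allows maps that commute with the unipotent group but shift torus
  weights, such as multiplication by d and \<open>weyl_down\<close>.\<close>

locale bmodule_hom = Y: bmodule C U H + Z: bmodule C' U' H'
  for C :: "('i \<Rightarrow> 'k::alg_closed_field) set" and U H
    and C' :: "('j \<Rightarrow> 'k) set" and U' H' +
  fixes f :: "('i \<Rightarrow> 'k) \<Rightarrow> ('j \<Rightarrow> 'k)" and k :: nat
  assumes f_C: "v \<in> C \<Longrightarrow> f v \<in> C'"
    and f_lin: "lin_on C f"
    and f_U: "v \<in> C \<Longrightarrow> f (U t v) = U' t (f v)"
    and f_H: "v \<in> C \<Longrightarrow> s \<noteq> 0 \<Longrightarrow> f (H s v) = fscale (s ^ k) (H' s (f v))"
begin

lemma f_E: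
  assumes v: "v \<in> C"
  shows "f (Y.E n v) = Z.E n (f v)"
proof -
  obtain N where N: "\<And>n. n \<ge> N \<Longrightarrow> Y.E n v = 0"
    "\<And>t N'. N' \<ge> N \<Longrightarrow> U t v = (\<Sum>n<N'. fscale (t ^ n) (Y.E n v))" using Y.E_expand[OF v] by blast
  have "Z.E n (f v) = f (Y.E n v)"
  proof (rule dpow_eq[where N = N and w = "\<lambda>n. f (Y.E n v)"])
    fix t
    have "U' t (f v) = f (\<Sum>n<N. fscale (t ^ n) (Y.E n v))"
      using f_U[OF v] N(2)[OF order_refl] by metis
    also have "\<dots> = (\<Sum>n<N. fscale (t ^ n) (f (Y.E n v)))"
      by (rule lin_on_sum_scale[OF Y.C_sub f_lin]) (rule Y.E_C[OF v])
    finally show "U' t (f v) = \<dots>" .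
  qed (use N(1) lin_on_0[OF Y.C_sub f_lin] in simp)
  then show ?thesis by simp
qed

lemma f_H': "v \<in> C \<Longrightarrow> s \<noteq> 0 \<Longrightarrow> H' s (f v) = fscale (s powi (- int k)) (f (H s v))"
  by (simp add: f_H power_int_minus)

lemma f_W:
  assumes "v \<in> Y.W w"
  shows "f v \<in> Z.W (w - int k)"
proof -
  have v: "v \<in> C" using Y.W_C[OF assms] .
  have "H' s (f v) = fscale (s powi (w - int k)) (f v)" if s: "s \<noteq> 0" for s
    unfolding f_H'[OF v s] Y.W_H[OF assms s] lin_on_scale[OF Y.C_sub f_lin v]
    using s power_int_add[of s "- int k" w] by (simp add: algebra_simps)
  then show ?thesis using f_C[OF v] by (simp add: wsp_def)
qed

text \<open>A preimage of a weight vector need not be one. Comparing Laurent coefficients shows that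
  its component of weight \<open>w\<close> already maps to \<open>z\<close>; if there is none,
  \<open>z\<close> is 0.\<close>

lemma f_W_surj:
  assumes surj: "C' \<subseteq> f ` C" and z: "z \<in> Z.W (w - int k)"
  shows "\<exists>y\<in>Y.W w. f y = z"
proof -
  obtain v where v: "v \<in> C" "z = f v" using surj Z.W_C[OF z] by blast
  obtain A x where A: "finite A" "\<And>i. i \<in> A \<Longrightarrow> x i \<in> Y.W i" "v = (\<Sum>i\<in>A. x i)"
    using Y.weight_decomp[OF v(1)] by blast
  have xC: "x i \<in> C" if "i \<in> A" for i using Y.W_C[OF A(2)[OF that]] .
  define x' where "x' i = (if i \<in> A then f (x i) else 0)" for i
  define z' where "z' i = (if i = w then z else 0)" for i
  have "x' w - z' w = 0"
  proof (rule laurent_zero[where A = "insert w A" and a = "\<lambda>i. x' i - z' i"])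
    fix s :: 'k assume s: "s \<noteq> 0"
    have 1: "(\<Sum>i\<in>insert w A. fscale (s powi i) (x' i)) = (\<Sum>i\<in>A. fscale (s powi i) (f (x i)))"
      using A(1) by (intro sum.mono_neutral_cong_right) (auto simp: x'_def)
    have 2: "(\<Sum>i\<in>insert w A. fscale (s powi i) (z' i)) = (\<Sum>i\<in>{w}. fscale (s powi i) z)"
      using A(1) by (intro sum.mono_neutral_cong_right) (auto simp: z'_def)
    have "(\<Sum>i\<in>A. fscale (s powi i) (f (x i))) = f (\<Sum>i\<in>A. fscale (s powi i) (x i))"
      by (rule lin_on_sum_scale[OF Y.C_sub f_lin, symmetric]) (rule xC)
    also have "(\<Sum>i\<in>A. fscale (s powi i) (x i)) = (\<Sum>i\<in>A. H s (x i))"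
      by (rule sum.cong[OF refl]) (metis Y.W_H[OF A(2) s])
    also have "\<dots> = H s v"
      unfolding A(3) by (rule lin_on_sum[OF Y.C_sub Y.H_lin[OF s], symmetric]) (rule xC)
    also have "f (H s v) = fscale (s ^ k) (H' s z)"
      using f_H[OF v(1) s] v(2) by simp
    also have "H' s z = fscale (s powi (w - int k)) z" by (rule Z.W_H[OF z s])
    also have "fscale (s ^ k) \<dots> = fscale (s powi w) z"
      using s by (simp add: power_int_diff)
    finally have 3: "(\<Sum>i\<in>A. fscale (s powi i) (f (x i))) = (\<Sum>i\<in>{w}. fscale (s powi i) z)" by simp
    show "(\<Sum>i\<in>insert w A. fscale (s powi i) (x' i - z' i)) = 0"
      unfolding fun_space.scale_right_diff_distrib sum_subtractf 1 2 3 by (rule diff_self)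
  qed (use A(1) in auto)
  then have "z = x' w" by (simp add: z'_def)
  show ?thesis
  proof (cases "w \<in> A")
    case True
    then show ?thesis using A(2) \<open>z = x' w\<close> by (auto simp: x'_def)
  next
    case False
    then have "f 0 = z" using \<open>z = x' w\<close> lin_on_0[OF Y.C_sub f_lin] by (simp add: x'_def)
    then show ?thesis using fun_space.subspace_0[OF Y.W_sub] by blast
  qed
qed

lemma xmodule_hom:
  assumes "prime p" "CHAR('k) = p" "odd p"
  shows "xmodule_hom p (dX p U) Y.W (dX p U') Z.W f (int k)"
proof -
  interpret YX: xmodule p "dX p U" "Y.W" using Y.xmodule assms by blast
  interpret ZX: xmodule p "dX p U'" "Z.W" using Z.xmodule assms by blast
  show ?thesis
  proof
    show "lin_on (Y.W w) f" for w
      by (rule lin_on_subset[OF f_lin]) (auto simp: wsp_def)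
    show "f (dX p U i v) = dX p U' i (f v)" if "v \<in> Y.W w" for v w i
      unfolding dX_def by (rule f_E[OF Y.W_C[OF that]])
  qed (rule f_W)
qed

lemma xmodule_epi:
  assumes "prime p" "CHAR('k) = p" "odd p" "C' \<subseteq> f ` C"
  shows "xmodule_epi p (dX p U) Y.W (dX p U') Z.W f (int k)"
proof -
  interpret xmodule_hom p "dX p U" "Y.W" "dX p U'" "Z.W" f "int k"
    using xmodule_hom assms by blast
  show ?thesis
    by standard (rule f_W_surj[OF assms(4)])
qed

end

section \<open>Right translation of functions on the group\<close>

definition mk2 :: "'k::field \<Rightarrow> 'k \<Rightarrow> 'k \<Rightarrow> 'k \<Rightarrow> 'k sl2" where
  "mk2 a b c d = Abs_sl2 (vector [vector [a, b], vector [c, d]])"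

definition ent :: "2 \<Rightarrow> 2 \<Rightarrow> 'k::field sl2 \<Rightarrow> 'k" where
  "ent i j g = Rep_sl2 g $ i $ j"

lemma ent_mk2:
  assumes "a * d - b * c = (1::'k::field)"
  shows "ent 1 1 (mk2 a b c d) = a" "ent 1 2 (mk2 a b c d) = b"
    "ent 2 1 (mk2 a b c d) = c" "ent 2 2 (mk2 a b c d) = d"
proof -
  have "det (vector [vector [a, b], vector [c, d]] :: 'k^2^2) = 1"
    using assms by (simp add: det_2)
  then show "ent 1 1 (mk2 a b c d) = a" "ent 1 2 (mk2 a b c d) = b"
    "ent 2 1 (mk2 a b c d) = c" "ent 2 2 (mk2 a b c d) = d"
    by (simp_all add: ent_def mk2_def Abs_sl2_inverse)
qed

lemma ent_det: "ent 1 1 g * ent 2 2 g - ent 1 2 g * ent 2 1 g = 1"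
  using Rep_sl2[of g] by (simp add: ent_def det_2)

lemma ent_mult: "ent i j (g * h) = ent i 1 g * ent 1 j h + ent i 2 g * ent 2 j h"
  by (simp add: ent_def Rep_sl2_times matrix_matrix_mult_def sum_2)

lemma ent_one: "ent i j 1 = (if i = j then 1 else 0)"
  by (simp add: ent_def Rep_sl2_one mat_def)

lemma sl2_eqI:
  assumes "ent 1 1 g = ent 1 1 h" "ent 1 2 g = ent 1 2 h" "ent 2 1 g = ent 2 1 h" "ent 2 2 g = ent 2 2 h"
  shows "g = h"
  using assms unfolding Rep_sl2_inject[symmetric] vec_eq_iff forall_2 ent_def by auto

definition lo :: "'k::field \<Rightarrow> 'k sl2" where "lo t = mk2 1 0 t 1"
definition upp :: "'k::field \<Rightarrow> 'k sl2" where "upp t = mk2 1 t 0 1"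
definition tor :: "'k::field \<Rightarrow> 'k sl2" where "tor s = mk2 s 0 0 (inverse s)"

lemma ent_lo [simp]: "ent 1 1 (lo t) = 1" "ent 1 2 (lo t) = 0" "ent 2 1 (lo t) = t" "ent 2 2 (lo t) = 1"
  by (simp_all add: lo_def ent_mk2)

lemma ent_upp [simp]: "ent 1 1 (upp t) = 1" "ent 1 2 (upp t) = t" "ent 2 1 (upp t) = 0" "ent 2 2 (upp t) = 1"
  by (simp_all add: upp_def ent_mk2)

lemma ent_tor [simp]:
  assumes "s \<noteq> 0"
  shows "ent 1 1 (tor s) = s" "ent 1 2 (tor s) = 0" "ent 2 1 (tor s) = 0" "ent 2 2 (tor s) = inverse s"
  using assms by (simp_all add: tor_def ent_mk2)

lemma lo_add: "lo s * lo t = lo (s + t)"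
  by (rule sl2_eqI) (simp_all add: ent_mult)

lemma lo_0 [simp]: "lo 0 = 1"
  by (rule sl2_eqI) (simp_all add: ent_one)

lemma tor_mult: "s \<noteq> 0 \<Longrightarrow> r \<noteq> 0 \<Longrightarrow> tor s * tor r = tor (s * r)"
  by (rule sl2_eqI) (simp_all add: ent_mult)

lemma tor_1 [simp]: "tor 1 = 1"
  by (rule sl2_eqI) (simp_all add: ent_one)

lemma tor_lo: "s \<noteq> 0 \<Longrightarrow> tor s * lo t = lo (t / s\<^sup>2) * tor s"
  by (rule sl2_eqI) (simp_all add: ent_mult power2_eq_square field_simps)

lemma lo_tor: "s \<noteq> 0 \<Longrightarrow> lo t * tor s = tor s * lo (t * s\<^sup>2)"
  by (subst tor_lo) simp_all

text \<open>Functions on G with values in functions on \<open>'i\<close> are written with a pair as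
  argument; only the group variable is translated.\<close>

definition RT :: "'k::field sl2 \<Rightarrow> ('k sl2 \<times> 'i \<Rightarrow> 'k) \<Rightarrow> ('k sl2 \<times> 'i \<Rightarrow> 'k)" where
  "RT h F = (\<lambda>(g, c). F (g * h, c))"

definition mul :: "('k::field sl2 \<Rightarrow> 'k) \<Rightarrow> ('k sl2 \<times> 'i \<Rightarrow> 'k) \<Rightarrow> ('k sl2 \<times> 'i \<Rightarrow> 'k)" where
  "mul f F = (\<lambda>(g, c). f g * F (g, c))"

lemma RT_apply [simp]: "RT h F (g, c) = F (g * h, c)"
  by (simp add: RT_def)

lemma mul_apply [simp]: "mul f F (g, c) = f g * F (g, c)"
  by (simp add: mul_def)

lemma lin_on_RT: "lin_on C (RT h)"
  by (auto simp: lin_on_def fscale_def fun_eq_iff)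

lemma lin_on_mul: "lin_on C (mul f)"
  by (auto simp: lin_on_def fscale_def fun_eq_iff algebra_simps)

lemma RT_RT: "RT h (RT h' F) = RT (h * h') F"
  by (auto simp: fun_eq_iff mult.assoc)

lemma RT_1: "RT 1 F = F"
  by (auto simp: fun_eq_iff)

lemma mul_mul: "mul f (mul f' F) = mul (\<lambda>g. f g * f' g) F"
  by (auto simp: fun_eq_iff)

lemma mul_fscale: "mul f (fscale c F) = fscale c (mul f F)"
  by (auto simp: fun_eq_iff fscale_def)

lemma bmodule_RT:
  fixes C :: "('k::alg_closed_field sl2 \<times> 'i \<Rightarrow> 'k) set"
  assumes "fun_space.subspace C"
    and "\<And>F. F \<in> C \<Longrightarrow> \<exists>N w. (\<forall>n. w n \<in> C) \<and> (\<forall>n\<ge>N. w n = 0) \<and>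
      (\<forall>t. RT (lo t) F = (\<Sum>n<N. fscale (t ^ n) (w n)))"
    and "\<And>F. F \<in> C \<Longrightarrow> \<exists>A a. finite A \<and> (\<forall>i\<in>A. a i \<in> C) \<and>
      (\<forall>s. s \<noteq> 0 \<longrightarrow> RT (tor s) F = (\<Sum>i\<in>A. fscale (s powi i) (a i)))"
  shows "bmodule C (\<lambda>t. RT (lo t)) (\<lambda>s. RT (tor s))"
  by standard (use assms in \<open>simp_all add: lin_on_RT RT_RT RT_1 lo_add tor_mult tor_lo\<close>)

text \<open>
  A function \<open>y\<close> with \<open>y (g * lo t) = y g + t\<close> trivialises the right action of the lower unitriangular
  matrices over \<open>D\<close>. Functions on \<open>D\<close> are then polynomials in \<open>y\<close> with invariant coefficients.
\<close>

locale ycoord = bmodule C "\<lambda>t. RT (lo t)" "\<lambda>s. RT (tor s)"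
  for C :: "('k::alg_closed_field sl2 \<times> 'i \<Rightarrow> 'k) set" +
  fixes D :: "'k sl2 set" and y :: "'k sl2 \<Rightarrow> 'k" and p :: nat
  assumes prime: "prime p" and char: "CHAR('k) = p" and p_odd: "odd p"
    and supp: "F \<in> C \<Longrightarrow> g \<notin> D \<Longrightarrow> F (g, c) = 0"
    and D_lo: "g * lo t \<in> D \<longleftrightarrow> g \<in> D"
    and D_tor: "s \<noteq> 0 \<Longrightarrow> g * tor s \<in> D \<longleftrightarrow> g \<in> D"
    and y_lo: "g \<in> D \<Longrightarrow> y (g * lo t) = y g + t"
    and y_tor: "g \<in> D \<Longrightarrow> s \<noteq> 0 \<Longrightarrow> y (g * tor s) = s\<^sup>2 * y g"
    and y_C: "F \<in> C \<Longrightarrow> mul y F \<in> C"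
begin

sublocale xmodule p "dX p (\<lambda>t. RT (lo t))" W
  by (rule xmodule[OF prime char p_odd])

abbreviation "X \<equiv> dX p (\<lambda>t. RT (lo t))"
abbreviation "ypow n \<equiv> mul (\<lambda>g. y g ^ n)"

text \<open>Restriction to the slice y = 0, extended constantly along the orbits of the lower
  unitriangular group.\<close>

definition ev :: "('k sl2 \<times> 'i \<Rightarrow> 'k) \<Rightarrow> ('k sl2 \<times> 'i \<Rightarrow> 'k)" where
  "ev F = (\<lambda>(g, c). if g \<in> D then F (g * lo (- y g), c) else 0)"

lemma ypow_C: "F \<in> C \<Longrightarrow> ypow n F \<in> C"
proof (induction n)
  case 0
  have "ypow 0 F = F" by (auto simp: fun_eq_iff)
  then show ?case using 0 by simp
next
  case (Suc n)
  then show ?case using y_C[OF Suc.IH] by (simp add: mul_mul)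
qed

lemma RT_lo_apply:
  assumes F: "F \<in> C" and N: "\<And>t. RT (lo t) F = (\<Sum>n<N. fscale (t ^ n) (E n F))"
  shows "F (g * lo t, c) = (\<Sum>n<N. t ^ n * E n F (g, c))"
  using fun_cong[OF N[of t], of "(g, c)"] by (simp add: sum_fun_apply fscale_def)

text \<open>Expanding F(g lo(-y)) in powers of y expresses \<open>ev F\<close> by the divided powers
  of \<open>F\<close> times powers of y, all of which stay in \<open>C\<close>.\<close>

lemma ev_C:
  assumes F: "F \<in> C"
  shows "ev F \<in> C"
proof -
  obtain N where N: "\<forall>n\<ge>N. E n F = 0" "\<forall>t. RT (lo t) F = (\<Sum>n<N. fscale (t ^ n) (E n F))"
    using E_ex[OF F] by blast
  have "ev F = (\<Sum>n<N. fscale ((-1) ^ n) (ypow n (E n F)))"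
  proof (rule ext, clarify)
    fix g c
    show "ev F (g, c) = (\<Sum>n<N. fscale ((-1) ^ n) (ypow n (E n F))) (g, c)"
    proof (cases "g \<in> D")
      case True
      then have "ev F (g, c) = (\<Sum>n<N. (- y g) ^ n * E n F (g, c))"
        using RT_lo_apply[OF F N(2)[rule_format]] by (simp add: ev_def)
      then show ?thesis
        by (simp add: sum_fun_apply fscale_def power_minus[of "y g"] mult.assoc)
    next
      case False
      then show ?thesis
        using supp[OF E_C[OF F]] by (simp add: ev_def sum_fun_apply fscale_def)
    qed
  qed
  also have "\<dots> \<in> C"
    by (intro fun_space.subspace_sum[OF C_sub] fun_space.subspace_scale[OF C_sub] ypow_C E_C F)
  finally show ?thesis .
qed

lemma ev_lo: "RT (lo t) (ev F) = ev F"
proof (rule ext, clarify)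
  fix g c
  show "RT (lo t) (ev F) (g, c) = ev F (g, c)"
    using D_lo[of g t] y_lo[of g t] by (auto simp: ev_def mult.assoc lo_add)
qed

lemma ev_W:
  assumes "F \<in> W w"
  shows "ev F \<in> W w"
proof -
  have "RT (tor s) (ev F) = fscale (s powi w) (ev F)" if s: "s \<noteq> 0" for s
  proof (rule ext, clarify)
    fix g c
    show "RT (tor s) (ev F) (g, c) = fscale (s powi w) (ev F) (g, c)"
    proof (cases "g \<in> D")
      case True
      have "g * tor s * lo (- y (g * tor s)) = g * lo (- y g) * tor s"
        using y_tor[OF True s] lo_tor[OF s, of "- y g"] by (simp add: mult.assoc mult.commute)
      then show ?thesis
        using True D_tor[OF s] fun_cong[OF W_H[OF assms s], of "(g * lo (- y g), c)"]
        by (simp add: ev_def fscale_def)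
    next
      case False
      then show ?thesis using D_tor[OF s] by (simp add: ev_def fscale_def)
    qed
  qed
  then show ?thesis using ev_C[OF W_C[OF assms]] by (simp add: wsp_def)
qed

text \<open>Taylor expansion along the orbit, starting at its point with y = 0.\<close>

lemma ev_expand:
  assumes F: "F \<in> C" and N: "\<And>n. n \<ge> N \<Longrightarrow> E n F = 0"
  shows "F = (\<Sum>n<N. ypow n (ev (E n F)))"
proof (rule ext, clarify)
  fix g c
  obtain M where M: "\<And>n. n \<ge> M \<Longrightarrow> E n F = 0"
    "\<And>t N'. N' \<ge> M \<Longrightarrow> RT (lo t) F = (\<Sum>n<N'. fscale (t ^ n) (E n F))"
    using E_expand[OF F] by blast
  have R: "RT (lo t) F = (\<Sum>n<N. fscale (t ^ n) (E n F))" for t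
  proof -
    have "RT (lo t) F = (\<Sum>n<max N M. fscale (t ^ n) (E n F))" by (rule M(2)) simp
    also have "\<dots> = (\<Sum>n<N. fscale (t ^ n) (E n F))"
      by (rule sum_fscale_extend) (use N in auto)
    finally show ?thesis .
  qed
  show "F (g, c) = (\<Sum>n<N. ypow n (ev (E n F))) (g, c)"
  proof (cases "g \<in> D")
    case True
    have "F (g, c) = F (g * lo (- y g) * lo (y g), c)" by (simp add: mult.assoc lo_add)
    also have "\<dots> = (\<Sum>n<N. y g ^ n * E n F (g * lo (- y g), c))"
      by (rule RT_lo_apply[OF F R])
    finally show ?thesis using True by (simp add: sum_fun_apply ev_def)
  next
    case False
    then show ?thesis using supp[OF F] by (simp add: sum_fun_apply ev_def)
  qed
qed

lemma E_ypow:
  assumes G: "G \<in> C" "\<And>t. RT (lo t) G = G"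
  shows "E m (ypow n G) = fscale (of_nat (n choose m)) (ypow (n - m) G)"
proof (rule dpow_eq[where N = "Suc n" and w = "\<lambda>m. fscale (of_nat (n choose m)) (ypow (n - m) G)"])
  show "RT (lo t) (ypow n G) = (\<Sum>m<Suc n. fscale (t ^ m) (fscale (of_nat (n choose m)) (ypow (n - m) G)))" for t
  proof (rule ext, clarify)
    fix g c
    have *: "G (g * lo t, c) = G (g, c)"
      using fun_cong[OF G(2)[of t], of "(g, c)"] by simp
    show "RT (lo t) (ypow n G) (g, c) =
      (\<Sum>m<Suc n. fscale (t ^ m) (fscale (of_nat (n choose m)) (ypow (n - m) G))) (g, c)"
    proof (cases "g \<in> D")
      case True
      have "(t + y g) ^ n = (\<Sum>m<Suc n. of_nat (n choose m) * t ^ m * y g ^ (n - m))"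
        unfolding binomial_ring lessThan_Suc_atMost ..
      then show ?thesis
        using y_lo[OF True, of t] *
        by (simp add: sum_fun_apply fscale_def sum_distrib_left mult_ac add.commute del: sum.lessThan_Suc)
    next
      case False
      then show ?thesis using supp[OF G(1)] D_lo[of g t] by (simp add: sum_fun_apply fscale_def)
    qed
  qed
qed (auto simp: binomial_eq_0)

lemma X_ypow:
  assumes "G \<in> C" "\<And>t. RT (lo t) G = G"
  shows "X i (ypow n G) = fscale (of_nat (n div p ^ i)) (ypow (n - p ^ i) G)"
  unfolding dX_def E_ypow[OF assms] of_nat_choose_char[OF prime char] ..

lemma ypow_W:
  assumes "G \<in> W w"
  shows "ypow n G \<in> W (w + 2 * int n)"
proof -
  have "RT (tor s) (ypow n G) = fscale (s powi (w + 2 * int n)) (ypow n G)" if s: "s \<noteq> 0" for s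
  proof (rule ext, clarify)
    fix g c
    have *: "G (g * tor s, c) = s powi w * G (g, c)"
      using fun_cong[OF W_H[OF assms s], of "(g, c)"] by (simp add: fscale_def)
    have **: "s powi (w + 2 * int n) = s powi w * (s\<^sup>2) ^ n"
      using s power_int_of_nat[of s "2 * n"] by (simp add: power_int_add power_mult)
    show "RT (tor s) (ypow n G) (g, c) = fscale (s powi (w + 2 * int n)) (ypow n G) (g, c)"
    proof (cases "g \<in> D")
      case True
      then show ?thesis
        using y_tor[OF True s] * ** by (simp add: fscale_def power_mult_distrib)
    next
      case False
      then show ?thesis using supp[OF W_C[OF assms]] D_tor[OF s] by (simp add: fscale_def)
    qed
  qed
  then show ?thesis using ypow_C[OF W_C[OF assms]] by (simp add: wsp_def)
qed

text \<open>Multiples of p^q are peeled off n one at a time; below p^(q+1) each binomial factor is a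
  nonzero digit. Hence X_q^j v = 0 kills every \<open>E n v\<close> in the stated range.\<close>

lemma E_via_X:
  assumes v: "v \<in> C" and n: "j * p ^ q \<le> n" "n < p * p ^ q"
  shows "\<exists>c. c \<noteq> 0 \<and> E (n - j * p ^ q) ((X q ^^ j) v) = fscale c (E n v)"
  using n(1)
proof (induction j)
  case 0
  show ?case by (rule exI[of _ 1]) simp
next
  case (Suc j)
  let ?P = "p ^ q" and ?w = "(X q ^^ j) v"
  have P: "?P > 0" using prime_gt_0_nat[OF prime] by simp
  have w: "?w \<in> C" unfolding dX_pow[OF prime char v] by (intro fun_space.subspace_scale[OF C_sub] E_C v)
  obtain c where c: "c \<noteq> 0" "E (n - j * ?P) ?w = fscale c (E n v)" using Suc by auto
  have eq: "n - Suc j * ?P + ?P = n - j * ?P" using Suc.prems by simp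
  have "(n - j * ?P) div ?P > 0"
    using Suc.prems P by (simp add: div_greater_zero_iff)
  moreover have "(n - j * ?P) div ?P < p"
    using n(2) P by (simp add: less_mult_imp_div_less)
  ultimately have c': "(of_nat ((n - j * ?P) div ?P) :: 'k) \<noteq> 0"
    using char by (simp add: of_nat_eq_0_iff_char_dvd nat_dvd_not_less)
  have "E (n - Suc j * ?P) (E ?P ?w) = fscale (of_nat (n - j * ?P choose ?P)) (E (n - j * ?P) ?w)"
    using E_E[OF w, of "n - Suc j * ?P" ?P] binomial_symmetric[of ?P "n - j * ?P"] Suc.prems eq
    by (metis add_diff_cancel_right' le_add2)
  then show ?case
    using c c' of_nat_choose_char[OF prime char, of "n - j * ?P" q]
    by (intro exI[of _ "of_nat ((n - j * ?P) div ?P) * c"]) (simp add: dX_def)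
qed

lemma Xpow_ypow:
  assumes G: "G \<in> C" "\<And>t. RT (lo t) G = G" and n: "n < p ^ q"
  shows "(X q ^^ j) (ypow (n + j * p ^ q) G) = fscale (of_nat (fact j)) (ypow n G)"
proof (induction j)
  case (Suc j)
  let ?P = "p ^ q"
  have "(n + Suc j * ?P) div ?P = Suc j"
    using n by (simp add: div_nat_eqI)
  then have 1: "X q (ypow (n + Suc j * ?P) G) = fscale (of_nat (Suc j)) (ypow (n + j * ?P) G)"
    using X_ypow[OF G, of q "n + Suc j * ?P"] by simp
  have "lin_on C (X q ^^ j)" for j
    unfolding lin_on_def dX_def[symmetric]
    using dX_pow[OF prime char] lin_on_add[OF C_sub E_lin] lin_on_scale[OF C_sub E_lin]
      fun_space.subspace_add[OF C_sub] fun_space.subspace_scale[OF C_sub]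
    by (simp add: fun_space.scale_right_distrib mult.commute)
  then have "(X q ^^ j) (X q (ypow (n + Suc j * ?P) G)) = fscale (of_nat (Suc j)) (fscale (of_nat (fact j)) (ypow n G))"
    unfolding 1 using Suc.IH lin_on_scale[OF C_sub _ ypow_C[OF G(1)]] by metis
  then show ?case by (simp add: funpow_swap1 del: of_nat_Suc funpow.simps) (simp add: funpow_swap1 algebra_simps)
qed simp

end

context ycoord
begin

text \<open>By \<open>ev_expand\<close>, vectors are polynomials in y with invariant coefficients,
  and X_q sends y^n to n div p^q times y^(n - p^q). Since the X_i with i > q kill \<open>v\<close>,
  exponents stay below p^(q+1); a preimage is written down termwise by raising exponents and
  dividing by the scalar that the operator produces.\<close>

lemma ycoord_free: free
  unfolding free_def
proof (intro allI impI)
  fix q w v h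
  assume h: "h \<ge> 1" and v: "v \<in> W w" and Xi: "\<forall>i>q. X i v = 0" and D0: "Dop p X q (Suc h) v = 0"
  define P where "P = p ^ q"
  have P: "P > 0" using prime_gt_0_nat[OF prime] by (simp add: P_def)
  have vC: "v \<in> C" using W_C[OF v] .
  have high: "E n v = 0" if "n \<ge> p * P" for n
    by (rule E_high[OF prime char vC, of "Suc q"]) (use Xi that in \<open>auto simp: P_def Suc_le_eq\<close>)
  have low: "E n v = 0" if j: "(X q ^^ j) v = 0" "n \<ge> j * P" for n j
  proof (cases "n < p * P")
    case True
    then obtain c where "c \<noteq> 0" "E (n - j * P) ((X q ^^ j) v) = fscale c (E n v)"
      using E_via_X[OF vC, of j q n] j(2) by (auto simp: P_def)
    then show ?thesis using j(1) lin_on_0[OF C_sub E_lin] by (metis fun_space.scale_eq_0_iff)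
  qed (use high in simp)
  define G where "G n = ev (E n v)" for n
  have GW: "G n \<in> W (w - 2 * int n)" for n
    unfolding G_def by (rule ev_W[OF E_W[OF v]])
  have GC: "G n \<in> C" for n by (rule W_C[OF GW])
  have Ginv: "RT (lo t) (G n) = G n" for n t unfolding G_def by (rule ev_lo)
  have Plarge: "p * P \<le> p ^ i" if "i > q" for i
    unfolding P_def power_Suc[symmetric]
    using that prime_gt_0_nat[OF prime] by (intro power_increasing) auto
  have Xu: "X i (\<Sum>n<N. fscale (c n) (ypow (n + k) (G n))) = 0" if "i > q" "N + k \<le> p * P" for i N k c
  proof -
    have "X i (\<Sum>n<N. fscale (c n) (ypow (n + k) (G n))) = (\<Sum>n<N. fscale (c n) (X i (ypow (n + k) (G n))))"
      unfolding dX_def by (rule lin_on_sum_scale[OF C_sub E_lin]) (rule ypow_C[OF GC])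
    also have "\<dots> = 0"
      using that Plarge[OF that(1)] by (intro sum.neutral) (simp add: X_ypow[OF GC Ginv])
    finally show ?thesis .
  qed
  have uW: "(\<Sum>n<N. fscale (c n) (ypow (n + k) (G n))) \<in> W (w + 2 * int k)" for N c k
  proof -
    have "ypow (n + k) (G n) \<in> W (w + 2 * int k)" for n
      using ypow_W[OF GW, of "n + k" n] by simp
    then show ?thesis
      by (intro fun_space.subspace_sum[OF W_sub] fun_space.subspace_scale[OF W_sub])
  qed
  show "\<exists>u\<in>W (w + 2 * wt_inc p q h). (\<forall>i>q. X i u = 0) \<and> Dop p X q h u = v"
  proof (cases "odd h")
    case True
    \<comment> \<open>For odd \<open>h\<close> the hypothesis is X_q^(p-1) v = 0, so n < (p-1) p^q.
      Then n div p^q + 1 is less than p, hence invertible, and the raised exponents stay below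
      p^(q+1).\<close>
    define N where "N = (p - 1) * P"
    have NP: "N + P = p * P" using prime_gt_0_nat[OF prime] by (cases p) (auto simp: N_def)
    define u where "u = (\<Sum>n<N. fscale (inverse (of_nat (Suc (n div P)))) (ypow (n + P) (G n)))"
    have zero: "E n v = 0" if "n \<ge> N" for n
      by (rule low[of "p - 1"]) (use D0 True that in \<open>auto simp: Dop_def N_def\<close>)
    have "X q u = (\<Sum>n<N. fscale (inverse (of_nat (Suc (n div P)))) (X q (ypow (n + P) (G n))))"
      unfolding u_def dX_def by (rule lin_on_sum_scale[OF C_sub E_lin]) (rule ypow_C[OF GC])
    also have "\<dots> = (\<Sum>n<N. ypow n (G n))"
    proof (rule sum.cong[OF refl])
      fix n assume "n \<in> {..<N}"
      then have "n div P < p - 1" using P by (simp add: N_def less_mult_imp_div_less)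
      then have "(of_nat (Suc (n div P)) :: 'k) \<noteq> 0"
        using char by (simp add: of_nat_eq_0_iff_char_dvd nat_dvd_not_less del: of_nat_Suc)
      moreover have "(n + P) div p ^ q = Suc (n div P)" using P by (simp add: P_def)
      ultimately show "fscale (inverse (of_nat (Suc (n div P)))) (X q (ypow (n + P) (G n))) = ypow n (G n)"
        using X_ypow[OF GC Ginv, of q "n + P"] by (simp add: P_def del: of_nat_Suc)
    qed
    also have "\<dots> = v"
      unfolding G_def by (rule ev_expand[OF vC zero, symmetric])
    finally have "Dop p X q h u = v" using True by (simp add: Dop_def)
    moreover have "u \<in> W (w + 2 * int P)" unfolding u_def by (rule uW)
    then have "u \<in> W (w + 2 * wt_inc p q h)"
      using True by (simp add: wt_inc_def P_def)
    moreover have "\<forall>i>q. X i u = 0" unfolding u_def using Xu NP by simp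
    ultimately show ?thesis by blast
  next
    case False
    \<comment> \<open>For even \<open>h\<close> the hypothesis is X_q v = 0, so n < p^q. Raising by
      (p-1) p^q makes X_q^(p-1) return to y^n with the invertible factor (p-1)!.\<close>
    define k where "k = (p - 1) * P"
    have kP: "P + k = p * P" using prime_gt_0_nat[OF prime] by (cases p) (auto simp: k_def)
    define u where "u = (\<Sum>n<P. fscale (inverse (of_nat (fact (p - 1)))) (ypow (n + k) (G n)))"
    have zero: "E n v = 0" if "n \<ge> P" for n
      by (rule low[of 1]) (use D0 False that in \<open>auto simp: Dop_def\<close>)
    have f: "(of_nat (fact (p - 1)) :: 'k) \<noteq> 0"
      using of_nat_fact_neq_0[OF prime char, of "p - 1"] prime_gt_0_nat[OF prime] by simp
    have "(X q ^^ (p - 1)) u = (\<Sum>n<P. fscale (inverse (of_nat (fact (p - 1)))) ((X q ^^ (p - 1)) (ypow (n + k) (G n))))"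
      unfolding u_def
    proof (rule lin_on_sum_scale[OF W_sub Xpow_lin])
      show "ypow (n + k) (G n) \<in> W (w + 2 * int k)" for n
        using ypow_W[OF GW, of "n + k" n] by simp
    qed
    also have "\<dots> = (\<Sum>n<P. ypow n (G n))"
    proof (rule sum.cong[OF refl])
      fix n assume "n \<in> {..<P}"
      then have "(X q ^^ (p - 1)) (ypow (n + k) (G n)) = fscale (of_nat (fact (p - 1))) (ypow n (G n))"
        using Xpow_ypow[OF GC Ginv, of n q "p - 1"] by (simp add: k_def P_def)
      then show "fscale (inverse (of_nat (fact (p - 1)))) ((X q ^^ (p - 1)) (ypow (n + k) (G n))) = ypow n (G n)"
        using f by (simp del: of_nat_fact)
    qed
    also have "\<dots> = v"
      unfolding G_def by (rule ev_expand[OF vC zero, symmetric])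
    finally have "Dop p X q h u = v" using False by (simp add: Dop_def)
    moreover have "u \<in> W (w + 2 * int k)" unfolding u_def by (rule uW)
    then have "u \<in> W (w + 2 * wt_inc p q h)"
      using False by (simp add: wt_inc_def P_def k_def)
    moreover have "\<forall>i>q. X i u = 0" unfolding u_def using Xu kP by simp
    ultimately show ?thesis by blast
  qed
qed

end


section \<open>Regular functions\<close>

abbreviation "CR \<equiv> coordinate_ring"

lemma CR_ent: "ent i j \<in> CR"
  unfolding ent_def[abs_def] by (rule coordinate_ring.entry)

lemma CR_scale: "f \<in> CR \<Longrightarrow> (\<lambda>g. c * f g) \<in> CR"
  by (rule coordinate_ring.mult[OF coordinate_ring.const])

lemma CR_sub: "fun_space.subspace CR"
  unfolding fun_space.subspace_def
  using coordinate_ring.const[of 0] coordinate_ring.add CR_scale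
  by (auto simp: fscale_def zero_fun_def plus_fun_def)

lemma CR_power: "f \<in> CR \<Longrightarrow> (\<lambda>g. f g ^ n) \<in> CR"
  by (induction n) (auto intro: coordinate_ring.const coordinate_ring.mult)

lemma CR_sum: "(\<And>a. a \<in> A \<Longrightarrow> f a \<in> CR) \<Longrightarrow> (\<lambda>g. \<Sum>a\<in>A. f a g) \<in> CR"
  using fun_space.subspace_sum[OF CR_sub, of A f] by (simp add: sum_fun_apply[abs_def])

lemma CR_diff: "f \<in> CR \<Longrightarrow> h \<in> CR \<Longrightarrow> (\<lambda>g. f g - h g) \<in> CR"
  using fun_space.subspace_diff[OF CR_sub] by (simp add: fun_diff_def)

lemma CR_poly:
  assumes f: "f \<in> CR" and \<phi>: "\<And>i j. \<exists>P. \<forall>t. ent i j (\<phi> t) = poly P t"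
  shows "\<exists>P. \<forall>t. f (\<phi> t) = poly P t"
  using f
proof induction
  case (const c)
  show ?case by (rule exI[of _ "[:c:]"]) simp
next
  case (entry i j)
  show ?case using \<phi>[of i j] by (simp add: ent_def)
next
  case (add f h)
  then show ?case by (metis poly_add)
next
  case (mult f h)
  then show ?case by (metis poly_mult)
qed

lemma ent_poly:
  fixes g h :: "'k::field sl2"
  shows "\<exists>P. \<forall>t. ent i j (g * lo t * h) = poly P t" "\<exists>P. \<forall>t. ent i j (g * upp t * h) = poly P t"
proof -
  have 1: "\<exists>P. \<forall>t. ent i j (g * \<phi> t * h) = poly P t"
    if \<phi>: "\<And>i j. \<exists>P. \<forall>t::'k. ent i j (\<phi> t) = poly P t" for \<phi>
  proof -
    obtain P where P: "\<And>i j t. ent i j (\<phi> t) = poly (P i j) t" using \<phi> by metis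
    have "ent i j (g * \<phi> t * h) = poly (\<Sum>l\<in>{1,2}. smult (ent l j h) (\<Sum>m\<in>{1,2}. smult (ent i m g) (P m l))) t" for t
      by (simp add: ent_mult P poly_sum algebra_simps)
    then show ?thesis by blast
  qed
  have 2: "i = 1 \<or> i = 2" for i :: 2 by (rule exhaust_2)
  have "\<exists>P. \<forall>t::'k. ent i j (lo t) = poly P t" for i j
    using 2[of i] 2[of j]
    by (auto intro: exI[of _ "[:0:]"] exI[of _ "[:1:]"] exI[of _ "[:0, 1:]"])
  then show "\<exists>P. \<forall>t. ent i j (g * lo t * h) = poly P t" by (rule 1)
  have "\<exists>P. \<forall>t::'k. ent i j (upp t) = poly P t" for i j
    using 2[of i] 2[of j]
    by (auto intro: exI[of _ "[:0:]"] exI[of _ "[:1:]"] exI[of _ "[:0, 1:]"])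
  then show "\<exists>P. \<forall>t. ent i j (g * upp t * h) = poly P t" by (rule 1)
qed

lemma CR_lo: "f \<in> CR \<Longrightarrow> \<exists>P. \<forall>t. f (g * lo t * h) = poly P t"
  by (erule CR_poly) (rule ent_poly)

lemma CR_upp: "f \<in> CR \<Longrightarrow> \<exists>P. \<forall>t. f (g * upp t * h) = poly P t"
  by (erule CR_poly) (rule ent_poly)

lemma CR_tor:
  assumes "f \<in> CR"
  shows "\<exists>N P. \<forall>s. s \<noteq> 0 \<longrightarrow> s ^ N * f (tor s) = poly P s"
  using assms
proof induction
  case (const c)
  show ?case by (rule exI[of _ 0], rule exI[of _ "[:c:]"]) simp
next
  case (entry i j)
  have "i = 1 \<or> i = 2" "j = 1 \<or> j = 2" by (rule exhaust_2)+
  then have "\<exists>P. \<forall>s. s \<noteq> 0 \<longrightarrow> s ^ 1 * ent i j (tor s) = poly P s"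
    by (auto intro: exI[of _ "[:0:]"] exI[of _ "[:1:]"] exI[of _ "[:0, 0, 1:]"])
  then show ?case unfolding ent_def by blast
next
  case (add f h)
  then obtain N P M Q where *: "\<And>s. s \<noteq> 0 \<Longrightarrow> s ^ N * f (tor s) = poly P s"
    "\<And>s. s \<noteq> 0 \<Longrightarrow> s ^ M * h (tor s) = poly Q s" by metis
  have "s ^ (N + M) * (f (tor s) + h (tor s)) = poly (monom 1 M * P + monom 1 N * Q) s" if "s \<noteq> 0" for s
    using *[OF that, symmetric] by (simp add: poly_monom power_add algebra_simps)
  then show ?case by blast
next
  case (mult f h)
  then obtain N P M Q where *: "\<And>s. s \<noteq> 0 \<Longrightarrow> s ^ N * f (tor s) = poly P s"
    "\<And>s. s \<noteq> 0 \<Longrightarrow> s ^ M * h (tor s) = poly Q s" by metis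
  have "s ^ (N + M) * (f (tor s) * h (tor s)) = poly (P * Q) s" if "s \<noteq> 0" for s
    using *[OF that, symmetric] by (simp add: power_add algebra_simps)
  then show ?case by blast
qed

definition ten :: "('k::field sl2 \<Rightarrow> 'k) \<Rightarrow> ('i \<Rightarrow> 'k) \<Rightarrow> ('k sl2 \<times> 'i \<Rightarrow> 'k)" where
  "ten f w = (\<lambda>(g, c). f g * w c)"

text \<open>\<open>C \<otimes> k[G]\<close>, realised as functions on the product of \<open>G\<close> with the index set of \<open>C\<close>.\<close>

definition Om :: "('i \<Rightarrow> 'k::field) set \<Rightarrow> ('k sl2 \<times> 'i \<Rightarrow> 'k) set" where
  "Om C = fun_space.span {ten f w | f w. f \<in> CR \<and> w \<in> C}"

lemma ten_apply [simp]: "ten f w (g, c) = f g * w c"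
  by (simp add: ten_def)

lemma Om_sub: "fun_space.subspace (Om C)"
  by (simp add: Om_def fun_space.subspace_span)

lemma Om_ten: "f \<in> CR \<Longrightarrow> w \<in> C \<Longrightarrow> ten f w \<in> Om C"
  unfolding Om_def by (rule fun_space.span_base) blast

lemma Om_induct [consumes 1, case_names zero step]:
  assumes "F \<in> Om C" "Q 0"
    "\<And>c f w F. f \<in> CR \<Longrightarrow> w \<in> C \<Longrightarrow> F \<in> Om C \<Longrightarrow> Q F \<Longrightarrow> Q (fscale c (ten f w) + F)"
  shows "Q F"
proof -
  have "F \<in> Om C \<and> Q F"
    using assms(1)[unfolded Om_def]
  proof (induction rule: fun_space.span_induct_alt)
    case base
    then show ?case using assms(2) fun_space.subspace_0[OF Om_sub] by blast
  next
    case (step c x y)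
    then obtain f w where x: "x = ten f w" "f \<in> CR" "w \<in> C" by blast
    have "fscale c x + y \<in> Om C"
      using step.IH Om_ten[OF x(2,3)] unfolding x(1)
      by (blast intro: fun_space.subspace_add[OF Om_sub] fun_space.subspace_scale[OF Om_sub])
    moreover have "Q (fscale c x + y)"
      unfolding x(1) using step.IH x assms(3) by blast
    ultimately show ?case ..
  qed
  then show ?thesis ..
qed

lemma Om_map:
  assumes F: "F \<in> Om C" and lin: "lin_on UNIV \<Phi>" and S: "fun_space.subspace S"
    and gen: "\<And>f w. f \<in> CR \<Longrightarrow> w \<in> C \<Longrightarrow> \<Phi> (ten f w) \<in> S"
  shows "\<Phi> F \<in> S"
  using F
proof (induction rule: Om_induct)
  case zero
  show "\<Phi> 0 \<in> S"
    using lin_on_0[OF fun_space.subspace_UNIV lin] fun_space.subspace_0[OF S] by simp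
next
  case (step c f w F)
  then show "\<Phi> (fscale c (ten f w) + F) \<in> S"
    using lin_on_add[OF fun_space.subspace_UNIV lin] lin_on_scale[OF fun_space.subspace_UNIV lin] gen
      fun_space.subspace_add[OF S] fun_space.subspace_scale[OF S] by simp
qed

lemma Om_mul:
  fixes C :: "('i \<Rightarrow> 'k::field) set"
  assumes F: "F \<in> Om C" and f: "f \<in> CR"
  shows "mul f F \<in> Om C"
proof (rule Om_map[OF F lin_on_mul Om_sub])
  fix h :: "'k sl2 \<Rightarrow> 'k" and w assume "h \<in> CR" "w \<in> C"
  moreover have "mul f (ten h w) = ten (\<lambda>g. f g * h g) w" by (auto simp: fun_eq_iff)
  ultimately show "mul f (ten h w) \<in> Om C"
    using coordinate_ring.mult[OF f, of h] by (simp add: Om_ten)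
qed

lemma Om_CR_times:
  fixes F F' :: "'k::field sl2 \<times> 'k sl2 \<Rightarrow> 'k"
  assumes "F \<in> Om CR" "F' \<in> Om CR"
  shows "(\<lambda>x. F x * F' x) \<in> Om CR"
proof (rule Om_map[OF assms(1) _ Om_sub])
  show "lin_on UNIV (\<lambda>F x. F x * F' x)"
    by (auto simp: lin_on_def fscale_def fun_eq_iff algebra_simps)
  fix f w :: "'k sl2 \<Rightarrow> 'k" assume fw: "f \<in> CR" "w \<in> CR"
  show "(\<lambda>x. ten f w x * F' x) \<in> Om CR"
  proof (rule Om_map[OF assms(2) _ Om_sub])
    show "lin_on UNIV (\<lambda>F' x. ten f w x * F' x)"
      by (auto simp: lin_on_def fscale_def fun_eq_iff algebra_simps)
    fix f' w' :: "'k sl2 \<Rightarrow> 'k" assume "f' \<in> CR" "w' \<in> CR"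
    moreover have "(\<lambda>x. ten f w x * ten f' w' x) = ten (\<lambda>g. f g * f' g) (\<lambda>g. w g * w' g)"
      by (auto simp: fun_eq_iff)
    ultimately show "(\<lambda>x. ten f w x * ten f' w' x) \<in> Om CR"
      using fw by (simp add: Om_ten coordinate_ring.mult)
  qed
qed

text \<open>The comultiplication of k[G]. The translating element is put first, so that the result
  is a function of it with values in \<open>CR\<close>.\<close>

lemma CR_comult:
  fixes f :: "'k::field sl2 \<Rightarrow> 'k"
  assumes "f \<in> CR"
  shows "(\<lambda>(h, g). f (g * h)) \<in> Om CR"
  using assms
proof induction
  case (const c)
  have "(\<lambda>(h :: 'k sl2, g :: 'k sl2). c) = ten (\<lambda>_. c) (\<lambda>_. 1)" by (auto simp: fun_eq_iff)
  then show "(\<lambda>(h :: 'k sl2, g :: 'k sl2). c) \<in> Om CR"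
    using Om_ten coordinate_ring.const by metis
next
  case (entry i j)
  have "(\<lambda>(h :: 'k sl2, g). Rep_sl2 (g * h) $ i $ j) = ten (ent 1 j) (ent i 1) + ten (ent 2 j) (ent i 2)"
    by (auto simp: fun_eq_iff ent_def ent_mult[unfolded ent_def] mult.commute)
  also have "\<dots> \<in> Om CR"
    by (intro fun_space.subspace_add[OF Om_sub] Om_ten CR_ent)
  finally show "(\<lambda>(h :: 'k sl2, g). Rep_sl2 (g * h) $ i $ j) \<in> Om CR" .
next
  case (add f h)
  have "(\<lambda>(x, g). f (g * x) + h (g * x)) = (\<lambda>(x, g). f (g * x)) + (\<lambda>(x, g). h (g * x))"
    by (auto simp: fun_eq_iff)
  also have "\<dots> \<in> Om CR"
    by (intro fun_space.subspace_add[OF Om_sub] add.IH)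
  finally show "(\<lambda>(x, g). f (g * x) + h (g * x)) \<in> Om CR" .
next
  case (mult f h)
  have "(\<lambda>(x, g). f (g * x) * h (g * x)) = (\<lambda>y. (\<lambda>(x, g). f (g * x)) y * (\<lambda>(x, g). h (g * x)) y)"
    by (auto simp: fun_eq_iff)
  also have "\<dots> \<in> Om CR" by (rule Om_CR_times[OF mult.IH])
  finally show "(\<lambda>(x, g). f (g * x) * h (g * x)) \<in> Om CR" .
qed

lemma Om_comult:
  fixes C :: "('i \<Rightarrow> 'k::field) set"
  assumes "F \<in> Om C"
  shows "(\<lambda>(h, x). F (fst x * h, snd x)) \<in> Om (Om C)"
proof (rule Om_map[OF assms _ Om_sub])
  show "lin_on UNIV (\<lambda>F (h, x). F (fst x * h, snd x))"
    by (auto simp: lin_on_def fscale_def fun_eq_iff)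
  fix f :: "'k sl2 \<Rightarrow> 'k" and w assume fw: "f \<in> CR" "w \<in> C"
  have "(\<lambda>(h, x). ten f w (fst x * h, snd x)) = (\<lambda>K (h, x). K (h, fst x) * w (snd x)) (\<lambda>(h, g). f (g * h))"
    by (auto simp: fun_eq_iff)
  also have "\<dots> \<in> Om (Om C)"
  proof (rule Om_map[OF CR_comult[OF fw(1)] _ Om_sub])
    show "lin_on UNIV (\<lambda>K (h, x). K (h, fst x) * w (snd x))"
      by (auto simp: lin_on_def fscale_def fun_eq_iff algebra_simps)
    fix a b :: "'k sl2 \<Rightarrow> 'k" assume "a \<in> CR" "b \<in> CR"
    moreover have "(\<lambda>(h, x). ten a b (h, fst x) * w (snd x)) = ten a (ten b w)"
      by (auto simp: fun_eq_iff)
    ultimately show "(\<lambda>(h, x). ten a b (h, fst x) * w (snd x)) \<in> Om (Om C)"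
      using fw(2) by (simp add: Om_ten)
  qed
  finally show "(\<lambda>(h, x). ten f w (fst x * h, snd x)) \<in> Om (Om C)" .
qed

text \<open>The shape required by the last clause of \<open>rational_module\<close>.\<close>

lemma Om_sum_form:
  fixes C :: "('i \<Rightarrow> 'k::field) set"
  assumes "F \<in> Om C"
  shows "\<exists>(n::nat) w f. (\<forall>i<n. w i \<in> C \<and> f i \<in> CR) \<and> (\<forall>g. (\<lambda>c. F (g, c)) = (\<Sum>i<n. fscale (f i g) (w i)))"
  using assms
proof (induction rule: Om_induct)
  case zero
  show ?case by (rule exI[of _ 0]) (simp add: zero_fun_def)
next
  case (step c f0 w0 F)
  obtain n w and f :: "nat \<Rightarrow> 'k sl2 \<Rightarrow> 'k" where *: "\<forall>i<n. w i \<in> C \<and> f i \<in> CR" "\<forall>g. (\<lambda>c. F (g, c)) = (\<Sum>i<n. fscale (f i g) (w i))"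
    using step.IH by blast
  let ?w = "w(n := w0)" and ?f = "f(n := (\<lambda>g. c * f0 g))"
  have "\<forall>i<Suc n. ?w i \<in> C \<and> ?f i \<in> CR"
    using * step.hyps CR_scale by (auto simp: less_Suc_eq)
  moreover have "(\<lambda>d. (fscale c (ten f0 w0) + F) (g, d)) = (\<Sum>i<Suc n. fscale (?f i g) (?w i))" for g
  proof -
    have "(\<Sum>i<Suc n. fscale (?f i g) (?w i)) = (\<lambda>c. F (g, c)) + fscale (c * f0 g) w0"
      using *(2) by simp
    then show ?thesis by (auto simp: fun_eq_iff fscale_def)
  qed
  ultimately show ?case by blast
qed

lemma Om_sum_formI:
  fixes C :: "('i \<Rightarrow> 'k::field) set" and f :: "nat \<Rightarrow> 'k sl2 \<Rightarrow> 'k"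
  assumes C: "fun_space.subspace C" and "\<forall>i<n::nat. w i \<in> C \<and> f i \<in> CR"
    "\<And>g. (\<lambda>c. F (g, c)) = (\<Sum>i<n. fscale (f i g) (w i))"
  shows "F \<in> Om C"
proof -
  have "F = (\<Sum>i<n. ten (f i) (w i))"
  proof (rule ext, clarify)
    fix g c
    show "F (g, c) = (\<Sum>i<n. ten (f i) (w i)) (g, c)"
      using fun_cong[OF assms(3), of g c] by (simp add: sum_fun_apply fscale_def)
  qed
  also have "\<dots> \<in> Om C"
    using assms(2) by (intro fun_space.subspace_sum[OF Om_sub] Om_ten) auto
  finally show ?thesis .
qed

lemma Om_lo:
  assumes "K \<in> Om C" and C: "fun_space.subspace C"
  shows "\<exists>N w. (\<forall>n. w n \<in> C) \<and> (\<forall>n\<ge>N. w n = 0) \<and> (\<forall>t. (\<lambda>c. K (lo t, c)) = (\<Sum>n<N. fscale (t ^ n) (w n)))"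
  using assms(1)
proof (induction rule: Om_induct)
  case zero
  show ?case
    by (rule exI[of _ 0], rule exI[of _ "\<lambda>_. 0"]) (simp add: zero_fun_def fun_space.subspace_0[OF C, unfolded zero_fun_def])
next
  case (step c f u K)
  obtain N w where w: "\<forall>n. w n \<in> C" "\<forall>n\<ge>N. w n = 0" "\<forall>t. (\<lambda>c. K (lo t, c)) = (\<Sum>n<N. fscale (t ^ n) (w n))"
    using step.IH by blast
  obtain P where P: "\<And>t. f (lo t) = poly P t" using CR_lo[OF step.hyps(1), of 1 1] by auto
  let ?w = "\<lambda>n. fscale (c * coeff P n) u + w n" and ?N = "max N (Suc (degree P))"
  have "(\<lambda>d. (fscale c (ten f u) + K) (lo t, d)) = (\<Sum>n<?N. fscale (t ^ n) (?w n))" for t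
  proof -
    have "(\<Sum>n<?N. fscale (t ^ n) (?w n)) =
        (\<Sum>n<?N. fscale (t ^ n) (fscale (c * coeff P n) u)) + (\<Sum>n<?N. fscale (t ^ n) (w n))"
      by (simp only: fun_space.scale_right_distrib sum.distrib)
    also have "(\<Sum>n<?N. fscale (t ^ n) (w n)) = (\<lambda>c. K (lo t, c))"
      using sum_fscale_extend[of N w ?N "\<lambda>n. t ^ n"] w(2,3) by simp
    also have "(\<Sum>n<?N. fscale (t ^ n) (fscale (c * coeff P n) u)) = fscale (c * poly P t) u"
    proof -
      have "poly P t = (\<Sum>n<?N. coeff P n * t ^ n)"
        unfolding poly_altdef by (intro sum.mono_neutral_left) (auto simp: coeff_eq_0)
      then show ?thesis
        by (simp add: fun_space.scale_sum_left[symmetric] sum_distrib_left mult_ac)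
    qed
    finally show ?thesis by (auto simp: fun_eq_iff fscale_def P)
  qed
  moreover have "\<forall>n. ?w n \<in> C"
    using w(1) step.hyps(2) by (auto intro: fun_space.subspace_add[OF C] fun_space.subspace_scale[OF C])
  moreover have "\<forall>n\<ge>?N. ?w n = 0" using w(2) by (auto simp: coeff_eq_0)
  ultimately show ?case by (intro exI[of _ ?N] exI[of _ ?w] conjI) blast+
qed

lemma Om_tor:
  assumes "K \<in> Om C" and C: "fun_space.subspace C"
  shows "\<exists>A a. finite A \<and> (\<forall>i\<in>A. a i \<in> C) \<and>
    (\<forall>s. s \<noteq> 0 \<longrightarrow> (\<lambda>c. K (tor s, c)) = (\<Sum>i\<in>A. fscale (s powi i) (a i)))"
  using assms(1)
proof (induction rule: Om_induct)
  case zero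
  show ?case
    by (rule exI[of _ "{}"], rule exI[of _ "\<lambda>_. 0"]) (simp add: zero_fun_def)
next
  case (step c f u K)
  obtain A a where a: "finite A \<and> (\<forall>i\<in>A. a i \<in> C) \<and>
      (\<forall>s. s \<noteq> 0 \<longrightarrow> (\<lambda>c. K (tor s, c)) = (\<Sum>i\<in>A. fscale (s powi i) (a i)))"
    using step.IH by (elim exE)
  obtain N P where P: "\<And>s. s \<noteq> 0 \<Longrightarrow> s ^ N * f (tor s) = poly P s" using CR_tor[OF step.hyps(1)] by blast
  define B where "B = (\<lambda>n. int n - int N) ` {..degree P}"
  have finB: "finite B" by (simp add: B_def)
  define b where "b i = fscale (c * coeff P (nat (i + int N))) u" for i
  let ?a = "\<lambda>i. (if i \<in> A then a i else 0) + (if i \<in> B then b i else 0)"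
  have "(\<lambda>d. (fscale c (ten f u) + K) (tor s, d)) = (\<Sum>i\<in>A \<union> B. fscale (s powi i) (?a i))" if s: "s \<noteq> 0" for s
  proof -
    have 1: "(\<Sum>i\<in>A \<union> B. fscale (s powi i) (if i \<in> A then a i else 0)) = (\<lambda>c. K (tor s, c))"
      using a s finB sum.mono_neutral_cong_right[of "A \<union> B" A "\<lambda>i. fscale (s powi i) (if i \<in> A then a i else 0)"
          "\<lambda>i. fscale (s powi i) (a i)"] by auto
    have "(\<Sum>i\<in>A \<union> B. fscale (s powi i) (if i \<in> B then b i else 0)) = (\<Sum>i\<in>B. fscale (s powi i) (b i))"
      using a finB by (intro sum.mono_neutral_cong_right) auto
    also have "\<dots> = (\<Sum>n\<le>degree P. fscale (s powi (int n - int N)) (fscale (c * coeff P n) u))"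
      unfolding B_def by (subst sum.reindex) (auto simp: inj_on_def b_def)
    also have "\<dots> = fscale (\<Sum>n\<le>degree P. s powi (int n - int N) * (c * coeff P n)) u"
      by (simp add: fun_space.scale_sum_left)
    also have "(\<Sum>n\<le>degree P. s powi (int n - int N) * (c * coeff P n)) = c * (poly P s / s ^ N)"
      using s by (simp add: poly_altdef power_int_diff sum_distrib_left sum_divide_distrib mult_ac)
    also have "poly P s / s ^ N = f (tor s)" using P[OF s] s by (simp add: field_simps)
    finally have 2: "(\<Sum>i\<in>A \<union> B. fscale (s powi i) (if i \<in> B then b i else 0)) = fscale (c * f (tor s)) u" .
    show ?thesis
      unfolding fun_space.scale_right_distrib sum.distrib 1 2 by (auto simp: fun_eq_iff fscale_def)
  qed
  moreover have "\<forall>i\<in>A \<union> B. ?a i \<in> C"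
    using a step.hyps(2) unfolding b_def
    by (auto intro!: fun_space.subspace_add[OF C] fun_space.subspace_scale[OF C] fun_space.subspace_0[OF C])
  moreover have "finite (A \<union> B)" using a finB by simp
  ultimately show ?case by (intro exI[of _ "A \<union> B"] exI[of _ ?a] conjI) blast+
qed

lemma Om_bmodule:
  fixes C :: "('i \<Rightarrow> 'k::alg_closed_field) set"
  shows "bmodule (Om C) (\<lambda>t. RT (lo t)) (\<lambda>s. RT (tor s))"
proof (rule bmodule_RT[OF Om_sub])
  fix F assume F: "F \<in> Om C"
  let ?K = "\<lambda>(h, x). F (fst x * h, snd x)"
  have eq: "RT h F = (\<lambda>x. ?K (h, x))" for h by (auto simp: fun_eq_iff)
  show "\<exists>N w. (\<forall>n. w n \<in> Om C) \<and> (\<forall>n\<ge>N. w n = 0) \<and> (\<forall>t. RT (lo t) F = (\<Sum>n<N. fscale (t ^ n) (w n)))"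
    unfolding eq by (rule Om_lo[OF Om_comult[OF F] Om_sub])
  show "\<exists>A a. finite A \<and> (\<forall>i\<in>A. a i \<in> Om C) \<and>
      (\<forall>s. s \<noteq> 0 \<longrightarrow> RT (tor s) F = (\<Sum>i\<in>A. fscale (s powi i) (a i)))"
    unfolding eq by (rule Om_tor[OF Om_comult[OF F] Om_sub])
qed

text \<open>The open cell is dense: through a point with d = 0 runs the curve g upp(t), on which d
  equals c t with c nonzero.\<close>

lemma CR_zero_dense:
  fixes f :: "'k::alg_closed_field sl2 \<Rightarrow> 'k"
  assumes f: "f \<in> CR" and z: "\<And>g. ent 2 2 g \<noteq> 0 \<Longrightarrow> f g = 0"
  shows "f g = 0"
proof (cases "ent 2 2 g = 0")
  case True
  then have c: "ent 2 1 g \<noteq> 0" using ent_det[of g] by auto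
  obtain P where P: "\<And>t. f (g * upp t * 1) = poly P t" using CR_upp[OF f] by blast
  have "poly P t = 0" if "t \<noteq> 0" for t
    using P[of t] z[of "g * upp t"] c that True by (simp add: ent_mult)
  then have "UNIV - {0} \<subseteq> {t. poly P t = 0}" by auto
  then have "P = 0"
    using poly_roots_finite[of P] infinite_UNIV_alg_closed[where 'k = 'k]
    by (metis finite_Diff_insert finite_subset finite.emptyI Diff_empty)
  moreover have "upp 0 = (1 :: 'k sl2)" by (rule sl2_eqI) (simp_all add: ent_one)
  ultimately show ?thesis using P[of 0] by simp
qed (use z in simp)

lemma Om_coord:
  fixes C :: "('i \<Rightarrow> 'k::field) set"
  assumes "F \<in> Om C"
  shows "(\<lambda>g. F (g, c)) \<in> CR"
proof (rule Om_map[OF assms _ CR_sub])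
  show "lin_on UNIV (\<lambda>F g. F (g, c))"
    by (auto simp: lin_on_def fscale_def fun_eq_iff)
  fix f :: "'k sl2 \<Rightarrow> 'k" and w assume "f \<in> CR"
  then show "(\<lambda>g. ten f w (g, c)) \<in> CR"
    using CR_scale[of f "w c"] by (simp add: mult.commute)
qed

lemma Om_eval:
  fixes C :: "('i \<Rightarrow> 'k::field) set"
  assumes "F \<in> Om C" and C: "fun_space.subspace C"
  shows "(\<lambda>c. F (g, c)) \<in> C"
proof (rule Om_map[OF assms(1) _ C])
  show "lin_on UNIV (\<lambda>F c. F (g, c))"
    by (auto simp: lin_on_def fscale_def fun_eq_iff)
  fix f :: "'k sl2 \<Rightarrow> 'k" and w assume "w \<in> C"
  then show "(\<lambda>c. ten f w (g, c)) \<in> C"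
    using fun_space.subspace_scale[OF C, of w "f g"] by (simp add: fscale_def)
qed

lemma Om_comult_left:
  fixes C :: "('i \<Rightarrow> 'k::field) set"
  assumes "F \<in> Om C"
  shows "(\<lambda>(h, x). F (h * fst x, snd x)) \<in> Om (Om C)"
proof (rule Om_map[OF assms _ Om_sub])
  show "lin_on UNIV (\<lambda>F (h, x). F (h * fst x, snd x))"
    by (auto simp: lin_on_def fscale_def fun_eq_iff)
  fix f :: "'k sl2 \<Rightarrow> 'k" and w assume fw: "f \<in> CR" "w \<in> C"
  have "(\<lambda>(h, x). ten f w (h * fst x, snd x)) = (\<lambda>K (h, x). K (fst x, h) * w (snd x)) (\<lambda>(h, g). f (g * h))"
    by (auto simp: fun_eq_iff)
  also have "\<dots> \<in> Om (Om C)"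
  proof (rule Om_map[OF CR_comult[OF fw(1)] _ Om_sub])
    show "lin_on UNIV (\<lambda>K (h, x). K (fst x, h) * w (snd x))"
      by (auto simp: lin_on_def fscale_def fun_eq_iff algebra_simps)
    fix a b :: "'k sl2 \<Rightarrow> 'k" assume "a \<in> CR" "b \<in> CR"
    moreover have "(\<lambda>(h, x). ten a b (fst x, h) * w (snd x)) = ten b (ten a w)"
      by (auto simp: fun_eq_iff)
    ultimately show "(\<lambda>(h, x). ten a b (fst x, h) * w (snd x)) \<in> Om (Om C)"
      using fw(2) by (simp add: Om_ten)
  qed
  finally show "(\<lambda>(h, x). ten f w (h * fst x, snd x)) \<in> Om (Om C)" .
qed

text \<open>Left translation by lo(t) changes d into d + t b, so t = -d/b moves g to the locus d =
  0. Expanding the vanishing value in t yields b^M F as a multiple of d; as b c = -1 modulo d,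
  multiplication by c^M removes the factor b^M.\<close>

lemma Om_dvd_d:
  fixes C :: "('i \<Rightarrow> 'k::field) set"
  assumes F: "F \<in> Om C" and z: "\<And>g c. ent 2 2 g = 0 \<Longrightarrow> F (g, c) = 0"
  shows "\<exists>G\<in>Om C. F = mul (ent 2 2) G"
proof -
  let ?a = "ent 1 1" and ?b = "ent 1 2" and ?c = "ent 2 1" and ?d = "ent 2 2"
  let ?K = "\<lambda>(h, x). F (h * fst x, snd x)"
  obtain N w where w: "\<forall>n. w n \<in> Om C" "\<forall>n\<ge>N. w n = 0"
    "\<forall>t. (\<lambda>x. ?K (lo t, x)) = (\<Sum>n<N. fscale (t ^ n) (w n))"
    using Om_lo[OF Om_comult_left[OF F] Om_sub] by blast
  \<comment> \<open>\<open>Suc N\<close> terms always include the constant one, which is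
    \<open>F\<close>.\<close>
  define M where "M = Suc N"
  have left: "F (lo t * g, c) = (\<Sum>n<M. t ^ n * w n (g, c))" for t g c
    using fun_cong[OF w(3)[rule_format, of t], of "(g, c)"] w(2) by (simp add: sum_fun_apply fscale_def M_def)
  have w0: "w 0 (g, c) = F (g, c)" for g c
  proof -
    have "F (g, c) = (\<Sum>n<M. 0 ^ n * w n (g, c))" using left[of 0 g c] by simp
    also have "\<dots> = (\<Sum>n\<in>{0}. 0 ^ n * w n (g, c))"
      by (rule sum.mono_neutral_right) (auto simp: M_def)
    finally show ?thesis by simp
  qed
  define G1 where "G1 = (\<Sum>n<N. mul (\<lambda>g. (-1) ^ n * (?d g ^ n * ?b g ^ (N - n))) (w (Suc n)))"
  have "G1 \<in> Om C"
    unfolding G1_def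
    by (intro fun_space.subspace_sum[OF Om_sub] Om_mul w(1)[rule_format] CR_scale coordinate_ring.mult CR_power CR_ent)
  \<comment> \<open>The factor b^M clears the denominators of t = -d/b. At b = 0 both sides vanish,
    because every summand of \<open>G1\<close> keeps a positive power of b.\<close>
  have bF: "?b g ^ M * F (g, c) = ?d g * G1 (g, c)" for g c
  proof (cases "?b g = 0")
    case True
    then have "?d g * G1 (g, c) = (\<Sum>n<N. ?d g * ((-1) ^ n * (?d g ^ n * 0 ^ (N - n)) * w (Suc n) (g, c)))"
      by (simp add: G1_def sum_fun_apply sum_distrib_left)
    also have "\<dots> = 0" by (intro sum.neutral) auto
    finally show ?thesis using True by (simp add: M_def)
  next
    case False
    let ?t = "- (?d g / ?b g)"
    have "?d (lo ?t * g) = 0" using False by (simp add: ent_mult)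
    then have "0 = (\<Sum>n<M. ?t ^ n * w n (g, c))"
      using z left by metis
    also have "\<dots> = F (g, c) + (\<Sum>n<N. ?t ^ Suc n * w (Suc n) (g, c))"
      unfolding M_def sum.lessThan_Suc_shift w0 by simp
    finally have "F (g, c) = - (\<Sum>n<N. ?t ^ Suc n * w (Suc n) (g, c))"
      unfolding eq_neg_iff_add_eq_0 by (rule sym)
    then have "?b g ^ M * F (g, c) = - (\<Sum>n<N. ?b g ^ M * (?t ^ Suc n * w (Suc n) (g, c)))"
      by (simp only: sum_distrib_left[symmetric] mult_minus_right)
    also have "\<dots> = (\<Sum>n<N. ?d g * ((-1) ^ n * (?d g ^ n * ?b g ^ (N - n)) * w (Suc n) (g, c)))"
      unfolding sum_negf[symmetric]
    proof (rule sum.cong[OF refl])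
      fix n assume "n \<in> {..<N}"
      then have "?b g ^ M = ?b g ^ (N - n) * ?b g ^ Suc n"
        by (simp add: M_def power_add[symmetric])
      moreover have "?t ^ Suc n = (-1) ^ Suc n * ?d g ^ Suc n / ?b g ^ Suc n"
        by (metis power_divide power_minus times_divide_eq_right)
      ultimately have "?b g ^ M * ?t ^ Suc n = - (?d g * ((-1) ^ n * (?d g ^ n * ?b g ^ (N - n))))"
        using False by simp
      then show "- (?b g ^ M * (?t ^ Suc n * w (Suc n) (g, c))) =
          ?d g * ((-1) ^ n * (?d g ^ n * ?b g ^ (N - n)) * w (Suc n) (g, c))"
        by (metis (no_types, lifting) minus_minus mult.assoc mult_minus_left)
    qed
    also have "\<dots> = ?d g * G1 (g, c)"
      by (simp add: G1_def sum_fun_apply sum_distrib_left)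
    finally show ?thesis .
  qed
  \<comment> \<open>Powers of b c = a d - 1, modulo d.\<close>
  have "\<exists>r\<in>CR. \<forall>g::'k sl2. (?b g * ?c g) ^ n = (-1) ^ n + ?d g * r g" for n
  proof (induction n)
    case 0
    show ?case by (rule bexI[OF _ coordinate_ring.const[of 0]]) simp
  next
    case (Suc n)
    then obtain r where r: "r \<in> CR" "\<And>g::'k sl2. (?b g * ?c g) ^ n = (-1) ^ n + ?d g * r g" by blast
    have bc: "?b g * ?c g = ?a g * ?d g - 1" for g :: "'k sl2" using ent_det[of g] by (simp add: algebra_simps)
    have "(?b g * ?c g) ^ Suc n = (-1) ^ Suc n + ?d g * (?a g * (-1) ^ n + (?a g * ?d g - 1) * r g)" for g :: "'k sl2"
      unfolding power_Suc r(2) unfolding bc by (simp add: algebra_simps)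
    moreover have "(\<lambda>g. ?a g * (-1) ^ n + (?a g * ?d g - 1) * r g) \<in> CR"
      by (intro coordinate_ring.add coordinate_ring.mult CR_diff coordinate_ring.const CR_ent r(1))
    ultimately show ?case by (intro bexI[where x = "\<lambda>g. ?a g * (-1) ^ n + (?a g * ?d g - 1) * r g"] allI)
  qed
  then obtain r where r: "r \<in> CR" "\<And>g::'k sl2. (?b g * ?c g) ^ M = (-1) ^ M + ?d g * r g" by blast
  define G where "G = fscale ((-1) ^ M) (mul (\<lambda>g. ?c g ^ M) G1 - mul r F)"
  have "G \<in> Om C"
    unfolding G_def
    by (intro fun_space.subspace_scale[OF Om_sub] fun_space.subspace_diff[OF Om_sub] Om_mul \<open>G1 \<in> Om C\<close> F CR_power CR_ent r(1))
  moreover have "F (g, c) = mul ?d G (g, c)" for g c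
  proof -
    have "((-1) ^ M + ?d g * r g) * F (g, c) = ?c g ^ M * (?d g * G1 (g, c))"
      unfolding r(2)[symmetric] bF[symmetric] by (simp add: power_mult_distrib)
    then have "(-1) ^ M * F (g, c) = ?d g * (?c g ^ M * G1 (g, c) - r g * F (g, c))"
      by (simp add: algebra_simps)
    then have "(-1) ^ M * ((-1) ^ M * F (g, c)) = mul ?d G (g, c)"
      by (simp add: G_def fscale_def mult.left_commute)
    then show ?thesis by (simp add: mult.assoc[symmetric] power_add[symmetric] mult_2[symmetric])
  qed
  ultimately show ?thesis by (intro bexI[of _ G]) auto
qed

section \<open>The open cell and its complement\<close>

abbreviation "rtU \<equiv> \<lambda>t. RT (lo t)"
abbreviation "rtH \<equiv> \<lambda>s. RT (tor s)"

text \<open>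
  The localisation of \<open>C \<otimes> k[G]\<close> at the matrix entry \<open>d\<close>, and its restriction to the locus \<open>d = 0\<close>. Functions on
  the open cell are extended by zero, which \<open>inverse 0 = 0\<close> together with the positive exponent achieves.
\<close>

definition Omd :: "('i \<Rightarrow> 'k::field) set \<Rightarrow> ('k sl2 \<times> 'i \<Rightarrow> 'k) set" where
  "Omd C = {mul (\<lambda>g. inverse (ent 2 2 g) ^ Suc N) F | N F. F \<in> Om C}"

definition ind0 :: "'k::field sl2 \<Rightarrow> 'k" where
  "ind0 g = (if ent 2 2 g = 0 then 1 else 0)"

definition Om0 :: "('i \<Rightarrow> 'k::field) set \<Rightarrow> ('k sl2 \<times> 'i \<Rightarrow> 'k) set" where
  "Om0 C = mul ind0 ` Om C"

lemma RT_mul: "RT h (mul f F) = mul (\<lambda>g. f (g * h)) (RT h F)"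
  by (auto simp: fun_eq_iff)

lemma ent_d_lo: "ent 2 2 (g * lo t) = ent 2 2 g"
  by (simp add: ent_mult)

lemma ent_b_lo: "ent 1 2 (g * lo t) = ent 1 2 g"
  by (simp add: ent_mult)

lemma ent_d_tor: "s \<noteq> 0 \<Longrightarrow> ent 2 2 (g * tor s) = ent 2 2 g / s"
  by (simp add: ent_mult divide_inverse)

lemma ent_b_tor: "s \<noteq> 0 \<Longrightarrow> ent 1 2 (g * tor s) = ent 1 2 g / s"
  by (simp add: ent_mult divide_inverse)

lemma mul_sum: "mul f (\<Sum>a\<in>A. fscale (c a) (F a)) = (\<Sum>a\<in>A. fscale (c a) (mul f (F a)))"
  by (rule lin_on_sum_scale[OF fun_space.subspace_UNIV lin_on_mul]) simp

lemma Omd_raise: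
  assumes "F \<in> Om C"
  shows "\<exists>F'\<in>Om C. mul (\<lambda>g. inverse (ent 2 2 g) ^ Suc N) F = mul (\<lambda>g. inverse (ent 2 2 g) ^ Suc (N + k)) F'"
proof (rule bexI[where x = "mul (\<lambda>g. ent 2 2 g ^ k) F"])
  show "mul (\<lambda>g. ent 2 2 g ^ k) F \<in> Om C" by (intro Om_mul assms CR_power CR_ent)
  have "inverse x ^ Suc N = inverse x ^ Suc (N + k) * x ^ k" for x :: 'a
  proof (cases "x = 0")
    case False
    then have "inverse x ^ k * x ^ k = 1" by (simp add: power_mult_distrib[symmetric])
    then show ?thesis by (simp add: power_add mult.assoc)
  qed simp
  then show "mul (\<lambda>g. inverse (ent 2 2 g) ^ Suc N) F =
      mul (\<lambda>g. inverse (ent 2 2 g) ^ Suc (N + k)) (mul (\<lambda>g. ent 2 2 g ^ k) F)"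
    unfolding mul_mul by metis
qed

lemma Omd_sub: "fun_space.subspace (Omd C)"
  unfolding fun_space.subspace_def
proof (intro conjI ballI allI)
  let ?i = "\<lambda>N g. inverse (ent 2 2 g) ^ Suc N"
  have "0 = mul (?i 0) 0" by (auto simp: fun_eq_iff)
  then show "0 \<in> Omd C" unfolding Omd_def using fun_space.subspace_0[OF Om_sub] by blast
next
  let ?i = "\<lambda>N g. inverse (ent 2 2 g) ^ Suc N"
  fix F G assume "F \<in> Omd C" "G \<in> Omd C"
  then obtain N F1 M G1 where F: "F = mul (?i N) F1" "F1 \<in> Om C" and G: "G = mul (?i M) G1" "G1 \<in> Om C"
    unfolding Omd_def by blast
  obtain F2 where F2: "F2 \<in> Om C" "F = mul (?i (N + M)) F2" using Omd_raise[OF F(2), of N M] F(1) by blast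
  obtain G2 where G2: "G2 \<in> Om C" "G = mul (?i (M + N)) G2" using Omd_raise[OF G(2), of M N] G(1) by blast
  have "F + G = mul (?i (N + M)) (F2 + G2)"
    unfolding F2(2) G2(2) by (auto simp: fun_eq_iff algebra_simps)
  then show "F + G \<in> Omd C"
    unfolding Omd_def using fun_space.subspace_add[OF Om_sub F2(1) G2(1)] by blast
next
  fix c F assume "F \<in> Omd C"
  then obtain N F1 where F: "F = mul (\<lambda>g. inverse (ent 2 2 g) ^ Suc N) F1" "F1 \<in> Om C"
    unfolding Omd_def by blast
  show "fscale c F \<in> Omd C"
    unfolding Omd_def F(1) mul_fscale[symmetric] using fun_space.subspace_scale[OF Om_sub F(2)] by blast
qed

lemma Om0_sub: "fun_space.subspace (Om0 C)"
  unfolding fun_space.subspace_def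
proof (intro conjI ballI allI)
  have "0 = mul ind0 0" by (auto simp: fun_eq_iff)
  then show "0 \<in> Om0 C" unfolding Om0_def using fun_space.subspace_0[OF Om_sub] by blast
next
  fix F G assume "F \<in> Om0 C" "G \<in> Om0 C"
  then obtain F1 G1 where "F = mul ind0 F1" "F1 \<in> Om C" "G = mul ind0 G1" "G1 \<in> Om C"
    unfolding Om0_def by blast
  moreover have "mul ind0 F1 + mul ind0 G1 = mul ind0 (F1 + G1)"
    by (auto simp: fun_eq_iff algebra_simps)
  ultimately show "F + G \<in> Om0 C"
    unfolding Om0_def using fun_space.subspace_add[OF Om_sub] by blast
next
  fix c F assume "F \<in> Om0 C"
  then obtain F1 where F: "F = mul ind0 F1" "F1 \<in> Om C"
    unfolding Om0_def by blast
  show "fscale c F \<in> Om0 C"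
    unfolding Om0_def F(1) mul_fscale[symmetric] using fun_space.subspace_scale[OF Om_sub F(2)] by blast
qed

lemma mul_lo_poly:
  fixes C :: "('i \<Rightarrow> 'k::alg_closed_field) set"
  assumes F: "F \<in> Om C" and f: "\<And>g t. f (g * lo t) = f g" and C': "\<And>F. F \<in> Om C \<Longrightarrow> mul f F \<in> C'"
  shows "\<exists>N w. (\<forall>n. w n \<in> C') \<and> (\<forall>n\<ge>N. w n = 0) \<and> (\<forall>t. RT (lo t) (mul f F) = (\<Sum>n<N. fscale (t ^ n) (w n)))"
proof -
  interpret bmodule "Om C" rtU rtH by (rule Om_bmodule)
  obtain N w where w: "\<forall>n. w n \<in> Om C" "\<forall>n\<ge>N. w n = 0" "\<forall>t. RT (lo t) F = (\<Sum>n<N. fscale (t ^ n) (w n))"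
    using U_poly[OF F] by blast
  have "mul f 0 = 0" by (auto simp: fun_eq_iff)
  then have "\<forall>n\<ge>N. mul f (w n) = 0" using w(2) by metis
  moreover have "RT (lo t) (mul f F) = (\<Sum>n<N. fscale (t ^ n) (mul f (w n)))" for t
    unfolding RT_mul f w(3)[rule_format] by (rule mul_sum)
  ultimately show ?thesis
    using w(1) C' by (intro exI[of _ N] exI[of _ "\<lambda>n. mul f (w n)"] conjI) blast+
qed

lemma mul_tor_laurent:
  fixes C :: "('i \<Rightarrow> 'k::alg_closed_field) set"
  assumes F: "F \<in> Om C" and f: "\<And>g s. s \<noteq> 0 \<Longrightarrow> f (g * tor s) = s powi k * f g"
    and C': "\<And>F. F \<in> Om C \<Longrightarrow> mul f F \<in> C'"
  shows "\<exists>A a. finite A \<and> (\<forall>i\<in>A. a i \<in> C') \<and>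
      (\<forall>s. s \<noteq> 0 \<longrightarrow> RT (tor s) (mul f F) = (\<Sum>i\<in>A. fscale (s powi i) (a i)))"
proof -
  interpret bmodule "Om C" rtU rtH by (rule Om_bmodule)
  obtain A a where a: "finite A \<and> (\<forall>i\<in>A. a i \<in> Om C) \<and>
      (\<forall>s. s \<noteq> 0 \<longrightarrow> RT (tor s) F = (\<Sum>i\<in>A. fscale (s powi i) (a i)))"
    using H_poly[OF F] by (elim exE)
  let ?A = "(\<lambda>i. i + k) ` A" and ?a = "\<lambda>i. mul f (a (i - k))"
  have "RT (tor s) (mul f F) = (\<Sum>i\<in>?A. fscale (s powi i) (?a i))" if s: "s \<noteq> 0" for s
  proof -
    have "RT (tor s) (mul f F) = fscale (s powi k) (mul f (RT (tor s) F))"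
      unfolding RT_mul f[OF s] by (auto simp: fun_eq_iff fscale_def)
    also have "mul f (RT (tor s) F) = (\<Sum>i\<in>A. fscale (s powi i) (mul f (a i)))"
      using a s mul_sum[of f "\<lambda>i. s powi i" a A] by simp
    also have "fscale (s powi k) \<dots> = (\<Sum>i\<in>A. fscale (s powi (i + k)) (mul f (a i)))"
      unfolding fun_space.scale_sum_right using s by (simp add: power_int_add mult.commute)
    also have "\<dots> = (\<Sum>i\<in>?A. fscale (s powi i) (?a i))"
      by (subst sum.reindex) (auto simp: inj_on_def)
    finally show ?thesis .
  qed
  moreover have "finite ?A" "\<forall>i\<in>?A. ?a i \<in> C'" using a C' by auto
  ultimately show ?thesis by (intro exI[of _ ?A] exI[of _ ?a] conjI) blast+
qed

lemma ind0_lo: "ind0 (g * lo t) = ind0 g"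
  by (simp add: ind0_def ent_d_lo)

lemma ind0_tor: "s \<noteq> 0 \<Longrightarrow> ind0 (g * tor s) = ind0 g"
  by (simp add: ind0_def ent_d_tor)

lemma Omd_bmodule: "bmodule (Omd C) rtU rtH"
proof (rule bmodule_RT[OF Omd_sub])
  fix F assume "F \<in> Omd C"
  then obtain N F1 where F: "F = mul (\<lambda>g. inverse (ent 2 2 g) ^ Suc N) F1" "F1 \<in> Om C"
    unfolding Omd_def by blast
  have C': "mul (\<lambda>g. inverse (ent 2 2 g) ^ Suc N) F \<in> Omd C" if "F \<in> Om C" for F
    using that unfolding Omd_def by blast
  show "\<exists>N w. (\<forall>n. w n \<in> Omd C) \<and> (\<forall>n\<ge>N. w n = 0) \<and> (\<forall>t. RT (lo t) F = (\<Sum>n<N. fscale (t ^ n) (w n)))"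
    unfolding F(1) by (rule mul_lo_poly[OF F(2) _ C']) (simp add: ent_d_lo)
  show "\<exists>A a. finite A \<and> (\<forall>i\<in>A. a i \<in> Omd C) \<and>
      (\<forall>s. s \<noteq> 0 \<longrightarrow> RT (tor s) F = (\<Sum>i\<in>A. fscale (s powi i) (a i)))"
    unfolding F(1)
  proof (rule mul_tor_laurent[OF F(2) _ C'])
    show "inverse (ent 2 2 (g * tor s)) ^ Suc N = s powi int (Suc N) * inverse (ent 2 2 g) ^ Suc N"
      if "s \<noteq> 0" for g s
      using that by (simp add: ent_d_tor power_mult_distrib power_divide divide_inverse del: power_Suc of_nat_Suc)
  qed
qed

lemma Om0_bmodule: "bmodule (Om0 C) rtU rtH"
proof (rule bmodule_RT[OF Om0_sub])
  fix F assume "F \<in> Om0 C"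
  then obtain F1 where F: "F = mul ind0 F1" "F1 \<in> Om C"
    unfolding Om0_def by blast
  have C': "mul ind0 F \<in> Om0 C" if "F \<in> Om C" for F
    using that unfolding Om0_def by blast
  show "\<exists>N w. (\<forall>n. w n \<in> Om0 C) \<and> (\<forall>n\<ge>N. w n = 0) \<and> (\<forall>t. RT (lo t) F = (\<Sum>n<N. fscale (t ^ n) (w n)))"
    unfolding F(1) by (rule mul_lo_poly[OF F(2) ind0_lo C'])
  show "\<exists>A a. finite A \<and> (\<forall>i\<in>A. a i \<in> Om0 C) \<and>
      (\<forall>s. s \<noteq> 0 \<longrightarrow> RT (tor s) F = (\<Sum>i\<in>A. fscale (s powi i) (a i)))"
    unfolding F(1) by (rule mul_tor_laurent[OF F(2) _ C', where k = 0]) (simp add: ind0_tor)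
qed

context
  fixes C :: "('i \<Rightarrow> 'k::alg_closed_field) set" and p :: nat
  assumes C: "fun_space.subspace C" and p: "prime p" "CHAR('k) = p" "odd p"
begin

text \<open>Right translation by lo(t) replaces c by c + d t and fixes d, so c/d is a trivialising
  coordinate where d is invertible.\<close>

lemma Omd_ycoord: "ycoord (Omd C) {g. ent 2 2 g \<noteq> 0} (\<lambda>g. ent 2 1 g / ent 2 2 g) p"
proof -
  interpret bmodule "Omd C" rtU rtH by (rule Omd_bmodule)
  show ?thesis
  proof
    fix F assume "F \<in> Omd C"
    then obtain N F1 where F: "F = mul (\<lambda>g. inverse (ent 2 2 g) ^ Suc N) F1" "F1 \<in> Om C"
      unfolding Omd_def by blast
    show "F (g, c) = 0" if "g \<notin> {g. ent 2 2 g \<noteq> 0}" for g c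
      using that by (simp add: F(1))
    have "mul (\<lambda>g. ent 2 1 g / ent 2 2 g) F = mul (\<lambda>g. inverse (ent 2 2 g) ^ Suc (Suc N)) (mul (ent 2 1) F1)"
      by (auto simp: fun_eq_iff F(1) divide_inverse)
    then show "mul (\<lambda>g. ent 2 1 g / ent 2 2 g) F \<in> Omd C"
      unfolding Omd_def using Om_mul[OF F(2) CR_ent] by blast
  qed (use p in \<open>auto simp: ent_mult field_simps power2_eq_square\<close>)
qed

text \<open>On d = 0 one has b c = -1; translation replaces a by a + b t and fixes c, so -a c grows
  by t.\<close>

lemma Om0_ycoord: "ycoord (Om0 C) {g. ent 2 2 g = 0} (\<lambda>g. - (ent 1 1 g * ent 2 1 g)) p"
proof -
  interpret bmodule "Om0 C" rtU rtH by (rule Om0_bmodule)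
  show ?thesis
  proof
    fix F assume "F \<in> Om0 C"
    then obtain F1 where F: "F = mul ind0 F1" "F1 \<in> Om C"
      unfolding Om0_def by blast
    show "F (g, c) = 0" if "g \<notin> {g. ent 2 2 g = 0}" for g c
      using that by (simp add: F(1) ind0_def)
    have "mul (\<lambda>g. - (ent 1 1 g * ent 2 1 g)) F = mul ind0 (mul (\<lambda>g. (-1) * (ent 1 1 g * ent 2 1 g)) F1)"
      by (auto simp: fun_eq_iff F(1))
    moreover have "mul (\<lambda>g. (-1) * (ent 1 1 g * ent 2 1 g)) F1 \<in> Om C"
      by (intro Om_mul F(2) CR_scale coordinate_ring.mult CR_ent)
    ultimately show "mul (\<lambda>g. - (ent 1 1 g * ent 2 1 g)) F \<in> Om0 C"
      unfolding Om0_def by blast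
  next
    fix g :: "'k sl2" and t assume "g \<in> {g. ent 2 2 g = 0}"
    then have d: "ent 2 2 g = 0" by simp
    then have "- (ent 1 2 g * ent 2 1 g) = 1" using ent_det[of g] by simp
    then have bc: "ent 1 2 g * ent 2 1 g = -1" by (metis minus_minus)
    have "(ent 1 1 g + ent 1 2 g * t) * ent 2 1 g = ent 1 1 g * ent 2 1 g - t"
      using bc by (simp add: algebra_simps)
    then show "- (ent 1 1 (g * lo t) * ent 2 1 (g * lo t)) = - (ent 1 1 g * ent 2 1 g) + t"
      using d by (simp add: ent_mult)
  qed (use p in \<open>auto simp: ent_mult power2_eq_square\<close>)
qed

lemma hom_d: "bmodule_hom (Om C) rtU rtH (Om C) rtU rtH (mul (ent 2 2)) 1"
proof -
  interpret bmodule "Om C" rtU rtH by (rule Om_bmodule)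
  show ?thesis
    by standard (auto simp: lin_on_mul RT_mul ent_d_lo ent_d_tor fscale_def fun_eq_iff intro: Om_mul CR_ent)
qed

lemma hom_res: "bmodule_hom (Om C) rtU rtH (Om0 C) rtU rtH (mul ind0) 0"
proof -
  interpret Y: bmodule "Om C" rtU rtH by (rule Om_bmodule)
  interpret Z: bmodule "Om0 C" rtU rtH by (rule Om0_bmodule)
  show ?thesis
    by standard (auto simp: lin_on_mul RT_mul ind0_lo ind0_tor Om0_def)
qed

text \<open>The multiplier is the indicator function of the open cell: the localisation map, in the
  realisation by extension with zero.\<close>

lemma hom_loc: "bmodule_hom (Om C) rtU rtH (Omd C) rtU rtH (mul (\<lambda>g. inverse (ent 2 2 g) * ent 2 2 g)) 0"
proof -
  interpret Y: bmodule "Om C" rtU rtH by (rule Om_bmodule)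
  interpret Z: bmodule "Omd C" rtU rtH by (rule Omd_bmodule)
  show ?thesis
  proof
    fix F assume "F \<in> Om C"
    then have "mul (ent 2 2) F \<in> Om C" by (intro Om_mul CR_ent)
    moreover have "mul (\<lambda>g. inverse (ent 2 2 g) * ent 2 2 g) F = mul (\<lambda>g. inverse (ent 2 2 g) ^ Suc 0) (mul (ent 2 2) F)"
      by (simp add: mul_mul)
    ultimately show "mul (\<lambda>g. inverse (ent 2 2 g) * ent 2 2 g) F \<in> Omd C"
      unfolding Omd_def by blast
  next
    fix F :: "'k sl2 \<times> 'i \<Rightarrow> 'k" and s :: 'k assume s: "s \<noteq> 0"
    have "inverse (x / s) * (x / s) = inverse x * x" for x using s by (cases "x = 0") auto
    then show "mul (\<lambda>g. inverse (ent 2 2 g) * ent 2 2 g) (RT (tor s) F) =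
        fscale (s ^ 0) (RT (tor s) (mul (\<lambda>g. inverse (ent 2 2 g) * ent 2 2 g) F))"
      using s by (simp add: RT_mul ent_d_tor)
  qed (auto simp: lin_on_mul RT_mul ent_d_lo)
qed

lemma hom_dpow: "bmodule_hom (Omd C) rtU rtH (Omd C) rtU rtH (mul (\<lambda>g. ent 2 2 g ^ n)) n"
proof -
  interpret bmodule "Omd C" rtU rtH by (rule Omd_bmodule)
  show ?thesis
  proof
    fix F assume "F \<in> Omd C"
    then obtain N F1 where F: "F = mul (\<lambda>g. inverse (ent 2 2 g) ^ Suc N) F1" "F1 \<in> Om C"
      unfolding Omd_def by blast
    have "mul (\<lambda>g. ent 2 2 g ^ n) F = mul (\<lambda>g. inverse (ent 2 2 g) ^ Suc N) (mul (\<lambda>g. ent 2 2 g ^ n) F1)"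
      by (auto simp: fun_eq_iff F(1))
    then show "mul (\<lambda>g. ent 2 2 g ^ n) F \<in> Omd C"
      unfolding Omd_def using Om_mul[OF F(2) CR_power[OF CR_ent]] by blast
  qed (auto simp: lin_on_mul RT_mul ent_d_lo ent_d_tor fscale_def fun_eq_iff power_divide)
qed

end

section \<open>Cochains of degree 0\<close>

abbreviation zero_cell :: "nat \<Rightarrow> nat" where
  "zero_cell \<equiv> (\<lambda>_. 0)"

lemma wt_zero_cell [simp]: "wt p zero_cell = 0"
  by (simp add: wt_def)

context xmodule
begin

lemma K_0_supp:
  assumes \<xi>: "\<xi> \<in> K 0 w" and ne: "e \<noteq> zero_cell"
  shows "\<xi> e = 0"
proof (rule ccontr)
  assume nz: "\<xi> e \<noteq> 0"
  have "finite {i. e i \<noteq> 0}" by (rule K_supp[OF \<xi>, OF nz])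
  moreover have "deg e = 0" by (rule K_deg[OF \<xi>, OF nz])
  ultimately have "e i = 0" for i unfolding deg_def by simp
  then show False using ne by auto
qed

lemma K_0_cocycle:
  assumes \<xi>: "\<xi> \<in> K 0 w" "\<delta> \<xi> = 0"
  shows "X i (\<xi> zero_cell) = 0"
proof -
  let ?e = "up zero_cell i"
  have "\<delta> \<xi> ?e = fscale (sg ?e i) (Dop p X i (?e i) (\<xi> (dn ?e i)))"
  proof (rule dl_up[OF \<xi>(1)])
    show "finite {j. ?e j \<noteq> 0}"
      by (rule finite_subset[of _ "{i}"]) (auto simp: up_def)
  qed (auto simp: up_def)
  then have "fscale (sg ?e i) (Dop p X i (?e i) (\<xi> (dn ?e i))) = 0"
    unfolding \<xi>(2) zero_fun_apply by (rule sym)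
  then have "fscale (sg ?e i * sg ?e i) (Dop p X i (?e i) (\<xi> zero_cell)) = 0"
    unfolding dn_up by (metis fun_space.scale_scale fun_space.scale_zero_right)
  then show ?thesis by (simp add: Dop_def up_def)
qed

lemma K_0_W: "\<xi> \<in> K 0 w \<Longrightarrow> \<xi> zero_cell \<in> W w"
  using K_W[of \<xi> 0 w zero_cell] by simp

definition cochain0 :: "('i \<Rightarrow> 'k) \<Rightarrow> (nat \<Rightarrow> nat) \<Rightarrow> ('i \<Rightarrow> 'k)" where
  "cochain0 v e = (if e = zero_cell then v else 0)"

lemma cochain0_K:
  assumes "v \<in> W w"
  shows "cochain0 v \<in> K 0 w"
proof -
  have "finite {e. cochain0 v e \<noteq> 0}"
    by (rule finite_subset[of _ "{zero_cell}"]) (auto simp: cochain0_def)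
  moreover have "cochain0 v e \<in> W (w - 2 * wt p e)" for e
    using assms fun_space.subspace_0[OF sub] by (simp add: cochain0_def)
  moreover have "finite {i. e i \<noteq> 0} \<and> deg e = 0" if "cochain0 v e \<noteq> 0" for e
  proof -
    have "e = zero_cell" using that by (auto simp: cochain0_def split: if_splits)
    then show ?thesis by (simp add: deg_def)
  qed
  ultimately show ?thesis unfolding cochains_def by blast
qed

lemma dl_cochain0:
  assumes v: "v \<in> W w" "\<And>i. X i v = 0"
  shows "\<delta> (cochain0 v) = 0"
proof
  fix e
  have "Dop p X i h (cochain0 v e') = 0" for i h e'
  proof (cases "e' = zero_cell")
    case True
    then show ?thesis using Dop_eq_0[OF v(1) v(2)] by (simp add: cochain0_def)
  next
    case False
    then have "cochain0 v e' = 0" unfolding cochain0_def by (rule if_not_P)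
    then show ?thesis by (simp only: Dop_0)
  qed
  then show "\<delta> (cochain0 v) e = 0 e"
    unfolding dl_def by (simp add: sum.neutral)
qed

end

section \<open>Acyclicity of M tensor k[G] in weights at most 1\<close>

context
  fixes C :: "('i \<Rightarrow> 'k::alg_closed_field) set" and p :: nat
  assumes C: "fun_space.subspace C" and p: "prime p" "CHAR('k) = p" "odd p"
begin

abbreviation (input) "XR \<equiv> dX p (rtU :: 'k \<Rightarrow> ('k sl2 \<times> 'i \<Rightarrow> 'k) \<Rightarrow> _)"
abbreviation (input) "WO \<equiv> wsp (Om C) rtH"

text \<open>The localisation at d is acyclic in positive degrees. A cochain there has finitely many
  coefficients, so one power of d clears all denominators.\<close>

lemma cocycle_torsion:
  assumes \<xi>: "\<xi> \<in> cochains p WO (Suc n) w" "dl p XR \<xi> = 0"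
  shows "\<exists>N. \<exists>\<eta>\<in>cochains p WO n (w - int N). dl p XR \<eta> = (\<lambda>e. mul (\<lambda>g. ent 2 2 g ^ N) (\<xi> e))"
proof -
  let ?\<rho> = "mul (\<lambda>g. inverse (ent 2 2 g) * ent 2 2 g)"
  let ?WD = "wsp (Omd C) rtH"
  interpret D: ycoord "Omd C" "{g. ent 2 2 g \<noteq> 0}" "\<lambda>g. ent 2 1 g / ent 2 2 g" p
    using Omd_ycoord[OF C p] .
  interpret L: xmodule_hom p XR WO XR ?WD ?\<rho> "int 0"
    using bmodule_hom.xmodule_hom[OF hom_loc[OF C p] p(1,2,3)] .
  have "(\<lambda>e. ?\<rho> (\<xi> e)) \<in> cochains p ?WD (Suc n) w"
    using L.hom_K[OF \<xi>(1)] by simp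
  moreover have "dl p XR (\<lambda>e. ?\<rho> (\<xi> e)) = 0"
    unfolding L.hom_dl[OF \<xi>(1)] \<xi>(2) by (rule ext) (simp only: zero_fun_apply L.f_0)
  ultimately have "(\<lambda>e. ?\<rho> (\<xi> e)) \<in> cobounds p XR ?WD (Suc n) w"
    using D.free_acyclic[OF D.ycoord_free, of n w] unfolding acyclic_at_def by blast
  then obtain \<eta> where \<eta>: "\<eta> \<in> cochains p ?WD n w" "(\<lambda>e. ?\<rho> (\<xi> e)) = dl p XR \<eta>"
    unfolding cobounds_def by auto
  have "\<exists>r. \<forall>e\<in>{e. \<eta> e \<noteq> 0}. \<forall>i\<ge>r. mul (\<lambda>g. ent 2 2 g ^ i) (\<eta> e) \<in> Om C"
  proof (rule finite_uniform_bound[OF D.K_fin[OF \<eta>(1)]])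
    fix e
    have "\<eta> e \<in> Omd C" by (rule D.W_C[OF D.K_W[OF \<eta>(1)]])
    then obtain N F where F: "\<eta> e = mul (\<lambda>g. inverse (ent 2 2 g) ^ Suc N) F" "F \<in> Om C"
      unfolding Omd_def by blast
    \<comment> \<open>One power more than the denominator, so that a positive power of d remains and
      both sides vanish on d = 0.\<close>
    have "mul (\<lambda>g. ent 2 2 g ^ i) (\<eta> e) \<in> Om C" if "i \<ge> Suc (Suc N)" for i
    proof -
      have "x ^ i * inverse x ^ Suc N = x ^ (i - Suc N)" for x :: 'k
      proof (cases "x = 0")
        case True
        then show ?thesis using that by (simp add: power_0_left)
      next
        case False
        have "x ^ i = x ^ (i - Suc N) * x ^ Suc N" unfolding power_add[symmetric] using that by simp
        moreover have "x ^ Suc N * inverse x ^ Suc N = 1"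
          using False by (simp only: power_mult_distrib[symmetric]) simp
        ultimately show ?thesis by (simp only: mult.assoc mult_1_right)
      qed
      then have "mul (\<lambda>g. ent 2 2 g ^ i) (\<eta> e) = mul (\<lambda>g. ent 2 2 g ^ (i - Suc N)) F"
        unfolding F(1) mul_mul by metis
      then show ?thesis using Om_mul[OF F(2) CR_power[OF CR_ent]] by metis
    qed
    then show "\<exists>r. \<forall>i\<ge>r. mul (\<lambda>g. ent 2 2 g ^ i) (\<eta> e) \<in> Om C" by blast
  qed
  then obtain r where r: "\<And>e i. \<eta> e \<noteq> 0 \<Longrightarrow> i \<ge> r \<Longrightarrow> mul (\<lambda>g. ent 2 2 g ^ i) (\<eta> e) \<in> Om C" by blast
  \<comment> \<open>\<open>N\<close> is positive, so that d^N is unchanged by the indicator function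
    of the open cell.\<close>
  define N where "N = Suc r"
  interpret P: xmodule_hom p XR ?WD XR ?WD "mul (\<lambda>g. ent 2 2 g ^ N)" "int N"
    using bmodule_hom.xmodule_hom[OF hom_dpow[OF C p] p(1,2,3)] .
  define \<eta>' where "\<eta>' = (\<lambda>e. mul (\<lambda>g. ent 2 2 g ^ N) (\<eta> e))"
  have "\<eta>' \<in> cochains p ?WD n (w - int N)" unfolding \<eta>'_def by (rule P.hom_K[OF \<eta>(1)])
  moreover have "\<eta>' e \<in> Om C" for e
  proof (cases "\<eta> e = 0")
    case True
    then show ?thesis unfolding \<eta>'_def using P.f_0 fun_space.subspace_0[OF Om_sub] by metis
  next
    case False
    show ?thesis unfolding \<eta>'_def by (rule r[OF False]) (simp add: N_def)
  qed
  ultimately have "\<eta>' \<in> cochains p WO n (w - int N)"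
    by (simp add: cochains_def wsp_def)
  moreover have "dl p XR \<eta>' = (\<lambda>e. mul (\<lambda>g. ent 2 2 g ^ N) (\<xi> e))"
  proof
    fix e
    have "dl p XR \<eta>' e = mul (\<lambda>g. ent 2 2 g ^ N) (?\<rho> (\<xi> e))"
      unfolding \<eta>'_def P.hom_dl[OF \<eta>(1)] \<eta>(2)[symmetric] ..
    moreover have "x ^ N * (inverse x * x) = x ^ N" for x :: 'k
      by (cases "x = 0") (simp_all add: N_def)
    ultimately show "dl p XR \<eta>' e = mul (\<lambda>g. ent 2 2 g ^ N) (\<xi> e)"
      by (simp only: mul_mul)
  qed
  ultimately show ?thesis by blast
qed

text \<open>The locus d = 0 is the single coset of B through \<open>?g1\<close>, so an invariant of
  weight \<open>w\<close> is determined by its value m there and equals b^(-w) m. This extends to a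
  regular function because -w \<ge> 0, which is where the weight bound originates.\<close>

lemma res_invariant_lift:
  assumes w: "w \<le> 0" and F: "F \<in> wsp (Om0 C) rtH w" "\<And>i. XR i F = 0"
  shows "\<exists>G\<in>WO w. (\<forall>i. XR i G = 0) \<and> mul ind0 G = F"
proof -
  interpret B: bmodule "Om0 C" rtU rtH by (rule Om0_bmodule)
  interpret O: bmodule "Om C" rtU rtH by (rule Om_bmodule)
  let ?g1 = "mk2 0 1 (-1) 0 :: 'k sl2"
  have FC: "F \<in> Om0 C" by (rule B.W_C[OF F(1)])
  then obtain F1 where F1: "F = mul ind0 F1" "F1 \<in> Om C" unfolding Om0_def by blast
  have g1: "ent 1 1 ?g1 = 0" "ent 1 2 ?g1 = 1" "ent 2 1 ?g1 = -1" "ent 2 2 ?g1 = 0"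
    by (simp_all add: ent_mk2)
  define m where "m = (\<lambda>c. F1 (?g1, c))"
  have m: "m \<in> C" unfolding m_def by (rule Om_eval[OF F1(2) C])
  define n where "n = nat (- w)"
  define G where "G = ten (\<lambda>g. ent 1 2 g ^ n) m"
  have GC: "G \<in> Om C" unfolding G_def by (intro Om_ten m CR_power CR_ent)
  have "RT (lo t) G = G" for t by (auto simp: G_def fun_eq_iff ent_b_lo)
  then have XG: "XR i G = 0" for i by (rule O.dX_invariant[OF p(1,2)])
  have "RT (tor s) G = fscale (s powi w) G" if s: "s \<noteq> 0" for s
  proof -
    have "s powi w = 1 / s ^ n" using w by (simp add: n_def power_int_def power_inverse divide_inverse)
    then show ?thesis by (auto simp: G_def fun_eq_iff ent_b_tor[OF s] power_divide fscale_def)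
  qed
  then have GW: "G \<in> WO w" using GC by (simp add: wsp_def)
  have U: "RT (lo t) F = F" for t by (rule B.U_invariant[OF p(1,2) FC F(2)])
  have "F (g, c) = mul ind0 G (g, c)" for g c
  proof (cases "ent 2 2 g = 0")
    case False
    then show ?thesis by (simp add: F1(1) ind0_def)
  next
    case True
    let ?a = "ent 1 1 g" and ?b = "ent 1 2 g" and ?c = "ent 2 1 g"
    have "- (?b * ?c) = 1" using ent_det[of g] True by simp
    then have bc: "?b * ?c = -1" by (metis minus_minus)
    then have b: "?b \<noteq> 0" by auto
    have cb: "?c = - inverse ?b" using bc b by (simp add: field_simps)
    have g: "g * lo (?a * ?c) = ?g1 * tor (inverse ?b)"
      by (rule sl2_eqI) (use b True in \<open>simp_all add: ent_mult g1 cb\<close>)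
    have "F (g, c) = F (g * lo (?a * ?c), c)"
      using fun_cong[OF U[of "?a * ?c"], of "(g, c)"] by simp
    also have "\<dots> = (RT (tor (inverse ?b)) F) (?g1, c)" by (simp add: g)
    also have "\<dots> = inverse ?b powi w * F (?g1, c)"
      using B.W_H[OF F(1), of "inverse ?b"] b by (simp add: fscale_def)
    also have "inverse ?b powi w = ?b ^ n" using w by (simp add: n_def power_int_def)
    also have "F (?g1, c) = m c" by (simp add: F1(1) m_def ind0_def g1)
    finally show ?thesis using True by (simp add: G_def ind0_def)
  qed
  then have "mul ind0 G = F" by auto
  then show ?thesis using GW XG by blast
qed

lemma mul_d_inj:
  assumes "F \<in> Om C" "mul (ent 2 2) F = 0"
  shows "F = 0"
proof -
  have "F (g, c) = 0" for g c
  proof (rule CR_zero_dense[OF Om_coord[OF assms(1)]])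
    fix g :: "'k sl2" assume "ent 2 2 g \<noteq> 0"
    then show "F (g, c) = 0" using fun_cong[OF assms(2), of "(g, c)"] by simp
  qed
  then show ?thesis by auto
qed

text \<open>The exact sequence given by multiplication by d and restriction to d = 0. The
  obstruction is the restriction of \<open>\<eta>\<close>: in positive degree it bounds, since
  \<open>Om0 C\<close> is acyclic; in degree 0 it is an invariant of weight w - 1 \<le> 0 and
  lifts.\<close>

lemma mul_d_boundary:
  assumes w: "w \<le> 1" and \<xi>: "\<xi> \<in> cochains p WO (Suc n) w" "dl p XR \<xi> = 0"
    and \<eta>: "\<eta> \<in> cochains p WO n (w - 1)" "dl p XR \<eta> = (\<lambda>e. mul (ent 2 2) (\<xi> e))"
  shows "\<exists>\<mu>\<in>cochains p WO n w. dl p XR \<mu> = \<xi>"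
proof -
  let ?W0 = "wsp (Om0 C) rtH"
  interpret Z: ycoord "Om0 C" "{g. ent 2 2 g = 0}" "\<lambda>g. - (ent 1 1 g * ent 2 1 g)" p
    using Om0_ycoord[OF C p] .
  interpret O: bmodule "Om C" rtU rtH by (rule Om_bmodule)
  interpret bmodule_hom "Om C" rtU rtH "Om0 C" rtU rtH "mul ind0" 0 by (rule hom_res[OF C p])
  interpret R: xmodule_epi p XR WO XR ?W0 "mul ind0" "int 0"
    by (rule xmodule_epi[OF p]) (simp add: Om0_def)
  have R\<eta>: "(\<lambda>e. mul ind0 (\<eta> e)) \<in> cochains p ?W0 n (w - 1)"
    using R.hom_K[OF \<eta>(1)] by simp
  have "mul ind0 (mul (ent 2 2) F) = 0" for F :: "'k sl2 \<times> 'i \<Rightarrow> 'k"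
    by (auto simp: fun_eq_iff ind0_def)
  then have dR\<eta>: "dl p XR (\<lambda>e. mul ind0 (\<eta> e)) = 0"
    unfolding R.hom_dl[OF \<eta>(1)] \<eta>(2) by (intro ext) (simp only: zero_fun_apply)
  have "\<exists>\<kappa>\<in>cochains p WO n (w - 1). dl p XR \<kappa> = 0 \<and> (\<forall>e. mul ind0 (\<kappa> e) = mul ind0 (\<eta> e))"
  proof (cases n)
    case (Suc m)
    have "acyclic_at p XR ?W0 n (w - 1)"
      unfolding Suc by (rule Z.free_acyclic[OF Z.ycoord_free])
    then obtain \<theta> where \<theta>: "\<theta> \<in> cochains p ?W0 m (w - 1)" "(\<lambda>e. mul ind0 (\<eta> e)) = dl p XR \<theta>"
      using R\<eta> dR\<eta> Suc unfolding acyclic_at_def cobounds_def by auto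
    obtain \<theta>' where \<theta>': "\<theta>' \<in> cochains p WO m (w - 1)" "(\<lambda>e. mul ind0 (\<theta>' e)) = \<theta>"
      using R.lift_K[of \<theta> m "w - 1"] \<theta>(1) by auto
    have "dl p XR \<theta>' \<in> cochains p WO n (w - 1)" using R.Y.dl_K[OF \<theta>'(1)] Suc by simp
    moreover have "mul ind0 (dl p XR \<theta>' e) = mul ind0 (\<eta> e)" for e
      using R.hom_dl[OF \<theta>'(1)] \<theta>(2) \<theta>'(2) by metis
    ultimately show ?thesis using R.Y.dl_dl[OF \<theta>'(1)] by blast
  next
    case 0
    have Z0: "(\<lambda>e. mul ind0 (\<eta> e)) \<in> cochains p ?W0 0 (w - 1)" using R\<eta> 0 by simp
    have O0: "\<eta> \<in> cochains p WO 0 (w - 1)" using \<eta>(1) 0 by simp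
    obtain G where G: "G \<in> WO (w - 1)" "\<And>i. XR i G = 0" "mul ind0 G = mul ind0 (\<eta> zero_cell)"
      using res_invariant_lift[OF _ Z.K_0_W[OF Z0] Z.K_0_cocycle[OF Z0 dR\<eta>]] w by auto
    have "R.Y.cochain0 G \<in> cochains p WO n (w - 1)"
      using R.Y.cochain0_K[OF G(1)] 0 by simp
    moreover have "dl p XR (R.Y.cochain0 G) = 0" by (rule R.Y.dl_cochain0[OF G(1,2)])
    moreover have "mul ind0 (R.Y.cochain0 G e) = mul ind0 (\<eta> e)" for e
      using G(3) R.Y.K_0_supp[OF O0, of e] by (cases "e = zero_cell") (simp_all add: R.Y.cochain0_def)
    ultimately show ?thesis by blast
  qed
  then obtain \<kappa> where \<kappa>: "\<kappa> \<in> cochains p WO n (w - 1)" "dl p XR \<kappa> = 0"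
    "\<And>e. mul ind0 (\<kappa> e) = mul ind0 (\<eta> e)" by blast
  have hd: "xmodule_hom p XR WO XR WO (mul (ent 2 2)) 1"
    using bmodule_hom.xmodule_hom[OF hom_d[OF C p] p(1,2,3)] by simp
  show ?thesis
  proof (rule R.divide_boundary[OF hd _ _ \<xi>(1) \<eta> \<kappa>])
    show "F = 0" if "F \<in> WO w'" "mul (ent 2 2) F = 0" for F w'
      using mul_d_inj[OF O.W_C[OF that(1)] that(2)] .
    show "\<exists>u\<in>WO w'. mul (ent 2 2) u = F" if F: "F \<in> WO (w' - 1)" "mul ind0 F = 0" for F w'
    proof -
      have "F (g, c) = 0" if "ent 2 2 g = 0" for g c
        using fun_cong[OF F(2), of "(g, c)"] that by (simp add: ind0_def)
      then obtain G where G: "G \<in> Om C" "F = mul (ent 2 2) G"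
        using Om_dvd_d[OF O.W_C[OF F(1)]] by blast
      have "RT (tor s) G = fscale (s powi w') G" if s: "s \<noteq> 0" for s
      proof -
        have "mul (ent 2 2) (RT (tor s) G) = fscale s (RT (tor s) F)"
          unfolding G(2) RT_mul using s by (auto simp: fun_eq_iff fscale_def ent_d_tor)
        also have "\<dots> = fscale (s * s powi (w' - 1)) F"
          using O.W_H[OF F(1) s] by simp
        also have "s * s powi (w' - 1) = s powi w'" using s by (simp add: power_int_diff)
        finally have "mul (ent 2 2) (RT (tor s) G - fscale (s powi w') G) = 0"
          unfolding G(2) by (auto simp: fun_eq_iff fscale_def algebra_simps)
        then have "RT (tor s) G - fscale (s powi w') G = 0"
          by (rule mul_d_inj[OF fun_space.subspace_diff[OF Om_sub O.H_C[OF G(1) s]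
                fun_space.subspace_scale[OF Om_sub G(1)]]])
        then show ?thesis by (metis eq_iff_diff_eq_0)
      qed
      then show ?thesis using G by (auto simp: wsp_def)
    qed
  qed
qed

text \<open>The power of d from \<open>cocycle_torsion\<close> is removed one factor at a time;
  passing to d times the cocycle lowers the weight, so the bound persists.\<close>

theorem Om_acyclic:
  assumes "w \<le> 1"
  shows "acyclic_at p XR WO (Suc n) w"
proof -
  interpret H: xmodule_hom p XR WO XR WO "mul (ent 2 2)" 1
    using bmodule_hom.xmodule_hom[OF hom_d[OF C p] p(1,2,3)] by simp
  have main: "\<exists>\<mu>\<in>cochains p WO n w. dl p XR \<mu> = \<xi>"
    if "w \<le> 1" "\<xi> \<in> cochains p WO (Suc n) w" "dl p XR \<xi> = 0"
      "\<exists>\<eta>\<in>cochains p WO n (w - int N). dl p XR \<eta> = (\<lambda>e. mul (\<lambda>g. ent 2 2 g ^ N) (\<xi> e))"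
    for N \<xi> w
    using that
  proof (induction N arbitrary: \<xi> w)
    case 0
    have "mul (\<lambda>g. ent 2 2 g ^ 0) (\<xi> e) = \<xi> e" for e by (auto simp: fun_eq_iff)
    then show ?case using 0(4) by simp
  next
    case (Suc N)
    define \<zeta> where "\<zeta> = (\<lambda>e. mul (ent 2 2) (\<xi> e))"
    have \<zeta>: "\<zeta> \<in> cochains p WO (Suc n) (w - 1)"
      unfolding \<zeta>_def by (rule H.hom_K[OF Suc.prems(2)])
    have d\<zeta>: "dl p XR \<zeta> = 0"
      unfolding \<zeta>_def H.hom_dl[OF Suc.prems(2)] Suc.prems(3)
      by (rule ext) (simp only: zero_fun_apply H.f_0)
    have "mul (\<lambda>g. ent 2 2 g ^ N) (\<zeta> e) = mul (\<lambda>g. ent 2 2 g ^ Suc N) (\<xi> e)" for e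
      unfolding \<zeta>_def mul_mul by (simp add: mult.commute)
    then have "\<exists>\<eta>\<in>cochains p WO n (w - 1 - int N). dl p XR \<eta> = (\<lambda>e. mul (\<lambda>g. ent 2 2 g ^ N) (\<zeta> e))"
      using Suc.prems(4) by (simp add: algebra_simps)
    then obtain \<eta> where "\<eta> \<in> cochains p WO n (w - 1)" "dl p XR \<eta> = \<zeta>"
      using Suc.IH[OF _ \<zeta> d\<zeta>] Suc.prems(1) by auto
    then show ?case using mul_d_boundary[OF Suc.prems(1,2,3)] unfolding \<zeta>_def by blast
  qed
  show ?thesis
    unfolding acyclic_at_def
  proof (intro ballI impI)
    fix \<xi> assume \<xi>: "\<xi> \<in> cochains p WO (Suc n) w" "dl p XR \<xi> = 0"
    obtain N where "\<exists>\<eta>\<in>cochains p WO n (w - int N). dl p XR \<eta> = (\<lambda>e. mul (\<lambda>g. ent 2 2 g ^ N) (\<xi> e))"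
      using cocycle_torsion[OF \<xi>] by blast
    then obtain \<mu> where "\<mu> \<in> cochains p WO n w" "dl p XR \<mu> = \<xi>"
      using main[OF assms \<xi>] by blast
    then show "\<xi> \<in> cobounds p XR WO (Suc n) w" by (auto simp: cobounds_def)
  qed
qed

end

section \<open>Rational modules\<close>

lemma subspace_image:
  assumes V: "fun_space.subspace V" and f: "lin_on V f"
  shows "fun_space.subspace (f ` V)"
  unfolding fun_space.subspace_def
proof (intro conjI ballI allI)
  show "0 \<in> f ` V"
    by (rule image_eqI[where f = f, OF lin_on_0[OF V f, symmetric] fun_space.subspace_0[OF V]])
next
  fix x y assume "x \<in> f ` V" "y \<in> f ` V"
  then obtain u v where uv: "u \<in> V" "v \<in> V" "x = f u" "y = f v" by blast
  show "x + y \<in> f ` V"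
    unfolding uv(3,4)
    by (rule image_eqI[where f = f, OF lin_on_add[OF V f uv(1,2), symmetric] fun_space.subspace_add[OF V uv(1,2)]])
next
  fix c x assume "x \<in> f ` V"
  then obtain u where u: "u \<in> V" "x = f u" by blast
  show "fscale c x \<in> f ` V"
    unfolding u(2)
    by (rule image_eqI[where f = f, OF lin_on_scale[OF V f u(1), symmetric] fun_space.subspace_scale[OF V u(1)]])
qed

definition orb :: "('k::field, 'i) gmodule \<Rightarrow> ('i \<Rightarrow> 'k) \<Rightarrow> ('k sl2 \<times> 'i \<Rightarrow> 'k)" where
  "orb M v = (\<lambda>(g, c). gact M g v c)"

lemma orb_apply [simp]: "orb M v (g, c) = gact M g v c"
  by (simp add: orb_def)

lemma rational_moduleI:
  fixes M :: "('k::field, 'i) gmodule"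
  assumes sub: "fun_space.subspace (gcarrier M)"
    and lin: "\<And>g. lin_on (gcarrier M) (gact M g)"
    and one: "\<And>v. v \<in> gcarrier M \<Longrightarrow> gact M 1 v = v"
    and mult: "\<And>g h v. v \<in> gcarrier M \<Longrightarrow> gact M (g * h) v = gact M g (gact M h v)"
    and orb: "\<And>v. v \<in> gcarrier M \<Longrightarrow> orb M v \<in> Om (gcarrier M)"
  shows "rational_module M"
proof -
  have "gact M g v \<in> gcarrier M" if "v \<in> gcarrier M" for g v
    using Om_eval[OF orb[OF that] sub, of g] by simp
  moreover have "\<exists>(n::nat) w f. (\<forall>i<n. w i \<in> gcarrier M \<and> f i \<in> CR) \<and>
      (\<forall>g. gact M g v = (\<Sum>i<n. fscale (f i g) (w i)))" if "v \<in> gcarrier M" for v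
    using Om_sum_form[OF orb[OF that]] by simp
  ultimately show ?thesis
    unfolding rational_module_def
    using sub lin one mult by (auto simp: lin_on_def)
qed

locale rational =
  fixes M :: "('k::field, 'i) gmodule"
  assumes rational: "rational_module M"
begin

abbreviation "C \<equiv> gcarrier M"

lemma C_sub: "fun_space.subspace C"
  using rational by (simp add: rational_module_def)

lemma act_C: "v \<in> C \<Longrightarrow> gact M g v \<in> C"
  using rational by (simp add: rational_module_def)

lemma act_lin: "lin_on C (gact M g)"
  using rational by (simp add: rational_module_def lin_on_def)

lemma act_1: "v \<in> C \<Longrightarrow> gact M 1 v = v"
  using rational by (simp add: rational_module_def)

lemma act_mult: "v \<in> C \<Longrightarrow> gact M (g * h) v = gact M g (gact M h v)"
  using rational by (simp add: rational_module_def)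

lemma orb_Om:
  assumes v: "v \<in> C"
  shows "orb M v \<in> Om C"
proof -
  obtain n :: nat and w and f :: "nat \<Rightarrow> 'k sl2 \<Rightarrow> 'k"
    where *: "\<forall>i<n. w i \<in> C \<and> f i \<in> CR" "\<forall>g. gact M g v = (\<Sum>i<n. fscale (f i g) (w i))"
    using rational v unfolding rational_module_def by metis
  show ?thesis
    by (rule Om_sum_formI[OF C_sub *(1)]) (simp add: *(2))
qed

end

abbreviation "MU M \<equiv> \<lambda>t. gact M (lo t)"
abbreviation "MH M \<equiv> \<lambda>s. gact M (tor s)"

lemma rational_bmodule:
  fixes M :: "('k::alg_closed_field, 'i) gmodule"
  assumes "rational_module M"
  shows "bmodule (gcarrier M) (MU M) (MH M)"
proof -
  interpret rational M by standard fact
  show ?thesis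
  proof
    fix v assume v: "v \<in> C"
    have eq: "gact M h v = (\<lambda>x. orb M v (h, x))" for h by simp
    show "\<exists>N w. (\<forall>n. w n \<in> C) \<and> (\<forall>n\<ge>N. w n = 0) \<and> (\<forall>t. gact M (lo t) v = (\<Sum>n<N. fscale (t ^ n) (w n)))"
      unfolding eq by (rule Om_lo[OF orb_Om[OF v] C_sub])
    show "\<exists>A a. finite A \<and> (\<forall>i\<in>A. a i \<in> C) \<and>
        (\<forall>s. s \<noteq> 0 \<longrightarrow> gact M (tor s) v = (\<Sum>i\<in>A. fscale (s powi i) (a i)))"
      unfolding eq by (rule Om_tor[OF orb_Om[OF v] C_sub])
  qed (simp_all add: C_sub act_lin act_1 act_mult[symmetric] lo_add tor_mult tor_lo)
qed

lemma Hom_G_bmodule_hom: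
  fixes M :: "('k::alg_closed_field, 'i) gmodule" and N :: "('k, 'j) gmodule"
  assumes "rational_module M" "rational_module N" "\<phi> \<in> Hom_G M N"
  shows "bmodule_hom (gcarrier M) (MU M) (MH M) (gcarrier N) (MU N) (MH N) \<phi> 0"
proof -
  interpret Y: bmodule "gcarrier M" "MU M" "MH M" by (rule rational_bmodule[OF assms(1)])
  interpret Z: bmodule "gcarrier N" "MU N" "MH N" by (rule rational_bmodule[OF assms(2)])
  show ?thesis
    by standard (use assms(3) in \<open>auto simp: Hom_G_def lin_on_def\<close>)
qed

text \<open>Only the carrier of \<open>M\<close> enters; its action is remembered by the orbit map,
  which embeds \<open>M\<close> equivariantly for right translation.\<close>

definition omega_module :: "('k::field, 'i) gmodule \<Rightarrow> ('k, 'k sl2 \<times> 'i) gmodule" where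
  "omega_module M = \<lparr>gcarrier = Om (gcarrier M), gact = RT\<rparr>"

lemma omega_module_simps [simp]:
  "gcarrier (omega_module M) = Om (gcarrier M)" "gact (omega_module M) = RT"
  by (simp_all add: omega_module_def)

lemma rational_omega: "rational_module (omega_module M)"
proof (rule rational_moduleI)
  fix F assume "F \<in> gcarrier (omega_module M)"
  then have "(\<lambda>(h, x). F (fst x * h, snd x)) \<in> Om (Om (gcarrier M))"
    by (simp add: Om_comult)
  moreover have "orb (omega_module M) F = (\<lambda>(h, x). F (fst x * h, snd x))"
    by (auto simp: orb_def fun_eq_iff)
  ultimately show "orb (omega_module M) F \<in> Om (gcarrier (omega_module M))" by simp
qed (simp_all add: Om_sub lin_on_RT RT_1 RT_RT)

lemma Om_map_second:
  fixes V :: "('i \<Rightarrow> 'k::field) set"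
  assumes K: "K \<in> Om V" and V: "fun_space.subspace V" and L: "lin_on V L"
    and V': "fun_space.subspace V'" "\<And>v. v \<in> V \<Longrightarrow> L v \<in> V'"
  shows "(\<lambda>(g, c). L (\<lambda>x. K (g, x)) c) \<in> Om V'"
proof -
  obtain n :: nat and w and f :: "nat \<Rightarrow> 'k sl2 \<Rightarrow> 'k"
    where *: "\<forall>i<n. w i \<in> V \<and> f i \<in> CR" "\<forall>g. (\<lambda>c. K (g, c)) = (\<Sum>i<n. fscale (f i g) (w i))"
    using Om_sum_form[OF K] by blast
  show ?thesis
  proof (rule Om_sum_formI[OF V'(1), where n = n and w = "\<lambda>i. L (w i)" and f = f])
    show "\<forall>i<n. L (w i) \<in> V' \<and> f i \<in> CR" using *(1) V'(2) by simp
    fix g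
    have "L (\<lambda>x. K (g, x)) = (\<Sum>i<n. fscale (f i g) (L (w i)))"
      unfolding *(2)[rule_format] using *(1) by (intro lin_on_sum_scale[OF V L]) simp
    then show "(\<lambda>c. (\<lambda>(g, c). L (\<lambda>x. K (g, x)) c) (g, c)) = (\<Sum>i<n. fscale (f i g) (L (w i)))"
      by simp
  qed
qed

text \<open>Carries a module along an injective linear map into k^nat, the only place where
  \<open>injective_module\<close> tests extensions.\<close>

definition transport :: "(('i \<Rightarrow> 'k::field) \<Rightarrow> ('j \<Rightarrow> 'k)) \<Rightarrow> ('k, 'i) gmodule \<Rightarrow> ('k, 'j) gmodule" where
  "transport \<kappa> M = \<lparr>gcarrier = \<kappa> ` gcarrier M,
     gact = (\<lambda>g x. \<kappa> (gact M g (inv_into (gcarrier M) \<kappa> x)))\<rparr>"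

context rational
begin

context
  fixes \<kappa> :: "('i \<Rightarrow> 'k) \<Rightarrow> ('j \<Rightarrow> 'k)"
  assumes lin: "lin_on C \<kappa>" and inj: "inj_on \<kappa> C"
begin

lemma transport_carrier: "gcarrier (transport \<kappa> M) = \<kappa> ` C"
  by (simp add: transport_def)

lemma transport_act: "v \<in> C \<Longrightarrow> gact (transport \<kappa> M) g (\<kappa> v) = \<kappa> (gact M g v)"
  by (simp add: transport_def inj)

lemma rational_transport: "rational_module (transport \<kappa> M)"
proof (rule rational_moduleI)
  show sub: "fun_space.subspace (gcarrier (transport \<kappa> M))"
    unfolding transport_carrier by (rule subspace_image[OF C_sub lin])
  show "lin_on (gcarrier (transport \<kappa> M)) (gact (transport \<kappa> M) g)" for g
    unfolding lin_on_def transport_carrier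
  proof (intro conjI ballI allI)
    fix x y assume "x \<in> \<kappa> ` C" "y \<in> \<kappa> ` C"
    then obtain u v where uv: "u \<in> C" "v \<in> C" "x = \<kappa> u" "y = \<kappa> v" by blast
    show "gact (transport \<kappa> M) g (x + y) = gact (transport \<kappa> M) g x + gact (transport \<kappa> M) g y"
      unfolding uv(3,4) lin_on_add[OF C_sub lin uv(1,2), symmetric] transport_act[OF uv(1)] transport_act[OF uv(2)]
        transport_act[OF fun_space.subspace_add[OF C_sub uv(1,2)]] lin_on_add[OF C_sub act_lin uv(1,2)]
      by (rule lin_on_add[OF C_sub lin act_C[OF uv(1)] act_C[OF uv(2)]])
  next
    fix c x assume "x \<in> \<kappa> ` C"
    then obtain u where u: "u \<in> C" "x = \<kappa> u" by blast
    show "gact (transport \<kappa> M) g (fscale c x) = fscale c (gact (transport \<kappa> M) g x)"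
      unfolding u(2) lin_on_scale[OF C_sub lin u(1), symmetric] transport_act[OF u(1)]
        transport_act[OF fun_space.subspace_scale[OF C_sub u(1)]] lin_on_scale[OF C_sub act_lin u(1)]
      by (rule lin_on_scale[OF C_sub lin act_C[OF u(1)]])
  qed
  fix x assume "x \<in> gcarrier (transport \<kappa> M)"
  then obtain v where v: "v \<in> C" "x = \<kappa> v" by (auto simp: transport_carrier)
  show "gact (transport \<kappa> M) 1 x = x"
    using v by (simp add: transport_act act_1)
  show "gact (transport \<kappa> M) (g * h) x = gact (transport \<kappa> M) g (gact (transport \<kappa> M) h x)" for g h
    using v by (simp add: transport_act act_mult act_C)
  have "(\<lambda>(g, c). \<kappa> (\<lambda>x. orb M v (g, x)) c) \<in> Om (gcarrier (transport \<kappa> M))"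
    by (rule Om_map_second[OF orb_Om[OF v(1)] C_sub lin sub]) (simp add: transport_carrier)
  then show "orb (transport \<kappa> M) x \<in> Om (gcarrier (transport \<kappa> M))"
    by (simp add: orb_def v transport_act)
qed

end

end

lemma lin_inj_onI:
  assumes V: "fun_space.subspace V" and f: "lin_on V f" and z: "\<And>v. v \<in> V \<Longrightarrow> f v = 0 \<Longrightarrow> v = 0"
  shows "inj_on f V"
proof (rule inj_onI)
  fix u v assume uv: "u \<in> V" "v \<in> V" "f u = f v"
  then have "f (u - v) = 0" using lin_on_diff[OF V f uv(1,2)] by (metis diff_self)
  then have "u - v = 0" by (rule z[OF fun_space.subspace_diff[OF V uv(1,2)]])
  then show "u = v" by (metis eq_iff_diff_eq_0)
qed


section \<open>A countable dense set of points\<close>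

lemma poly_zero_infinite:
  fixes P :: "'k::field poly"
  assumes "infinite S" "\<And>x. x \<in> S \<Longrightarrow> poly P x = 0"
  shows "P = 0"
  using assms poly_roots_finite[of P] by (metis (mono_tags, lifting) finite_subset mem_Collect_eq subsetI)

text \<open>Elements with b nonzero are products lo upp lo. If b = 0 then a is nonzero, and right
  multiplication by upp(1) makes b nonzero.\<close>

lemma sl2_factor: "\<exists>a b c d. g = lo a * upp b * lo c * upp (d :: 'k::field)"
proof -
  have main: "\<exists>a b c. h = lo a * upp b * lo (c :: 'k)" if b: "ent 1 2 h \<noteq> 0" for h
  proof -
    have "h = lo ((ent 2 2 h - 1) / ent 1 2 h) * upp (ent 1 2 h) * lo ((ent 1 1 h - 1) / ent 1 2 h)"
    proof (rule sl2_eqI)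
      have "ent 2 1 h * ent 1 2 h = ent 1 1 h * ent 2 2 h - 1"
        using ent_det[of h] by (simp add: algebra_simps)
      then have "ent 2 1 h = (ent 1 1 h * ent 2 2 h - 1) / ent 1 2 h"
        using b by (simp add: eq_divide_eq)
      also have "\<dots> = (ent 2 2 h - 1) / ent 1 2 h + ent 2 2 h * ((ent 1 1 h - 1) / ent 1 2 h)"
        by (simp add: add_divide_distrib[symmetric] algebra_simps)
      finally show "ent 2 1 h = ent 2 1 (lo ((ent 2 2 h - 1) / ent 1 2 h) * upp (ent 1 2 h) * lo ((ent 1 1 h - 1) / ent 1 2 h))"
        using b by (simp add: ent_mult)
    qed (use b in \<open>simp_all add: ent_mult\<close>)
    then show ?thesis by blast
  qed
  have upp_add: "upp s * upp t = upp (s + t)" for s t :: 'k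
    by (rule sl2_eqI) (simp_all add: ent_mult add.commute)
  have upp_0: "upp 0 = (1 :: 'k sl2)" by (rule sl2_eqI) (simp_all add: ent_one)
  show ?thesis
  proof (cases "ent 1 2 g = 0")
    case False
    then obtain a b c where "g = lo a * upp b * lo c" using main by blast
    then have "g = lo a * upp b * lo c * upp 0" by (simp add: upp_0)
    then show ?thesis by blast
  next
    case True
    then have "ent 1 1 g \<noteq> 0" using ent_det[of g] by auto
    then have "ent 1 2 (g * upp 1) \<noteq> 0" using True by (simp add: ent_mult)
    then obtain a b c where "g * upp 1 = lo a * upp b * lo c" using main by blast
    then have "g * upp 1 * upp (- 1) = lo a * upp b * lo c * upp (- 1)" by simp
    then have "g = lo a * upp b * lo c * upp (- 1)" by (simp add: mult.assoc upp_add upp_0)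
    then show ?thesis by blast
  qed
qed

text \<open>The points are the products lo upp lo upp with parameters in a countably infinite set. A
  regular function is a polynomial in each parameter separately, so the parameters are freed one
  after another.\<close>

lemma countable_dense_points:
  "\<exists>\<gamma> :: nat \<Rightarrow> 'k::alg_closed_field sl2. \<forall>f\<in>CR. (\<forall>n. f (\<gamma> n) = 0) \<longrightarrow> (\<forall>g. f g = 0)"
proof -
  obtain s :: "nat \<Rightarrow> 'k" where s: "inj s"
    using infinite_countable_subset[OF infinite_UNIV_alg_closed[where 'k = 'k]] by auto
  define S where "S = range s"
  have S: "infinite S" using s by (simp add: S_def finite_image_iff)
  define \<gamma> where "\<gamma> n = (case prod_decode n of (m, l) \<Rightarrow> case prod_decode m of (i, j) \<Rightarrow>
    case prod_decode l of (i', j') \<Rightarrow> lo (s i) * upp (s j) * lo (s i') * upp (s j'))" for n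
  have "f g = 0" if f: "f \<in> CR" and z: "\<forall>n. f (\<gamma> n) = 0" for f g
  proof -
    have 0: "f (lo a * upp b * lo c * upp d) = 0"
      if abcd: "a \<in> S" "b \<in> S" "c \<in> S" "d \<in> S" for a b c d
    proof -
      obtain i j i' j' where "a = s i" "b = s j" "c = s i'" "d = s j'" using abcd unfolding S_def by blast
      then have "\<gamma> (prod_encode (prod_encode (i, j), prod_encode (i', j'))) = lo a * upp b * lo c * upp d"
        by (simp add: \<gamma>_def)
      then show ?thesis using z by metis
    qed
    have 1: "f (lo a * upp b * lo c * upp d) = 0" if "b \<in> S" "c \<in> S" "d \<in> S" for a b c d
    proof -
      obtain P where P: "\<And>t. f (1 * lo t * (upp b * lo c * upp d)) = poly P t" using CR_lo[OF f] by blast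
      have "P = 0" by (rule poly_zero_infinite[OF S]) (simp add: P[symmetric] 0 that mult.assoc[symmetric])
      then show ?thesis using P[of a] by (simp add: mult.assoc)
    qed
    have 2: "f (lo a * upp b * lo c * upp d) = 0" if "c \<in> S" "d \<in> S" for a b c d
    proof -
      obtain P where P: "\<And>t. f (lo a * upp t * (lo c * upp d)) = poly P t" using CR_upp[OF f] by blast
      have "P = 0" by (rule poly_zero_infinite[OF S]) (simp add: P[symmetric] 1 that mult.assoc[symmetric])
      then show ?thesis using P[of b] by (simp add: mult.assoc)
    qed
    have 3: "f (lo a * upp b * lo c * upp d) = 0" if "d \<in> S" for a b c d
    proof -
      obtain P where P: "\<And>t. f (lo a * upp b * lo t * upp d) = poly P t" using CR_lo[OF f] by blast
      have "P = 0" by (rule poly_zero_infinite[OF S]) (simp add: P[symmetric] 2 that)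
      then show ?thesis using P[of c] by simp
    qed
    obtain a b c d where g: "g = lo a * upp b * lo c * upp d" using sl2_factor[of g] by blast
    obtain P where P: "\<And>t. f (lo a * upp b * lo c * upp t * 1) = poly P t" using CR_upp[OF f] by blast
    have "P = 0" by (rule poly_zero_infinite[OF S]) (use P in \<open>simp add: P[symmetric] 3\<close>)
    then show ?thesis using P[of d] g by simp
  qed
  then show ?thesis by blast
qed

text \<open>Evaluation at the dense points, combined with the coordinates of k^nat; each coordinate
  of an element is a regular function on G.\<close>

lemma omega_encode:
  fixes M :: "('k::alg_closed_field, nat) gmodule"
  shows "\<exists>\<kappa> :: ('k sl2 \<times> nat \<Rightarrow> 'k) \<Rightarrow> (nat \<Rightarrow> 'k). (\<forall>V. lin_on V \<kappa>) \<and> inj_on \<kappa> (Om (gcarrier M))"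
proof -
  obtain \<gamma> :: "nat \<Rightarrow> 'k sl2" where \<gamma>: "\<forall>f\<in>CR. (\<forall>n. f (\<gamma> n) = 0) \<longrightarrow> (\<forall>g. f g = 0)"
    using countable_dense_points by blast
  define \<kappa> :: "('k sl2 \<times> nat \<Rightarrow> 'k) \<Rightarrow> (nat \<Rightarrow> 'k)"
    where "\<kappa> F = (\<lambda>n. F (\<gamma> (fst (prod_decode n)), snd (prod_decode n)))" for F
  have lin: "lin_on V \<kappa>" for V
    by (auto simp: lin_on_def \<kappa>_def fscale_def fun_eq_iff)
  have "F = 0" if F: "F \<in> Om (gcarrier M)" and z: "\<kappa> F = 0" for F
  proof -
    have "F (\<gamma> n, c) = 0" for n c
      using fun_cong[OF z, of "prod_encode (n, c)"] by (simp add: \<kappa>_def)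
    then have "F (g, c) = 0" for g c
      using bspec[OF \<gamma> Om_coord[OF F, of c]] by simp
    then show ?thesis by auto
  qed
  then have "inj_on \<kappa> (Om (gcarrier M))" by (rule lin_inj_onI[OF Om_sub lin])
  then show ?thesis using lin by blast
qed

section \<open>Semi-invariant regular functions\<close>

text \<open>Such functions are sections of the line bundle of degree \<open>m\<close> on the
  projective line. They are polynomials P and Q in the two charts where d and b are nonzero, and the
  transition between the charts bounds the degree of P.\<close>

lemma semi_invariant:
  fixes f :: "'k::alg_closed_field sl2 \<Rightarrow> 'k"
  assumes f: "f \<in> CR" and inv: "\<And>g t. f (g * lo t) = f g"
    and wt: "\<And>g s. s \<noteq> 0 \<Longrightarrow> f (g * tor s) = s powi (- m) * f g"
  obtains P where "\<And>x. f (upp x) = poly P x" "P = 0 \<or> int (degree P) \<le> m"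
    "\<And>g. ent 2 2 g \<noteq> 0 \<Longrightarrow> f g = ent 2 2 g powi m * poly P (ent 1 2 g / ent 2 2 g)"
proof -
  let ?\<sigma> = "mk2 0 1 (-1) 0 :: 'k sl2"
  have \<sigma>: "ent 1 1 ?\<sigma> = 0" "ent 1 2 ?\<sigma> = 1" "ent 2 1 ?\<sigma> = -1" "ent 2 2 ?\<sigma> = 0"
    by (simp_all add: ent_mk2)
  obtain P where "\<And>x. f (1 * upp x * 1) = poly P x" using CR_upp[OF f] by blast
  then have P: "f (upp x) = poly P x" for x by simp
  obtain Q where "\<And>x. f (?\<sigma> * upp x * 1) = poly Q x" using CR_upp[OF f] by blast
  then have Q: "f (?\<sigma> * upp x) = poly Q x" for x by simp
  have chart1: "f g = ent 2 2 g powi m * poly P (ent 1 2 g / ent 2 2 g)" if d: "ent 2 2 g \<noteq> 0" for g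
  proof -
    have "ent 1 1 g * ent 2 2 g = 1 + ent 1 2 g * ent 2 1 g" using ent_det[of g] by (simp add: algebra_simps)
    then have a: "ent 1 1 g = inverse (ent 2 2 g) + ent 1 2 g * (ent 2 1 g / ent 2 2 g)"
      using d by (simp add: field_simps)
    have "g = upp (ent 1 2 g / ent 2 2 g) * tor (inverse (ent 2 2 g)) * lo (ent 2 1 g / ent 2 2 g)"
      by (rule sl2_eqI) (use d in \<open>simp_all add: ent_mult a\<close>)
    then have "f g = inverse (ent 2 2 g) powi (- m) * f (upp (ent 1 2 g / ent 2 2 g))"
      using inv wt[of "inverse (ent 2 2 g)"] d by (metis inverse_nonzero_iff_nonzero)
    then show ?thesis by (simp add: P power_int_minus power_int_inverse)
  qed
  have chart2: "f g = ent 1 2 g powi m * poly Q (- (ent 2 2 g / ent 1 2 g))" if b: "ent 1 2 g \<noteq> 0" for g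
  proof -
    have "ent 2 1 g * ent 1 2 g = ent 1 1 g * ent 2 2 g - 1" using ent_det[of g] by (simp add: algebra_simps)
    then have "ent 2 1 g = (ent 1 1 g * ent 2 2 g - 1) / ent 1 2 g" using b by (simp add: eq_divide_eq)
    then have c: "ent 2 1 g = ent 2 2 g * (ent 1 1 g / ent 1 2 g) - inverse (ent 1 2 g)"
      by (simp add: divide_inverse algebra_simps)
    have "g = ?\<sigma> * upp (- (ent 2 2 g / ent 1 2 g)) * tor (inverse (ent 1 2 g)) * lo (ent 1 1 g / ent 1 2 g)"
      by (rule sl2_eqI) (use b in \<open>simp_all add: ent_mult \<sigma> c\<close>)
    then have "f g = inverse (ent 1 2 g) powi (- m) * f (?\<sigma> * upp (- (ent 2 2 g / ent 1 2 g)))"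
      using inv wt[of "inverse (ent 1 2 g)"] b by (metis inverse_nonzero_iff_nonzero)
    then show ?thesis by (simp add: Q power_int_minus power_int_inverse)
  qed
  have rel: "poly P x = x powi m * poly Q (- inverse x)" if "x \<noteq> 0" for x
    using chart2[of "upp x"] that by (simp add: P divide_inverse)
  \<comment> \<open>Reversing the coefficients of Q(-x) turns Q(-1/x) into a polynomial, up to
    x^q.\<close>
  define R where "R = reflect_poly (Q \<circ>\<^sub>p [:0, -1:])"
  define q where "q = degree (Q \<circ>\<^sub>p [:0, -1:])"
  have R: "poly R x = x ^ q * poly Q (- inverse x)" if "x \<noteq> 0" for x
    using poly_reflect_poly_nz[OF that, of "Q \<circ>\<^sub>p [:0, -1:]"] by (simp add: R_def q_def poly_pcompose)
  have degR: "degree R \<le> q" unfolding R_def q_def by (rule degree_reflect_poly_le)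
  have "int (degree P) \<le> m" if P0: "P \<noteq> 0"
  proof -
    \<comment> \<open>Positive and negative part of \<open>m\<close>, so that the chart identity
      involves no negative powers.\<close>
    define a b where "a = nat m" and "b = nat (- m)"
    have m: "m = int a - int b" by (simp add: a_def b_def)
    have "monom 1 (b + q) * P - monom 1 a * R = 0"
    proof (rule poly_zero_infinite[of "UNIV - {0}"])
      fix x :: 'k assume "x \<in> UNIV - {0}"
      then have x: "x \<noteq> 0" by simp
      have "x ^ b * x powi m = x ^ a" unfolding m using x by (simp add: power_int_diff)
      then have "x ^ (b + q) * poly P x = x ^ a * poly R x"
        unfolding rel[OF x] R[OF x] by (simp add: power_add mult_ac)
      then show "poly (monom 1 (b + q) * P - monom 1 a * R) x = 0" by (simp add: poly_monom)
    qed (use infinite_UNIV_alg_closed in simp)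
    then have "degree (monom 1 (b + q) * P) = degree (monom 1 a * R)" by simp
    also have "\<dots> \<le> a + q"
      using degree_mult_le[of "monom 1 a" R] degR by (simp add: degree_monom_eq)
    finally have "b + q + degree P \<le> a + q"
      using P0 by (simp add: degree_mult_eq degree_monom_eq)
    then show ?thesis unfolding m by simp
  qed
  then show ?thesis using that[OF P _ chart1] by blast
qed

lemma semi_invariant_neg:
  fixes f :: "'k::alg_closed_field sl2 \<Rightarrow> 'k"
  assumes f: "f \<in> CR" "\<And>g t. f (g * lo t) = f g" "\<And>g s. s \<noteq> 0 \<Longrightarrow> f (g * tor s) = s powi (- m) * f g"
    and m: "m < 0"
  shows "f g = 0"
proof -
  obtain P where "\<And>x. f (upp x) = poly P x" and P: "P = 0 \<or> int (degree P) \<le> m"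
    "\<And>g. ent 2 2 g \<noteq> 0 \<Longrightarrow> f g = ent 2 2 g powi m * poly P (ent 1 2 g / ent 2 2 g)"
    by (rule semi_invariant[of f m]) (use f in auto)
  have "P = 0" using P(1) m by auto
  then show ?thesis using CR_zero_dense[OF f(1)] P(2) by simp
qed

lemma invariant_const:
  fixes f :: "'k::alg_closed_field sl2 \<Rightarrow> 'k"
  assumes f: "f \<in> CR" "\<And>g t. f (g * lo t) = f g" "\<And>g s. s \<noteq> 0 \<Longrightarrow> f (g * tor s) = f g"
  shows "f g = f 1"
proof -
  obtain P where "\<And>x. f (upp x) = poly P x" and P: "P = 0 \<or> int (degree P) \<le> 0"
    "\<And>g. ent 2 2 g \<noteq> 0 \<Longrightarrow> f g = ent 2 2 g powi 0 * poly P (ent 1 2 g / ent 2 2 g)"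
    by (rule semi_invariant[of f 0]) (use f in auto)
  then have "degree P = 0" by auto
  then obtain c where "P = [:c:]" by (rule degree_eq_zeroE)
  then have c: "f g = c" if "ent 2 2 g \<noteq> 0" for g using P(2)[OF that] by simp
  have "f g - c = 0"
    by (rule CR_zero_dense[OF CR_diff[OF f(1) coordinate_ring.const]]) (simp add: c)
  moreover have "f 1 = c" by (rule c) (simp add: ent_one)
  ultimately show ?thesis by simp
qed


section \<open>Acyclicity of modules\<close>

lemma acyclic_retract:
  assumes "xmodule_hom p XM WM XY WY \<iota> 0" and "xmodule_hom p XY WY XM WM r 0"
    and r\<iota>: "\<And>v w. v \<in> WM w \<Longrightarrow> r (\<iota> v) = v"
    and ac: "acyclic_at p XY WY (Suc n) w"
  shows "acyclic_at p XM WM (Suc n) w"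
proof -
  interpret I: xmodule_hom p XM WM XY WY \<iota> 0 by fact
  interpret R: xmodule_hom p XY WY XM WM r 0 by fact
  show ?thesis
    unfolding acyclic_at_def
  proof (intro ballI impI)
    fix \<xi> assume \<xi>: "\<xi> \<in> cochains p WM (Suc n) w" "dl p XM \<xi> = 0"
    have "(\<lambda>e. \<iota> (\<xi> e)) \<in> cochains p WY (Suc n) w" using I.hom_K[OF \<xi>(1)] by simp
    moreover have "dl p XY (\<lambda>e. \<iota> (\<xi> e)) = 0"
      unfolding I.hom_dl[OF \<xi>(1)] \<xi>(2) by (rule ext) (simp only: zero_fun_apply I.f_0)
    ultimately have "(\<lambda>e. \<iota> (\<xi> e)) \<in> cobounds p XY WY (Suc n) w"
      using ac unfolding acyclic_at_def by blast
    then obtain \<eta> where \<eta>: "\<eta> \<in> cochains p WY n w" "(\<lambda>e. \<iota> (\<xi> e)) = dl p XY \<eta>"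
      unfolding cobounds_def by auto
    have "dl p XM (\<lambda>e. r (\<eta> e)) = \<xi>"
      unfolding R.hom_dl[OF \<eta>(1)] \<eta>(2)[symmetric] by (rule ext) (rule r\<iota>[OF I.Y.K_W[OF \<xi>(1)]])
    moreover have "(\<lambda>e. r (\<eta> e)) \<in> cochains p WM n w" using R.hom_K[OF \<eta>(1)] by simp
    ultimately show "\<xi> \<in> cobounds p XM WM (Suc n) w" unfolding cobounds_def by auto
  qed
qed

lemma bmodule_hom_comp:
  assumes "bmodule_hom C U H C' U' H' f k" "bmodule_hom C' U' H' C'' U'' H'' g 0"
  shows "bmodule_hom C U H C'' U'' H'' (g \<circ> f) k"
proof -
  interpret F: bmodule_hom C U H C' U' H' f k by fact
  interpret G: bmodule_hom C' U' H' C'' U'' H'' g 0 by fact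
  show ?thesis
  proof
    show "lin_on C (g \<circ> f)" by (rule lin_on_comp[OF F.f_lin G.f_lin]) (auto intro: F.f_C)
    show "(g \<circ> f) (H s v) = fscale (s ^ k) (H'' s ((g \<circ> f) v))" if "v \<in> C" "s \<noteq> 0" for s v
      using lin_on_scale[OF F.Z.C_sub G.f_lin F.Z.H_C[OF F.f_C[OF that(1)] that(2)]]
        F.f_H[OF that] G.f_H[OF F.f_C[OF that(1)] that(2)] by simp
  qed (use F.f_C G.f_C F.f_U G.f_U in auto)
qed

context rational
begin

lemma orb_lin: "lin_on C (orb M)"
  using lin_on_add[OF C_sub act_lin] lin_on_scale[OF C_sub act_lin]
  by (auto simp: lin_on_def fun_eq_iff fscale_def)

lemma orb_0 [simp]: "orb M 0 = 0"
  by (rule lin_on_0[OF C_sub orb_lin])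

lemma RT_orb: "v \<in> C \<Longrightarrow> RT g (orb M v) = orb M (gact M g v)"
  by (auto simp: fun_eq_iff act_mult)

lemma orb_at_1: "v \<in> C \<Longrightarrow> (\<lambda>c. orb M v (1, c)) = v"
  by (simp add: act_1)

lemma orb_inj: "u \<in> C \<Longrightarrow> v \<in> C \<Longrightarrow> orb M u = orb M v \<Longrightarrow> u = v"
  using orb_at_1 by metis

end

lemma orb_bmodule_hom:
  fixes M :: "('k::alg_closed_field, 'i) gmodule"
  assumes "rational_module M"
  shows "bmodule_hom (gcarrier M) (MU M) (MH M) (Om (gcarrier M)) rtU rtH (orb M) 0"
proof -
  interpret rational M by standard fact
  interpret Y: bmodule C "MU M" "MH M" by (rule rational_bmodule[OF assms])
  interpret Z: bmodule "Om C" rtU rtH by (rule Om_bmodule)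
  show ?thesis
    by standard (simp_all add: orb_Om orb_lin RT_orb)
qed

lemma transport_bmodule_hom:
  fixes M :: "('k::alg_closed_field, 'i) gmodule" and \<kappa> :: "('i \<Rightarrow> 'k) \<Rightarrow> ('j \<Rightarrow> 'k)"
  assumes M: "rational_module M" and \<kappa>: "lin_on (gcarrier M) \<kappa>" "inj_on \<kappa> (gcarrier M)"
  shows "bmodule_hom (gcarrier M) (MU M) (MH M)
    (gcarrier (transport \<kappa> M)) (MU (transport \<kappa> M)) (MH (transport \<kappa> M)) \<kappa> 0"
proof -
  interpret rational M by standard fact
  interpret Y: bmodule C "MU M" "MH M" by (rule rational_bmodule[OF M])
  interpret Z: bmodule "gcarrier (transport \<kappa> M)" "MU (transport \<kappa> M)" "MH (transport \<kappa> M)"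
    by (rule rational_bmodule[OF rational_transport[OF \<kappa>]])
  show ?thesis
    by standard (simp_all add: transport_carrier[OF \<kappa>] transport_act[OF \<kappa>] \<kappa>(1))
qed

text \<open>Through the orbit map, moved into k^nat, \<open>Q\<close> embeds into Q tensor k[G];
  injectivity splits the embedding, so \<open>Q\<close> inherits acyclicity as a retract.\<close>

theorem injective_acyclic:
  fixes Q :: "('k::alg_closed_field, nat) gmodule"
  assumes p: "prime p" "CHAR('k) = p" "odd p" and Q: "injective_module Q"
  shows "acyclic_at p (dX p (MU Q)) (wsp (gcarrier Q) (MH Q)) (Suc n) 0"
proof -
  have rat: "rational_module Q" using Q by (simp add: injective_module_def)
  interpret rational Q by standard (fact rat)
  obtain \<kappa> :: "('k sl2 \<times> nat \<Rightarrow> 'k) \<Rightarrow> (nat \<Rightarrow> 'k)"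
    where \<kappa>: "\<And>V. lin_on V \<kappa>" "inj_on \<kappa> (Om C)" using omega_encode[of Q] by blast
  let ?O = "omega_module Q"
  define N where "N = transport \<kappa> ?O"
  interpret O: rational ?O by standard (rule rational_omega)
  have \<kappa>': "lin_on (gcarrier ?O) \<kappa>" "inj_on \<kappa> (gcarrier ?O)" using \<kappa> by simp_all
  have ratN: "rational_module N" unfolding N_def by (rule O.rational_transport[OF \<kappa>'])
  have actN: "gact N g (\<kappa> F) = \<kappa> (RT g F)" if "F \<in> Om C" for g F
    using O.transport_act[OF \<kappa>', of F g] that by (simp add: N_def)
  have carN: "gcarrier N = \<kappa> ` Om C"
    using O.transport_carrier[OF \<kappa>'] by (simp add: N_def)
  define \<iota> where "\<iota> v = (if v \<in> C then \<kappa> (orb Q v) else 0)" for v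
  have \<iota>: "\<iota> \<in> Hom_G Q N"
    using orb_Om lin_on_add[OF C_sub orb_lin] lin_on_scale[OF C_sub orb_lin] \<kappa>(1)[of UNIV]
      fun_space.subspace_add[OF C_sub] fun_space.subspace_scale[OF C_sub]
    by (simp add: Hom_G_def \<iota>_def carN actN RT_orb act_C lin_on_def)
  have inj: "inj_on \<iota> C"
  proof (rule inj_onI)
    fix u v assume uv: "u \<in> C" "v \<in> C" "\<iota> u = \<iota> v"
    then have "orb Q u = orb Q v"
      using inj_onD[OF \<kappa>(2)] orb_Om by (simp add: \<iota>_def)
    then show "u = v" using orb_inj uv by blast
  qed
  \<comment> \<open>The identity, extended by zero as \<open>Hom_G\<close> demands.\<close>
  have id: "(\<lambda>v. if v \<in> C then v else 0) \<in> Hom_G Q Q"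
    using fun_space.subspace_add[OF C_sub] fun_space.subspace_scale[OF C_sub]
    by (simp add: Hom_G_def act_C)
  have "\<forall>\<iota>\<in>Hom_G Q N. inj_on \<iota> C \<longrightarrow> (\<forall>\<phi>\<in>Hom_G Q Q. \<exists>\<psi>\<in>Hom_G N Q. \<forall>v\<in>C. \<psi> (\<iota> v) = \<phi> v)"
    using Q rat ratN unfolding injective_module_def by simp
  from bspec[OF mp[OF bspec[OF this \<iota>] inj] id] obtain \<psi>
    where \<psi>: "\<psi> \<in> Hom_G N Q" "\<forall>v\<in>C. \<psi> (\<iota> v) = (if v \<in> C then v else 0)" by (elim bexE)
  have 1: "bmodule_hom (Om C) rtU rtH C (MU Q) (MH Q) (\<psi> \<circ> \<kappa>) 0"
    using bmodule_hom_comp[OF transport_bmodule_hom[OF rational_omega \<kappa>'] Hom_G_bmodule_hom[OF ratN rat \<psi>(1), unfolded N_def]]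
    by simp
  have h1: "xmodule_hom p (dX p (MU Q)) (wsp C (MH Q)) (dX p rtU) (wsp (Om C) rtH) (orb Q) 0"
    using bmodule_hom.xmodule_hom[OF orb_bmodule_hom[OF rat] p(1,2,3)] by simp
  have h2: "xmodule_hom p (dX p rtU) (wsp (Om C) rtH) (dX p (MU Q)) (wsp C (MH Q)) (\<psi> \<circ> \<kappa>) 0"
    using bmodule_hom.xmodule_hom[OF 1 p(1,2,3)] by simp
  show ?thesis
  proof (rule acyclic_retract[OF h1, OF h2])
    show "(\<psi> \<circ> \<kappa>) (orb Q v) = v" if "v \<in> wsp C (MH Q) w" for v w
      using \<psi>(2) that by (simp add: \<iota>_def wsp_def)
    show "acyclic_at p (dX p rtU) (wsp (Om C) rtH) (Suc n) 0"
      by (rule Om_acyclic[OF C_sub p]) simp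
  qed
qed

text \<open>The matrix coefficients of \<open>v\<close> are sections of the line bundle of degree
  \<open>-w\<close> on the projective line: constants for w = 0, zero for w > 0. In particular
  B-invariants are G-invariants.\<close>

lemma fixed_points:
  fixes M :: "('k::alg_closed_field, 'i) gmodule"
  assumes p: "prime p" "CHAR('k) = p" "odd p" and M: "rational_module M"
    and v: "v \<in> wsp (gcarrier M) (MH M) w" "\<And>i. dX p (MU M) i v = 0"
  shows "w = 0 \<Longrightarrow> gact M g v = v" and "w > 0 \<Longrightarrow> v = 0"
proof -
  interpret rational M by standard fact
  interpret bmodule C "MU M" "MH M" by (rule rational_bmodule[OF M])
  have vC: "v \<in> C" by (rule W_C[OF v(1)])
  have CR: "(\<lambda>g. gact M g v c) \<in> CR" for c using Om_coord[OF orb_Om[OF vC], of c] by simp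
  have U: "gact M (lo t) v = v" for t by (rule U_invariant[OF p(1,2) vC v(2)])
  have inv: "gact M (g * lo t) v c = gact M g v c" for g t c
    by (simp add: act_mult[OF vC] U)
  have wt: "gact M (g * tor s) v c = s powi (- (- w)) * gact M g v c" if "s \<noteq> 0" for g s c
    unfolding act_mult[OF vC] W_H[OF v(1) that] lin_on_scale[OF C_sub act_lin vC] by (simp add: fscale_def)
  show "gact M g v = v" if "w = 0"
  proof
    fix c
    have "gact M g v c = gact M 1 v c"
      by (rule invariant_const[OF CR inv]) (use wt that in simp)
    then show "gact M g v c = v c" by (simp add: act_1[OF vC])
  qed
  show "v = 0" if "w > 0"
  proof
    fix c
    have "gact M 1 v c = 0"
      by (rule semi_invariant_neg[where m = "- w", OF CR inv wt]) (use that in auto)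
    then show "v c = 0 c" by (simp add: act_1[OF vC])
  qed
qed

lemma acyclic_0_weight_1:
  fixes M :: "('k::alg_closed_field, 'i) gmodule"
  assumes p: "prime p" "CHAR('k) = p" "odd p" and M: "rational_module M"
  shows "acyclic_at p (dX p (MU M)) (wsp (gcarrier M) (MH M)) 0 1"
proof -
  interpret bmodule "gcarrier M" "MU M" "MH M" by (rule rational_bmodule[OF M])
  interpret xmodule p "dX p (MU M)" W by (rule xmodule[OF p])
  show ?thesis
    unfolding acyclic_at_def
  proof (intro ballI impI)
    fix \<xi> assume \<xi>: "\<xi> \<in> K 0 1" "\<delta> \<xi> = 0"
    have "\<xi> zero_cell = 0"
      by (rule fixed_points(2)[OF p M K_0_W[OF \<xi>(1)] K_0_cocycle[OF \<xi>]]) simp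
    then have "\<xi> e = 0" for e using K_0_supp[OF \<xi>(1), of e] by (cases "e = zero_cell") auto
    then have "\<xi> = 0" by (simp add: fun_eq_iff)
    then show "\<xi> \<in> cobounds p (dX p (MU M)) W 0 1" by (simp add: cobounds_def)
  qed
qed

text \<open>
  The quotient of \<open>M \<otimes> k[G]\<close> by the image of \<open>M\<close> under the orbit map, realised on the complement of
  the functions vanishing at the identity.
\<close>

definition omega_proj :: "('k::field, 'i) gmodule \<Rightarrow> ('k sl2 \<times> 'i \<Rightarrow> 'k) \<Rightarrow> ('k sl2 \<times> 'i \<Rightarrow> 'k)" where
  "omega_proj M F = F - orb M (\<lambda>c. F (1, c))"

definition omega_quotient :: "('k::field, 'i) gmodule \<Rightarrow> ('k, 'k sl2 \<times> 'i) gmodule" where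
  "omega_quotient M = \<lparr>gcarrier = {F \<in> Om (gcarrier M). \<forall>c. F (1, c) = 0},
     gact = (\<lambda>g F. omega_proj M (RT g F))\<rparr>"

context rational
begin

abbreviation "Q0 \<equiv> {F \<in> Om C. \<forall>c. F (1, c) = 0}"

lemma omega_quotient_simps [simp]:
  "gcarrier (omega_quotient M) = Q0" "gact (omega_quotient M) g F = omega_proj M (RT g F)"
  by (simp_all add: omega_quotient_def)

lemma Q0_sub: "fun_space.subspace Q0"
  using Om_sub[of C] by (simp add: fun_space.subspace_def fscale_def)

lemma at_1_C: "F \<in> Om C \<Longrightarrow> (\<lambda>c. F (1, c)) \<in> C"
  by (rule Om_eval[OF _ C_sub])

lemma omega_proj_lin: "lin_on (Om C) (omega_proj M)"
  unfolding lin_on_def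
proof (intro conjI ballI allI)
  fix F G assume FG: "F \<in> Om C" "G \<in> Om C"
  have "(\<lambda>c. (F + G) (1, c)) = (\<lambda>c. F (1, c)) + (\<lambda>c. G (1, c))" by (auto simp: fun_eq_iff)
  then have "orb M (\<lambda>c. (F + G) (1, c)) = orb M (\<lambda>c. F (1, c)) + orb M (\<lambda>c. G (1, c))"
    using lin_on_add[OF C_sub orb_lin at_1_C[OF FG(1)] at_1_C[OF FG(2)]] by simp
  then show "omega_proj M (F + G) = omega_proj M F + omega_proj M G"
    unfolding omega_proj_def by (simp only: add_diff_add)
next
  fix c F assume F: "F \<in> Om C"
  have "(\<lambda>d. fscale c F (1, d)) = fscale c (\<lambda>d. F (1, d))" by (auto simp: fun_eq_iff fscale_def)
  then show "omega_proj M (fscale c F) = fscale c (omega_proj M F)"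
    unfolding omega_proj_def fun_space.scale_right_diff_distrib
    using lin_on_scale[OF C_sub orb_lin at_1_C[OF F]] by metis
qed

lemma omega_proj_Q0:
  assumes F: "F \<in> Om C"
  shows "omega_proj M F \<in> Q0"
proof -
  have "omega_proj M F \<in> Om C"
    unfolding omega_proj_def by (rule fun_space.subspace_diff[OF Om_sub F orb_Om[OF at_1_C[OF F]]])
  then show ?thesis by (simp add: omega_proj_def act_1 at_1_C[OF F])
qed

lemma omega_proj_id: "F \<in> Q0 \<Longrightarrow> omega_proj M F = F"
  using orb_0 by (simp add: omega_proj_def zero_fun_def)

lemma omega_proj_orb: "v \<in> C \<Longrightarrow> omega_proj M (orb M v) = 0"
  unfolding omega_proj_def by (metis orb_at_1 diff_self)

lemma omega_proj_eq_0: "omega_proj M F = 0 \<Longrightarrow> orb M (\<lambda>c. F (1, c)) = F"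
  unfolding omega_proj_def by (metis eq_iff_diff_eq_0)

lemma RT_Om: "F \<in> Om C \<Longrightarrow> RT g F \<in> Om C"
  using rational.act_C[of "omega_module M" F g] rational_omega[of M] by (simp add: rational_def)

text \<open>Makes the action on representatives well defined: the correction is an orbit function,
  its translates are orbit functions, and these are projected to 0.\<close>

lemma omega_proj_RT:
  assumes F: "F \<in> Om C"
  shows "omega_proj M (RT g (omega_proj M F)) = omega_proj M (RT g F)"
proof -
  let ?v = "\<lambda>c. F (1, c)"
  have v: "?v \<in> C" by (rule at_1_C[OF F])
  have "RT g (omega_proj M F) = RT g F - orb M (gact M g ?v)"
    unfolding omega_proj_def RT_orb[OF v, symmetric] by (auto simp: fun_eq_iff)
  then have "omega_proj M (RT g (omega_proj M F)) = omega_proj M (RT g F) - omega_proj M (orb M (gact M g ?v))"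
    using lin_on_diff[OF Om_sub omega_proj_lin RT_Om[OF F] orb_Om[OF act_C[OF v]]] by simp
  then show ?thesis unfolding omega_proj_orb[OF act_C[OF v]] by simp
qed

lemma rational_omega_quotient: "rational_module (omega_quotient M)"
proof (rule rational_moduleI)
  show "lin_on (gcarrier (omega_quotient M)) (gact (omega_quotient M) g)" for g
  proof -
    have "lin_on (Om C) (omega_proj M \<circ> RT g)"
      by (rule lin_on_comp[OF lin_on_RT omega_proj_lin]) (use RT_Om in auto)
    then have "lin_on Q0 (omega_proj M \<circ> RT g)" by (rule lin_on_subset) auto
    then show ?thesis by (simp add: omega_quotient_def comp_def)
  qed
  fix F assume F: "F \<in> gcarrier (omega_quotient M)"
  then have FO: "F \<in> Om C" and F0: "F \<in> Q0" by auto
  show "gact (omega_quotient M) 1 F = F"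
    by (simp add: RT_1 omega_proj_id[OF F0])
  show "gact (omega_quotient M) (g * h) F = gact (omega_quotient M) g (gact (omega_quotient M) h F)" for g h
    by (simp add: omega_proj_RT[OF RT_Om[OF FO]] RT_RT)
  have "(\<lambda>(g, c). omega_proj M (\<lambda>x. (\<lambda>(h, x). F (fst x * h, snd x)) (g, x)) c) \<in> Om (gcarrier (omega_quotient M))"
    by (rule Om_map_second[OF Om_comult[OF FO] Om_sub omega_proj_lin])
      (use Q0_sub omega_proj_Q0 in auto)
  moreover have "(\<lambda>x. (\<lambda>(h, x). F (fst x * h, snd x)) (g, x)) = RT g F" for g
    by (auto simp: fun_eq_iff)
  ultimately show "orb (omega_quotient M) F \<in> Om (gcarrier (omega_quotient M))"
    by (simp add: orb_def)
qed (use Q0_sub in simp)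

end

lemma omega_proj_bmodule_hom:
  fixes M :: "('k::alg_closed_field, 'i) gmodule"
  assumes M: "rational_module M"
  shows "bmodule_hom (Om (gcarrier M)) rtU rtH (gcarrier (omega_quotient M))
    (MU (omega_quotient M)) (MH (omega_quotient M)) (omega_proj M) 0"
proof -
  interpret rational M by standard fact
  interpret Y: bmodule "Om C" rtU rtH by (rule Om_bmodule)
  interpret Z: bmodule "gcarrier (omega_quotient M)" "MU (omega_quotient M)" "MH (omega_quotient M)"
    by (rule rational_bmodule[OF rational_omega_quotient])
  show ?thesis
    by standard (use omega_proj_Q0 omega_proj_lin in \<open>simp_all add: omega_proj_RT\<close>)
qed

text \<open>Expresses that all derived functors of induction vanish on the weight -1. Degree 0 is
  \<open>fixed_points\<close>; a higher degree is shifted down along M -> M tensor k[G] -> quotient,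
  the quotient being encoded in k^nat again to meet the induction hypothesis.\<close>

theorem weight_1_acyclic:
  fixes M :: "('k::alg_closed_field, nat) gmodule"
  assumes p: "prime p" "CHAR('k) = p" "odd p" and M: "rational_module M"
  shows "acyclic_at p (dX p (MU M)) (wsp (gcarrier M) (MH M)) n 1"
  using M
proof (induction n arbitrary: M)
  case 0
  then show ?case by (rule acyclic_0_weight_1[OF p])
next
  case (Suc n)
  interpret rational M by standard fact
  obtain \<kappa> :: "('k sl2 \<times> nat \<Rightarrow> 'k) \<Rightarrow> (nat \<Rightarrow> 'k)"
    where \<kappa>: "\<And>V. lin_on V \<kappa>" "inj_on \<kappa> (Om C)" using omega_encode[of M] by blast
  let ?N = "transport \<kappa> (omega_quotient M)"
  interpret Q: rational "omega_quotient M" by standard (rule rational_omega_quotient)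
  have \<kappa>': "lin_on (gcarrier (omega_quotient M)) \<kappa>" "inj_on \<kappa> (gcarrier (omega_quotient M))"
    using \<kappa>(1) inj_on_subset[OF \<kappa>(2)] by auto
  have ratN: "rational_module ?N" by (rule Q.rational_transport[OF \<kappa>'])
  have hom: "bmodule_hom (Om C) rtU rtH (gcarrier ?N) (MU ?N) (MH ?N) (\<kappa> \<circ> omega_proj M) 0"
    by (rule bmodule_hom_comp[OF omega_proj_bmodule_hom[OF Suc.prems]
          transport_bmodule_hom[OF rational_omega_quotient \<kappa>']])
  have surj: "gcarrier ?N \<subseteq> (\<kappa> \<circ> omega_proj M) ` Om C"
  proof
    fix x assume "x \<in> gcarrier ?N"
    then obtain F where F: "F \<in> Q0" "x = \<kappa> F"
      unfolding Q.transport_carrier[OF \<kappa>'] by auto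
    then have "x = (\<kappa> \<circ> omega_proj M) F" using omega_proj_id[OF F(1)] by simp
    then show "x \<in> (\<kappa> \<circ> omega_proj M) ` Om C" using F(1) by blast
  qed
  interpret E: xmodule_epi p "dX p rtU" "wsp (Om C) rtH" "dX p (MU ?N)" "wsp (gcarrier ?N) (MH ?N)"
    "\<kappa> \<circ> omega_proj M" "int 0"
    by (rule bmodule_hom.xmodule_epi[OF hom p surj])
  have \<iota>: "xmodule_hom p (dX p (MU M)) (wsp C (MH M)) (dX p rtU) (wsp (Om C) rtH) (orb M) 0"
    using bmodule_hom.xmodule_hom[OF orb_bmodule_hom[OF Suc.prems] p(1,2,3)] by simp
  have \<kappa>0: "\<kappa> 0 = 0" by (rule lin_on_0[OF fun_space.subspace_UNIV \<kappa>(1)])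
  show ?case
  proof (rule E.acyclic_shift[OF \<iota>])
    show "v = 0" if "v \<in> wsp C (MH M) w" "orb M v = 0" for v w
      using orb_inj[of v 0] that fun_space.subspace_0[OF C_sub] by (simp add: wsp_def)
    show "(\<kappa> \<circ> omega_proj M) (orb M v) = 0" if "v \<in> wsp C (MH M) w" for v w
      using omega_proj_orb[of v] that \<kappa>0 by (simp add: wsp_def)
    show "\<exists>u\<in>wsp C (MH M) w. orb M u = F" if F: "F \<in> wsp (Om C) rtH w" "(\<kappa> \<circ> omega_proj M) F = 0" for F w
    proof -
      have FO: "F \<in> Om C" using F(1) by (simp add: wsp_def)
      have "omega_proj M F \<in> Om C" using omega_proj_Q0[OF FO] by simp
      then have "omega_proj M F = 0"
        using inj_onD[OF \<kappa>(2), of "omega_proj M F" 0] F(2) \<kappa>0 fun_space.subspace_0[OF Om_sub[of C]] by simp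
      then have eq: "orb M (\<lambda>c. F (1, c)) = F" by (rule omega_proj_eq_0)
      let ?u = "\<lambda>c. F (1, c)"
      have u: "?u \<in> C" by (rule at_1_C[OF FO])
      have "gact M (tor s) ?u = fscale (s powi w) ?u" if s: "s \<noteq> 0" for s
      proof (rule orb_inj)
        have "orb M (gact M (tor s) ?u) = fscale (s powi w) F"
          using RT_orb[OF u, of "tor s"] eq F(1) s by (simp add: wsp_def)
        also have "\<dots> = orb M (fscale (s powi w) ?u)"
          using lin_on_scale[OF C_sub orb_lin u] eq by simp
        finally show "orb M (gact M (tor s) ?u) = orb M (fscale (s powi w) ?u)" .
      qed (use act_C[OF u] fun_space.subspace_scale[OF C_sub u] in auto)
      then show ?thesis using eq u by (auto simp: wsp_def)
    qed
    show "acyclic_at p (dX p (MU ?N)) (wsp (gcarrier ?N) (MH ?N)) n (1 - int 0)"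
      using Suc.IH[OF ratN] by simp
    show "acyclic_at p (dX p rtU) (wsp (Om C) rtH) (Suc n) 1"
      by (rule Om_acyclic[OF C_sub p]) simp
  qed
qed

section \<open>Weyl modules\<close>

text \<open>The coordinates with respect to \<open>bas\<close>: on upp(x) the function
  \<open>bas m i\<close> is x^i.\<close>

definition cf :: "('k::field sl2 \<Rightarrow> 'k) \<Rightarrow> nat \<Rightarrow> 'k" where
  "cf f i = coeff (SOME P. \<forall>x. f (upp x) = poly P x) i"

text \<open>The binary forms b^i d^(m-i), a basis of \<open>ind m\<close> for i \<le> m.\<close>

definition bas :: "nat \<Rightarrow> nat \<Rightarrow> 'k::field sl2 \<Rightarrow> 'k" where
  "bas m i g = ent 1 2 g ^ i * ent 2 2 g ^ (m - i)"

abbreviation "ind m \<equiv> gcarrier (induced_module m)"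

lemma cf_eq:
  fixes f :: "'k::alg_closed_field sl2 \<Rightarrow> 'k"
  assumes P: "\<And>x. f (upp x) = poly P x"
  shows "cf f i = coeff P i"
proof -
  define P' where "P' = (SOME P. \<forall>x. f (upp x) = poly P x)"
  have "\<forall>x. f (upp x) = poly P' x" unfolding P'_def by (rule someI[of _ P]) (use P in blast)
  then have "poly (P' - P) x = 0" for x using P by simp
  then have "P' - P = 0" by (intro poly_zero_infinite[OF infinite_UNIV_alg_closed])
  then show ?thesis by (simp add: cf_def P'_def)
qed

lemma CR_upp_poly: "f \<in> CR \<Longrightarrow> \<exists>P. \<forall>x. f (upp x) = poly P x"
  using CR_upp[of f 1 1] by simp

lemma cf_sum:
  fixes f :: "nat \<Rightarrow> 'k::alg_closed_field sl2 \<Rightarrow> 'k"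
  assumes "\<And>a. a \<in> A \<Longrightarrow> f a \<in> CR"
  shows "cf (\<lambda>g. \<Sum>a\<in>A. c a * f a g) i = (\<Sum>a\<in>A. c a * cf (f a) i)"
proof -
  obtain P where P: "\<And>a x. a \<in> A \<Longrightarrow> f a (upp x) = poly (P a) x"
    using CR_upp_poly[OF assms] by metis
  have "cf (\<lambda>g. \<Sum>a\<in>A. c a * f a g) i = coeff (\<Sum>a\<in>A. smult (c a) (P a)) i"
    by (rule cf_eq) (simp add: poly_sum P)
  also have "\<dots> = (\<Sum>a\<in>A. c a * cf (f a) i)"
    unfolding coeff_sum by (intro sum.cong refl) (simp add: cf_eq[OF P])
  finally show ?thesis .
qed

lemma cf_add:
  fixes f h :: "'k::alg_closed_field sl2 \<Rightarrow> 'k"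
  shows "f \<in> CR \<Longrightarrow> h \<in> CR \<Longrightarrow> cf (f + h) i = cf f i + cf h i"
  using cf_sum[of "{0, 1}" "\<lambda>a. if a = 0 then f else h" "\<lambda>_. 1" i] by (simp add: plus_fun_def)

lemma cf_scale:
  fixes f :: "'k::alg_closed_field sl2 \<Rightarrow> 'k"
  shows "f \<in> CR \<Longrightarrow> cf (fscale c f) i = c * cf f i"
  using cf_sum[of "{0}" "\<lambda>a. f" "\<lambda>_. c" i] by (simp add: fscale_def)

lemma cf_mult_b:
  fixes f :: "'k::alg_closed_field sl2 \<Rightarrow> 'k"
  assumes "f \<in> CR"
  shows "cf (\<lambda>g. ent 1 2 g * f g) (Suc i) = cf f i"
proof -
  obtain P where P: "\<And>x. f (upp x) = poly P x" using CR_upp_poly[OF assms] by blast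
  have "cf (\<lambda>g. ent 1 2 g * f g) (Suc i) = coeff (pCons 0 P) (Suc i)"
    by (rule cf_eq) (simp add: P)
  then show ?thesis by (simp add: cf_eq[OF P])
qed

lemma cf_translate_CR:
  fixes F :: "'k::alg_closed_field sl2 \<Rightarrow> 'k"
  assumes "F \<in> CR"
  shows "(\<lambda>g. cf (\<lambda>x. F (g * x)) l) \<in> CR"
proof -
  obtain n :: nat and w and f :: "nat \<Rightarrow> 'k sl2 \<Rightarrow> 'k"
    where *: "\<forall>i<n. w i \<in> CR \<and> f i \<in> CR"
      "\<forall>h. (\<lambda>g. (\<lambda>(h, g). F (g * h)) (h, g)) = (\<Sum>i<n. fscale (f i h) (w i))"
    using Om_sum_form[OF CR_comult[OF assms]] by blast
  have "F (g * h) = (\<Sum>i<n. w i g * f i h)" for g h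
    using fun_cong[OF *(2)[rule_format, of h], of g] by (simp add: sum_fun_apply fscale_def mult.commute)
  then have "cf (\<lambda>x. F (g * x)) l = (\<Sum>i<n. w i g * cf (f i) l)" for g
    using cf_sum[of "{..<n}" f "\<lambda>i. w i g" l] *(1) by simp
  moreover have "(\<lambda>g. \<Sum>i<n. w i g * cf (f i) l) \<in> CR"
    using *(1) by (intro CR_sum coordinate_ring.mult coordinate_ring.const) auto
  ultimately show ?thesis by simp
qed

lemma ind_iff:
  "f \<in> ind m \<longleftrightarrow> f \<in> CR \<and> (\<forall>g. \<forall>b. ent 1 2 b = 0 \<longrightarrow> f (g * b) = inverse (ent 1 1 b ^ m) * f g)"
  by (auto simp: induced_module_def borel_subgroup_def ent_def)

lemma ind_act: "gact (induced_module m) g f = (\<lambda>x. f (inverse g * x))"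
  by (simp add: induced_module_def)

lemma ind_CR: "f \<in> ind m \<Longrightarrow> f \<in> CR"
  by (simp add: ind_iff)

lemma ind_sub: "fun_space.subspace (ind m :: ('k::alg_closed_field sl2 \<Rightarrow> 'k) set)"
  unfolding fun_space.subspace_def
proof (intro conjI ballI allI)
  show "0 \<in> (ind m :: ('k sl2 \<Rightarrow> 'k) set)"
    using fun_space.subspace_0[OF CR_sub] by (simp add: ind_iff)
next
  fix f h :: "'k sl2 \<Rightarrow> 'k" assume "f \<in> ind m" "h \<in> ind m"
  then show "f + h \<in> ind m"
    using fun_space.subspace_add[OF CR_sub, of f h] by (simp add: ind_iff algebra_simps)
next
  fix c and f :: "'k sl2 \<Rightarrow> 'k" assume "f \<in> ind m"
  then show "fscale c f \<in> ind m"
    using fun_space.subspace_scale[OF CR_sub, of f c] by (simp add: ind_iff fscale_def)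
qed

lemma CR_translate:
  assumes "f \<in> CR"
  shows "(\<lambda>x. f (g * x)) \<in> CR"
  using assms
proof induction
  case (entry i j)
  have "(\<lambda>x. Rep_sl2 (g * x) $ i $ j) = (\<lambda>x. ent i 1 g * ent 1 j x + ent i 2 g * ent 2 j x)"
    by (simp add: ent_mult[symmetric]) (simp add: ent_def)
  then show ?case by (simp add: coordinate_ring.add CR_scale CR_ent)
qed (intro coordinate_ring.intros; assumption)+

lemma ind_translate: "f \<in> ind m \<Longrightarrow> (\<lambda>x. f (g * x)) \<in> ind m"
  by (simp add: ind_iff CR_translate mult.assoc[symmetric])

lemma bas_ind: "i \<le> m \<Longrightarrow> bas m i \<in> ind m"
  unfolding ind_iff
proof (intro conjI allI impI)
  show "bas m i \<in> CR"
    unfolding bas_def[abs_def] by (intro coordinate_ring.mult CR_power CR_ent)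
  fix g b :: "'a sl2" assume i: "i \<le> m" and b: "ent 1 2 b = 0"
  then have ab: "ent 1 1 b * ent 2 2 b = 1" using ent_det[of b] by simp
  then have "ent 2 2 b = inverse (ent 1 1 b)" by (metis inverse_unique)
  then have "ent 1 2 (g * b) = ent 1 2 g * inverse (ent 1 1 b)" "ent 2 2 (g * b) = ent 2 2 g * inverse (ent 1 1 b)"
    using b by (simp_all add: ent_mult)
  then have "bas m i (g * b) = inverse (ent 1 1 b) ^ i * inverse (ent 1 1 b) ^ (m - i) * bas m i g"
    by (simp add: bas_def power_mult_distrib)
  also have "inverse (ent 1 1 b) ^ i * inverse (ent 1 1 b) ^ (m - i) = inverse (ent 1 1 b ^ m)"
    using power_add[of "inverse (ent 1 1 b)" i "m - i"] i by (simp add: power_inverse)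
  finally show "bas m i (g * b) = inverse (ent 1 1 b ^ m) * bas m i g" .
qed

text \<open>By \<open>semi_invariant\<close> with degree m the expansion holds on the open cell;
  density extends it to G.\<close>

lemma ind_expand:
  fixes f :: "'k::alg_closed_field sl2 \<Rightarrow> 'k"
  assumes f: "f \<in> ind m"
  shows "f g = (\<Sum>i\<le>m. cf f i * bas m i g)"
proof -
  have CR: "f \<in> CR" and B: "\<And>g b. ent 1 2 b = 0 \<Longrightarrow> f (g * b) = inverse (ent 1 1 b ^ m) * f g"
    using f by (auto simp: ind_iff)
  obtain P where P: "\<And>x. f (upp x) = poly P x" "P = 0 \<or> int (degree P) \<le> int m"
    "\<And>g. ent 2 2 g \<noteq> 0 \<Longrightarrow> f g = ent 2 2 g powi int m * poly P (ent 1 2 g / ent 2 2 g)"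
    by (rule semi_invariant[of f "int m"]) (use CR B in \<open>auto simp: power_int_minus\<close>)
  have "f g - (\<Sum>i\<le>m. cf f i * bas m i g) = 0"
  proof (rule CR_zero_dense)
    show "(\<lambda>g. f g - (\<Sum>i\<le>m. cf f i * bas m i g)) \<in> CR"
      by (intro CR_diff CR CR_sum CR_scale ind_CR[OF bas_ind]) simp
    fix g :: "'k sl2" assume d: "ent 2 2 g \<noteq> 0"
    have "poly P y = (\<Sum>i\<le>m. coeff P i * y ^ i)" for y
      unfolding poly_altdef using P(2) by (intro sum.mono_neutral_left) (auto simp: coeff_eq_0)
    then have "f g = (\<Sum>i\<le>m. ent 2 2 g ^ m * (cf f i * (ent 1 2 g / ent 2 2 g) ^ i))"
      unfolding P(3)[OF d] by (simp add: sum_distrib_left cf_eq[OF P(1)])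
    also have "\<dots> = (\<Sum>i\<le>m. cf f i * bas m i g)"
    proof (rule sum.cong[OF refl])
      fix i assume "i \<in> {..m}"
      then have "ent 2 2 g ^ m = ent 2 2 g ^ i * ent 2 2 g ^ (m - i)" by (simp add: power_add[symmetric])
      then show "ent 2 2 g ^ m * (cf f i * (ent 1 2 g / ent 2 2 g) ^ i) = cf f i * bas m i g"
        using d by (simp add: bas_def power_divide)
    qed
    finally show "f g - (\<Sum>i\<le>m. cf f i * bas m i g) = 0" by simp
  qed
  then show ?thesis by simp
qed

abbreviation "weyl m \<equiv> gcarrier (weyl_module m)"

lemma weyl_iff: "\<phi> \<in> weyl m \<longleftrightarrow>
    (\<forall>u\<in>ind m. \<forall>v\<in>ind m. \<phi> (u + v) = \<phi> u + \<phi> v) \<and>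
    (\<forall>c. \<forall>v\<in>ind m. \<phi> (fscale c v) = c * \<phi> v) \<and> (\<forall>v. v \<notin> ind m \<longrightarrow> \<phi> v = 0)"
  by (simp add: weyl_module_def dual_module_def)

lemma weyl_act:
  "gact (weyl_module m) g \<phi> v = (if v \<in> ind m then \<phi> (\<lambda>x. v (g * x)) else 0)"
proof -
  have "inverse (inverse g) = g"
    using sl2_inverse[of g] sl2_inverse[of "inverse g"] by (metis mult.assoc mult_1_left mult_1_right)
  then show ?thesis by (simp add: weyl_module_def dual_module_def ind_act)
qed

lemma weyl_outside: "\<phi> \<in> weyl m \<Longrightarrow> v \<notin> ind m \<Longrightarrow> \<phi> v = 0"
  by (simp add: weyl_iff)

lemma weyl_sum:
  fixes \<phi> :: "('k::alg_closed_field sl2 \<Rightarrow> 'k) \<Rightarrow> 'k"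
  assumes \<phi>: "\<phi> \<in> weyl m" and u: "\<And>a. a \<in> A \<Longrightarrow> u a \<in> ind m"
  shows "\<phi> (\<Sum>a\<in>A. fscale (c a) (u a)) = (\<Sum>a\<in>A. c a * \<phi> (u a))"
proof -
  have "lin_on (ind m) (\<lambda>v (_::unit). \<phi> v)"
    using \<phi> by (auto simp: lin_on_def weyl_iff fscale_def)
  from lin_on_sum_scale[OF ind_sub this, of A u c] u
  have "(\<lambda>_::unit. \<phi> (\<Sum>a\<in>A. fscale (c a) (u a))) = (\<Sum>a\<in>A. fscale (c a) (\<lambda>_. \<phi> (u a)))" by simp
  from fun_cong[OF this, of "()"] show ?thesis by (simp add: sum_fun_apply fscale_def)
qed

lemma weyl_expand:
  fixes \<phi> :: "('k::alg_closed_field sl2 \<Rightarrow> 'k) \<Rightarrow> 'k"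
  assumes \<phi>: "\<phi> \<in> weyl m" and v: "v \<in> ind m"
  shows "\<phi> v = (\<Sum>i\<le>m. cf v i * \<phi> (bas m i))"
proof -
  have "v = (\<Sum>i\<le>m. fscale (cf v i) (bas m i))"
    using ind_expand[OF v] by (auto simp: fun_eq_iff sum_fun_apply fscale_def)
  then have "\<phi> v = \<phi> (\<Sum>i\<le>m. fscale (cf v i) (bas m i))" by (rule arg_cong)
  also have "\<dots> = (\<Sum>i\<le>m. cf v i * \<phi> (bas m i))"
    by (rule weyl_sum[OF \<phi>]) (simp add: bas_ind)
  finally show ?thesis .
qed

text \<open>The index map \<open>h\<close> covers both the dual basis and functionals that read
  shifted coordinates.\<close>

lemma weylI_cf:
  fixes c :: "nat \<Rightarrow> 'k::alg_closed_field"
  shows "(\<lambda>v. if v \<in> ind m then \<Sum>i\<in>A. cf v (h i) * c i else 0) \<in> weyl m"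
  by (auto simp: weyl_iff cf_add cf_scale ind_CR sum.distrib sum_distrib_left algebra_simps
      fun_space.subspace_add[OF ind_sub] fun_space.subspace_scale[OF ind_sub])

lemma rational_weyl:
  fixes m :: nat
  shows "rational_module (weyl_module m :: ('k::alg_closed_field, 'k sl2 \<Rightarrow> 'k) gmodule)"
proof (rule rational_moduleI)
  let ?V = "weyl_module m :: ('k, 'k sl2 \<Rightarrow> 'k) gmodule"
  show sub: "fun_space.subspace (weyl m :: (('k sl2 \<Rightarrow> 'k) \<Rightarrow> 'k) set)"
    by (auto simp: fun_space.subspace_def weyl_iff fscale_def algebra_simps)
  show "lin_on (weyl m) (gact ?V g)" for g
    by (auto simp: lin_on_def fun_eq_iff weyl_act fscale_def)
  fix \<phi> :: "('k sl2 \<Rightarrow> 'k) \<Rightarrow> 'k" assume \<phi>: "\<phi> \<in> weyl m"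
  show "gact ?V 1 \<phi> = \<phi>"
    by (auto simp: fun_eq_iff weyl_act weyl_outside[OF \<phi>])
  show "gact ?V (g * h) \<phi> = gact ?V g (gact ?V h \<phi>)" for g h
    by (auto simp: fun_eq_iff weyl_act ind_translate mult.assoc)
  \<comment> \<open>The dual basis, written with a singleton sum and a factor 1 to fit
    \<open>weylI_cf\<close>.\<close>
  define w where "w i = (\<lambda>v :: 'k sl2 \<Rightarrow> 'k. if v \<in> ind m then \<Sum>j\<in>{i}. cf v j * 1 else 0)" for i
  define f where "f i g = \<phi> (\<lambda>x. bas m i (g * x))" for i g
  have w: "w i \<in> weyl m" for i unfolding w_def by (rule weylI_cf)
  have f: "f i \<in> CR" if "i \<le> m" for i
  proof -
    have eq: "f i g = (\<Sum>l\<le>m. \<phi> (bas m l) * cf (\<lambda>x. bas m i (g * x)) l)" for g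
      unfolding f_def weyl_expand[OF \<phi> ind_translate[OF bas_ind[OF that]]] by (simp only: mult.commute)
    have 1: "(\<lambda>g. \<phi> (bas m l) * cf (\<lambda>x. bas m i (g * x)) l) \<in> CR" for l
      using CR_scale[OF cf_translate_CR[OF ind_CR[OF bas_ind[OF that]]]] .
    show ?thesis
      using CR_sum[of "{..m}" "\<lambda>l g. \<phi> (bas m l) * cf (\<lambda>x. bas m i (g * x)) l"] 1
      unfolding eq[symmetric] by simp
  qed
  show "orb ?V \<phi> \<in> Om (weyl m)"
  proof (rule Om_sum_formI[OF sub, where n = "Suc m" and w = w and f = f])
    show "\<forall>i<Suc m. w i \<in> weyl m \<and> f i \<in> CR" using w f by simp
    fix g
    show "(\<lambda>c. orb ?V \<phi> (g, c)) = (\<Sum>i<Suc m. fscale (f i g) (w i))"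
    proof
      fix v
      show "orb ?V \<phi> (g, v) = (\<Sum>i<Suc m. fscale (f i g) (w i)) v"
      proof (cases "v \<in> ind m")
        case True
        have "(\<lambda>x. v (g * x)) = (\<Sum>i\<le>m. fscale (cf v i) (\<lambda>x. bas m i (g * x)))"
          using ind_expand[OF True] by (auto simp: fun_eq_iff sum_fun_apply fscale_def)
        then have "\<phi> (\<lambda>x. v (g * x)) = \<phi> (\<Sum>i\<le>m. fscale (cf v i) (\<lambda>x. bas m i (g * x)))"
          by (rule arg_cong)
        also have "\<dots> = (\<Sum>i\<le>m. cf v i * f i g)"
          unfolding f_def by (rule weyl_sum[OF \<phi>]) (simp add: bas_ind ind_translate)
        finally show ?thesis
          using True by (simp only: orb_apply weyl_act sum_fun_apply fscale_def w_def lessThan_Suc_atMost)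
            (simp add: mult.commute)
      next
        case False
        then show ?thesis by (simp add: weyl_act sum_fun_apply fscale_def w_def)
      qed
    qed
  qed
qed

lemma weyl_encode:
  fixes m :: nat
  obtains \<kappa> :: "(('k::alg_closed_field sl2 \<Rightarrow> 'k) \<Rightarrow> 'k) \<Rightarrow> (nat \<Rightarrow> 'k)"
  where "\<And>V. lin_on V \<kappa>" "inj_on \<kappa> (weyl m)"
proof -
  define \<kappa> :: "(('k sl2 \<Rightarrow> 'k) \<Rightarrow> 'k) \<Rightarrow> (nat \<Rightarrow> 'k)" where "\<kappa> \<phi> = (\<lambda>i. \<phi> (bas m i))" for \<phi>
  have lin: "lin_on V \<kappa>" for V by (auto simp: lin_on_def \<kappa>_def fscale_def fun_eq_iff)
  have "inj_on \<kappa> (weyl m)"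
  proof (rule inj_onI)
    fix \<phi> \<psi> assume *: "\<phi> \<in> weyl m" "\<psi> \<in> weyl m" "\<kappa> \<phi> = \<kappa> \<psi>"
    then have "\<phi> (bas m i) = \<psi> (bas m i)" for i by (simp add: \<kappa>_def fun_eq_iff)
    then have "\<phi> v = \<psi> v" for v
      using weyl_expand[OF *(1), of v] weyl_expand[OF *(2), of v] weyl_outside[OF *(1), of v] weyl_outside[OF *(2), of v]
      by (cases "v \<in> ind m") auto
    then show "\<phi> = \<psi>" by auto
  qed
  then show ?thesis using that lin by blast
qed

text \<open>
  Multiplication by the matrix entry \<open>b\<close> embeds \<open>ind m\<close> into \<open>ind (m + 1)\<close> equivariantly for the
  lower unipotent group, with cokernel spanned by \<open>d\<^bsup>m+1\<^esup>\<close>; this is the dual map.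
\<close>

definition weyl_down :: "nat \<Rightarrow> (('k::field sl2 \<Rightarrow> 'k) \<Rightarrow> 'k) \<Rightarrow> (('k sl2 \<Rightarrow> 'k) \<Rightarrow> 'k)" where
  "weyl_down m \<psi> = (\<lambda>v. if v \<in> ind m then \<psi> (\<lambda>g. ent 1 2 g * v g) else 0)"

lemma mult_b_ind:
  assumes v: "v \<in> ind m"
  shows "(\<lambda>g. ent 1 2 g * v g) \<in> ind (Suc m)"
  unfolding ind_iff
proof (intro conjI allI impI)
  show "(\<lambda>g. ent 1 2 g * v g) \<in> CR" by (intro coordinate_ring.mult CR_ent ind_CR[OF v])
  fix g b :: "'a sl2" assume b: "ent 1 2 b = 0"
  then have "ent 1 1 b * ent 2 2 b = 1" using ent_det[of b] by simp
  then have "ent 2 2 b = inverse (ent 1 1 b)" by (metis inverse_unique)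
  then show "ent 1 2 (g * b) * v (g * b) = inverse (ent 1 1 b ^ Suc m) * (ent 1 2 g * v g)"
    using v b by (simp add: ind_iff ent_mult mult_ac)
qed

lemma bas_Suc: "bas (Suc m) (Suc i) = (\<lambda>g. ent 1 2 g * bas m i g)"
  by (auto simp: bas_def fun_eq_iff)

lemma weyl_down_bmodule_hom:
  fixes m :: nat
  defines "V \<equiv> \<lambda>m. weyl_module m :: ('k::alg_closed_field, 'k sl2 \<Rightarrow> 'k) gmodule"
  shows "bmodule_hom (gcarrier (V (Suc m))) (MU (V (Suc m))) (MH (V (Suc m)))
    (gcarrier (V m)) (MU (V m)) (MH (V m)) (weyl_down m) 1"
proof -
  interpret Y: bmodule "weyl (Suc m)" "MU (V (Suc m))" "MH (V (Suc m))"
    unfolding V_def by (rule rational_bmodule[OF rational_weyl])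
  interpret Z: bmodule "weyl m" "MU (V m)" "MH (V m)"
    unfolding V_def by (rule rational_bmodule[OF rational_weyl])
  have "bmodule_hom (weyl (Suc m)) (MU (V (Suc m))) (MH (V (Suc m))) (weyl m) (MU (V m)) (MH (V m)) (weyl_down m) 1"
  proof
    fix \<psi> :: "('k sl2 \<Rightarrow> 'k) \<Rightarrow> 'k" assume \<psi>: "\<psi> \<in> weyl (Suc m)"
    have add: "(\<lambda>g. ent 1 2 g * (u + v) g) = (\<lambda>g. ent 1 2 g * u g) + (\<lambda>g. ent 1 2 g * v g)" for u v :: "'k sl2 \<Rightarrow> 'k"
      by (auto simp: fun_eq_iff algebra_simps)
    have scale: "(\<lambda>g. ent 1 2 g * fscale c v g) = fscale c (\<lambda>g. ent 1 2 g * v g)" for c and v :: "'k sl2 \<Rightarrow> 'k"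
      by (auto simp: fun_eq_iff fscale_def)
    show "weyl_down m \<psi> \<in> weyl m"
      unfolding weyl_iff
    proof (intro conjI ballI allI impI)
      fix u v :: "'k sl2 \<Rightarrow> 'k" and c assume uv: "u \<in> ind m"
      show "weyl_down m \<psi> (fscale c u) = c * weyl_down m \<psi> u"
        using uv mult_b_ind[OF uv] \<psi> fun_space.subspace_scale[OF ind_sub uv]
        by (simp add: weyl_down_def scale weyl_iff)
      show "weyl_down m \<psi> (u + v) = weyl_down m \<psi> u + weyl_down m \<psi> v" if "v \<in> ind m"
        using uv that mult_b_ind[OF uv] mult_b_ind[OF that] \<psi> fun_space.subspace_add[OF ind_sub uv that]
        unfolding weyl_down_def add by (simp add: weyl_iff)
    qed (simp add: weyl_down_def)
    show "weyl_down m (gact (V (Suc m)) (lo t) \<psi>) = gact (V m) (lo t) (weyl_down m \<psi>)" for t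
    proof
      fix v :: "'k sl2 \<Rightarrow> 'k"
      show "weyl_down m (gact (V (Suc m)) (lo t) \<psi>) v = gact (V m) (lo t) (weyl_down m \<psi>) v"
        using mult_b_ind[of v m] ind_translate[of v m "lo t"]
        by (auto simp: weyl_down_def V_def weyl_act ent_mult)
    qed
    show "weyl_down m (gact (V (Suc m)) (tor s) \<psi>) = fscale (s ^ 1) (gact (V m) (tor s) (weyl_down m \<psi>))"
      if s: "s \<noteq> 0" for s
    proof
      fix v :: "'k sl2 \<Rightarrow> 'k"
      have eq: "(\<lambda>x. ent 1 2 (tor s * x) * v (tor s * x)) = fscale s (\<lambda>x. ent 1 2 x * v (tor s * x))"
        using s by (auto simp: fun_eq_iff fscale_def ent_mult)
      have "\<psi> (fscale s (\<lambda>x. ent 1 2 x * v (tor s * x))) = s * \<psi> (\<lambda>x. ent 1 2 x * v (tor s * x))" if "v \<in> ind m"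
        using \<psi> mult_b_ind[OF ind_translate[OF that, of "tor s"]] by (simp add: weyl_iff)
      then show "weyl_down m (gact (V (Suc m)) (tor s) \<psi>) v = fscale (s ^ 1) (gact (V m) (tor s) (weyl_down m \<psi>)) v"
        using mult_b_ind[of v m] ind_translate[of v m "tor s"] eq
        by (auto simp: weyl_down_def V_def weyl_act fscale_def)
    qed
  next
    show "lin_on (weyl (Suc m)) (weyl_down m)"
      by (auto simp: lin_on_def weyl_down_def fun_eq_iff fscale_def)
  qed
  then show ?thesis by (simp add: V_def)
qed

text \<open>Multiplication by b raises basis indices by one, so the functional that reads shifted
  coordinates and vanishes on d^(m+1) is a preimage.\<close>

lemma weyl_down_surj:
  fixes \<eta> :: "('k::alg_closed_field sl2 \<Rightarrow> 'k) \<Rightarrow> 'k"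
  assumes \<eta>: "\<eta> \<in> weyl m"
  shows "\<eta> \<in> weyl_down m ` weyl (Suc m)"
proof -
  define \<psi> where "\<psi> = (\<lambda>v :: 'k sl2 \<Rightarrow> 'k. if v \<in> ind (Suc m) then \<Sum>i\<in>{..m}. cf v (Suc i) * \<eta> (bas m i) else 0)"
  have "\<psi> \<in> weyl (Suc m)" unfolding \<psi>_def by (rule weylI_cf)
  moreover have "weyl_down m \<psi> = \<eta>"
  proof
    fix v
    show "weyl_down m \<psi> v = \<eta> v"
      using weyl_expand[OF \<eta>, of v] weyl_outside[OF \<eta>, of v] mult_b_ind[of v m]
      by (auto simp: weyl_down_def \<psi>_def cf_mult_b ind_CR)
  qed
  ultimately show ?thesis by blast
qed

lemma weyl_down_kernel:
  fixes \<psi> :: "('k::alg_closed_field sl2 \<Rightarrow> 'k) \<Rightarrow> 'k"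
  assumes \<psi>: "\<psi> \<in> weyl (Suc m)" "weyl_down m \<psi> = 0" and z: "\<psi> (bas (Suc m) 0) = 0"
  shows "\<psi> = 0"
proof
  fix v
  have "\<psi> (bas (Suc m) (Suc i)) = 0" if "i \<le> m" for i
    using fun_cong[OF \<psi>(2), of "bas m i"] bas_ind[OF that, where 'a = 'k] by (simp add: weyl_down_def bas_Suc)
  then have "\<psi> (bas (Suc m) i) = 0" if "i \<le> Suc m" for i
    using z that by (cases i) auto
  then show "\<psi> v = 0 v"
    using weyl_expand[OF \<psi>(1), of v] weyl_outside[OF \<psi>(1), of v] by (cases "v \<in> ind (Suc m)") auto
qed

text \<open>A functional in the kernel is determined by its value on d^(m+1), which tor(s) scales by
  s^(-(m+1)).\<close>

lemma weyl_down_kernel_weight: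
  fixes \<psi> :: "('k::alg_closed_field sl2 \<Rightarrow> 'k) \<Rightarrow> 'k"
  assumes \<psi>: "\<psi> \<in> wsp (weyl (Suc m)) (MH (weyl_module (Suc m))) w" "weyl_down m \<psi> = 0" "\<psi> \<noteq> 0"
  shows "w = - int (Suc m)"
proof (rule ccontr)
  assume ne: "w \<noteq> - int (Suc m)"
  have V: "\<psi> \<in> weyl (Suc m)" using \<psi>(1) by (simp add: wsp_def)
  let ?b = "bas (Suc m) 0 :: 'k sl2 \<Rightarrow> 'k"
  have b: "?b \<in> ind (Suc m)" by (rule bas_ind) simp
  have eq: "s powi (- int (Suc m)) * \<psi> ?b = s powi w * \<psi> ?b" if s: "s \<noteq> 0" for s
  proof -
    have "(\<lambda>x. ?b (tor s * x)) = fscale (s powi (- int (Suc m))) ?b"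
      using s by (auto simp: fun_eq_iff bas_def fscale_def ent_mult power_mult_distrib power_int_minus
          power_inverse simp del: power_Suc of_nat_Suc)
    then have "gact (weyl_module (Suc m)) (tor s) \<psi> ?b = s powi (- int (Suc m)) * \<psi> ?b"
      using V b by (simp add: weyl_act weyl_iff del: of_nat_Suc)
    moreover have "gact (weyl_module (Suc m)) (tor s) \<psi> ?b = s powi w * \<psi> ?b"
      using \<psi>(1) s by (simp add: wsp_def fscale_def)
    ultimately show ?thesis by metis
  qed
  \<comment> \<open>The two weights would give a Laurent polynomial with coefficients plus and minus
    that value, vanishing for all nonzero s.\<close>
  define a where "a i = (\<lambda>_::unit. if i = w then \<psi> ?b else - \<psi> ?b)" for i
  have "a w = 0"
  proof (rule laurent_zero[where A = "{w, - int (Suc m)}" and a = a])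
    show "(\<Sum>i\<in>{w, - int (Suc m)}. fscale (s powi i) (a i)) = 0" if "s \<noteq> 0" for s
      using eq[OF that] ne by (auto simp: fun_eq_iff fscale_def a_def simp del: of_nat_Suc)
  qed auto
  then have "\<psi> ?b = 0" by (simp add: a_def fun_eq_iff)
  then show False using weyl_down_kernel[OF V \<psi>(2)] \<psi>(3) by blast
qed

section \<open>Counting cells\<close>

lemma cell_decomp:
  fixes e :: "nat \<Rightarrow> nat"
  obtains h t where "e = case_nat h t"
proof
  show "e = case_nat (e 0) (\<lambda>i. e (Suc i))" by (rule ext) (simp split: nat.split)
qed

lemma supp_case_nat: "{i. case_nat h t i \<noteq> 0} = (if h = 0 then {} else {0}) \<union> Suc ` {i. t i \<noteq> (0::nat)}"
proof (rule set_eqI)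
  fix i show "i \<in> {i. case_nat h t i \<noteq> 0} \<longleftrightarrow> i \<in> (if h = 0 then {} else {0}) \<union> Suc ` {i. t i \<noteq> (0::nat)}"
    by (cases i) auto
qed

lemma finite_supp_case_nat: "finite {i. case_nat h t i \<noteq> 0} \<longleftrightarrow> finite {i. t i \<noteq> (0::nat)}"
  unfolding supp_case_nat by (auto dest: finite_imageD)

lemma deg_case_nat:
  assumes "finite {i. t i \<noteq> 0}"
  shows "deg (case_nat h t) = h + deg t"
proof -
  have "deg (case_nat h t) = (\<Sum>i\<in>insert 0 (Suc ` {i. t i \<noteq> 0}). case_nat h t i)"
    by (rule deg_superset) (use assms in \<open>auto simp: supp_case_nat simp del: neq0_conv\<close>)
  then show ?thesis using assms by (simp add: sum.reindex deg_def)
qed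

text \<open>Shifting indices multiplies weights by p, and y_0 already has weight p; the lowest digit
  is thus governed by x_0 alone.\<close>

lemma wt_case_nat:
  assumes "finite {i. t i \<noteq> 0}"
  shows "wt p (case_nat h t) = int (h mod 2) + int p * (int (h div 2) + wt p t)"
proof -
  have "wt p (case_nat h t) = (\<Sum>i\<in>insert 0 (Suc ` {i. t i \<noteq> 0}). cell_wt p i (case_nat h t i))"
    by (rule wt_superset) (use assms in \<open>auto simp: supp_case_nat simp del: neq0_conv\<close>)
  then show ?thesis using assms
    by (simp add: sum.reindex wt_def cell_wt_def sum_distrib_left algebra_simps)
qed

lemma deg_eq_0:
  assumes "finite {i. e i \<noteq> 0}" "deg e = 0"
  shows "e = (\<lambda>_. 0)"
  using assms by (auto simp: deg_def)

lemma wt_nonneg: "wt p e \<ge> 0"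
  by (auto simp: wt_def cell_wt_def intro!: sum_nonneg)

lemma wt_eq_0:
  assumes "p > 0" "finite {i. e i \<noteq> 0}" "wt p e = 0"
  shows "e = (\<lambda>_. 0)"
proof
  fix i
  have "\<forall>i\<in>{i. e i \<noteq> 0}. cell_wt p i (e i) = 0"
    using assms(3) unfolding wt_def by (subst sum_nonneg_eq_0_iff[symmetric]) (use assms(2) in \<open>auto simp: cell_wt_def simp del: neq0_conv\<close>)
  moreover have "cell_wt p i h \<noteq> 0" if "h \<noteq> 0" for h
  proof -
    have "cell_wt p i h = int (p ^ i * (h mod 2) + p ^ Suc i * (h div 2))"
      by (simp add: cell_wt_def)
    moreover have "p ^ i * (h mod 2) + p ^ Suc i * (h div 2) \<noteq> 0"
      using that assms(1) by (cases "h mod 2 = 0") (auto elim!: dvdE)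
    ultimately show ?thesis by (metis of_nat_eq_0_iff)
  qed
  ultimately show "e i = 0" by blast
qed

text \<open>
  Monomials with one further polynomial generator of degree 2 and weight 1: dividing the weight by
  \<open>p\<close> turns the polynomial generator split off with the lowest digit into such a generator.
\<close>

definition cells2 :: "nat \<Rightarrow> nat \<Rightarrow> nat \<Rightarrow> (nat \<times> (nat \<Rightarrow> nat)) set" where
  "cells2 p D N = {(a, e). finite {i. e i \<noteq> 0} \<and> 2 * a + deg e = D \<and> int a + wt p e = int N}"

lemma cells2_0: "cells2 p 0 N \<subseteq> {(0, \<lambda>_. 0)}"
  using deg_eq_0 by (auto simp: cells2_def)

lemma cells2_0_pos: "N > 0 \<Longrightarrow> cells2 p 0 N = {}"
  using cells2_0[of p N] by (auto simp: cells2_def wt_def)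

lemma cells2_weight_0: "p > 0 \<Longrightarrow> D > 0 \<Longrightarrow> cells2 p D 0 = {}"
proof -
  assume p: "p > 0" and D: "D > 0"
  have False if "(a, e) \<in> cells2 p D 0" for a e
  proof -
    have e: "finite {i. e i \<noteq> 0}" "int a + wt p e = 0" "2 * a + deg e = D" using that by (auto simp: cells2_def)
    then have "a = 0" "wt p e = 0" using wt_nonneg[of p e] by linarith+
    then show False using wt_eq_0[OF p e(1)] e(3) D by (simp add: deg_def)
  qed
  then show ?thesis by auto
qed

lemma fin_card_image_le:
  assumes "finite B" "card B \<le> b" "A \<subseteq> f ` B"
  shows "finite A \<and> card A \<le> b"
  using assms surj_card_le[of B A f] finite_subset[OF assms(3)] by (meson finite_imageI le_trans)

text \<open>Induction on the weight. The lowest digit r of N equals a, or a + 1 if x_0 occurs;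
  dividing by p leaves pairs of degree D - 2r or D + 1 - 2r respectively, with y_0 as the new extra
  generator. For r \<ge> 1 these are consecutive degrees, and their Fibonacci bounds add up.\<close>

lemma cells2_bound:
  assumes p: "p \<ge> 3" and D: "D \<le> 2 * p - 2"
  shows "finite (cells2 p D N) \<and> card (cells2 p D N) \<le> (if D = 0 then 1 else fib D)"
  using D
proof (induction N arbitrary: D rule: less_induct)
  case (less N)
  consider "D = 0" | "D > 0" "N = 0" | "D > 0" "N > 0" by force
  then show ?case
  proof cases
    case 1
    then show ?thesis using cells2_0[of p N] finite_subset[OF cells2_0[of p N]] card_mono[OF _ cells2_0[of p N]] by simp
  next
    case 2
    then show ?thesis using cells2_weight_0[of p D] p by simp
  next
    case 3
    define r where "r = N mod p"
    define N' where "N' = N div p"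
    have N: "N = r + p * N'" by (simp add: r_def N'_def)
    have N': "N' < N" using 3 p by (simp add: N'_def)
    have r: "r < p" using p by (simp add: r_def)
    let ?f = "\<lambda>(a, t). (r, case_nat (2 * a) t)"
    let ?g = "\<lambda>(a, t). (r - 1, case_nat (Suc (2 * a)) t)"
    define A where "A = {x \<in> cells2 p D N. even (snd x 0)}"
    define B where "B = {x \<in> cells2 p D N. odd (snd x 0)}"
    have AB: "cells2 p D N = A \<union> B" by (auto simp: A_def B_def)
    have key: "\<exists>t a'. e = case_nat (h mod 2 + 2 * a') t \<and> a + h mod 2 = r \<and> 2 * a + h mod 2 + 2 * a' + deg t = D \<and>
        finite {i. t i \<noteq> 0} \<and> int a' + wt p t = int N'"
      if "(a, e) \<in> cells2 p D N" and h: "h = e 0" for a e h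
    proof -
      obtain h' t where e: "e = case_nat h' t" by (rule cell_decomp)
      then have [simp]: "h' = h" using h by simp
      have t: "finite {i. t i \<noteq> 0}" using that(1) unfolding e by (simp add: cells2_def finite_supp_case_nat del: neq0_conv)
      have deg: "2 * a + h mod 2 + 2 * (h div 2) + deg t = D"
        using that(1) unfolding e by (simp add: cells2_def deg_case_nat[OF t])
      have "int a + int (h mod 2) + int p * (int (h div 2) + wt p t) = int N"
        using that(1) unfolding e by (simp add: cells2_def wt_case_nat[OF t])
      moreover obtain w where w: "wt p t = int w" using wt_nonneg[of p t] nonneg_int_cases by blast
      ultimately have "int (a + h mod 2 + p * (h div 2 + w)) = int N" by simp
      then have Neq: "a + h mod 2 + p * (h div 2 + w) = N" by (simp only: of_nat_eq_iff)
      \<comment> \<open>No carry: 2a + h mod 2 \<le> D \<le> 2p - 2 forces a + h mod 2 < p.\<close>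
      have lt: "a + h mod 2 < p" using deg less.prems p by (cases "h mod 2 = 0") auto
      have "N mod p = a + h mod 2" "N div p = h div 2 + w"
        using lt by (simp_all flip: Neq)
      moreover have "h = h mod 2 + 2 * (h div 2)" by simp
      ultimately show ?thesis using deg t w unfolding e \<open>h' = h\<close> r_def N'_def
        by (intro exI[of _ t] exI[of _ "h div 2"]) simp
    qed
    have A: "\<exists>x\<in>cells2 p (D - 2 * r) N'. y = ?f x" "2 * r \<le> D" if "y \<in> A" for y
    proof -
      obtain a e where y: "y = (a, e)" by (cases y)
      then have "(a, e) \<in> cells2 p D N" "e 0 mod 2 = 0" using that by (auto simp: A_def)
      from key[OF this(1) refl] this(2) obtain t a' where *: "e = case_nat (2 * a') t" "a = r"
        "2 * a + 2 * a' + deg t = D" "finite {i. t i \<noteq> 0}" "int a' + wt p t = int N'" by auto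
      then have "(a', t) \<in> cells2 p (D - 2 * r) N'" by (auto simp: cells2_def)
      moreover have "y = ?f (a', t)" using * y by simp
      ultimately show "\<exists>x\<in>cells2 p (D - 2 * r) N'. y = ?f x" by blast
      show "2 * r \<le> D" using * by simp
    qed
    have B: "\<exists>x\<in>cells2 p (D + 1 - 2 * r) N'. y = ?g x" "2 * r \<le> D + 1" "r \<ge> 1" if "y \<in> B" for y
    proof -
      obtain a e where y: "y = (a, e)" by (cases y)
      then have "(a, e) \<in> cells2 p D N" "e 0 mod 2 = 1" using that by (auto simp: B_def odd_iff_mod_2_eq_one)
      from key[OF this(1) refl] this(2) obtain t a' where *: "e = case_nat (1 + 2 * a') t" "a + 1 = r"
        "2 * a + 1 + 2 * a' + deg t = D" "finite {i. t i \<noteq> 0}" "int a' + wt p t = int N'" by auto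
      then have "(a', t) \<in> cells2 p (D + 1 - 2 * r) N'" by (auto simp: cells2_def)
      moreover have "y = ?g (a', t)" using * y by auto
      ultimately show "\<exists>x\<in>cells2 p (D + 1 - 2 * r) N'. y = ?g x" by blast
      show "2 * r \<le> D + 1" "r \<ge> 1" using * by auto
    qed
    have IH: "finite (cells2 p E N') \<and> card (cells2 p E N') \<le> (if E = 0 then 1 else fib E)" if "E \<le> D" for E
      using less.IH[OF N', of E] that less.prems by simp
    have fA: "finite A \<and> card A \<le> card (cells2 p (D - 2 * r) N')"
      by (rule fin_card_image_le[where f = ?f and B = "cells2 p (D - 2 * r) N'"])
        (use A(1) IH[of "D - 2 * r"] in auto)
    show ?thesis
    proof (cases "r = 0")
      case True
      then have "B = {}" using B(3) by fastforce
      then show ?thesis using AB fA IH[of D] True 3 by simp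
    next
      case False
      have le: "D + 1 - 2 * r \<le> D" using False by simp
      have fB: "finite B \<and> card B \<le> card (cells2 p (D + 1 - 2 * r) N')"
        by (rule fin_card_image_le[where f = ?g and B = "cells2 p (D + 1 - 2 * r) N'"])
          (use B(1) IH[OF le] in auto)
      have "card A + card B \<le> fib D"
      proof (cases "2 * r \<le> D + 1")
        case True
        \<comment> \<open>The two remaining degrees are \<open>E\<close> and \<open>E - 1\<close>,
          so the sum is bounded by fib(E + 1), and E + 1 \<le> D because r \<ge> 1.\<close>
        define E where "E = D + 1 - 2 * r"
        have mono: "fib (Suc E) \<le> fib D" using True False by (intro fib_mono) (simp add: E_def)
        consider "E = 0" | "E = 1" | "E \<ge> 2" by linarith
        then have "card A + card B \<le> fib (Suc E)"
        proof cases
          case 1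
          then have "A = {}" using A(2) True unfolding E_def by fastforce
          then show ?thesis using fB IH[OF le] 1 by (simp add: E_def)
        next
          \<comment> \<open>Here fib 2 = 1, yet each part could have one element. They exclude each
            other: degree 0 needs N' = 0, degree 1 needs N' > 0.\<close>
          case 2
          then have "D - 2 * r = 0" by (simp add: E_def)
          then show ?thesis
            using fA fB[folded E_def] IH[OF le, folded E_def] IH[of 0] 2 cells2_0_pos[of N' p] cells2_weight_0[of p 1] p
            by (cases "N' = 0") simp_all
        next
          case 3
          have "D - 2 * r = E - 1" using 3 by (simp add: E_def)
          then have "card A + card B \<le> fib (E - 1) + fib E"
            using fA fB IH[OF le] IH[of "E - 1"] le 3 unfolding E_def[symmetric] by fastforce
          also have "\<dots> = fib (Suc E)" using 3 fib_plus_2[of "E - 1"] by (cases E) (auto simp: numeral_2_eq_2)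
          finally show ?thesis .
        qed
        with mono show ?thesis by simp
      next
        case False
        then have "A = {}" "B = {}" using A(2) B(2) by fastforce+
        then show ?thesis by simp
      qed
      then show ?thesis unfolding AB using fA fB 3 card_Un_le[of A B] by simp
    qed
  qed
qed

definition cells :: "nat \<Rightarrow> nat \<Rightarrow> int \<Rightarrow> (nat \<Rightarrow> nat) set" where
  "cells p D N = {e. finite {i. e i \<noteq> 0} \<and> deg e = D \<and> wt p e = N}"

text \<open>As p \<ge> 3, the exponent of x_0 is the lowest digit of the weight. Dividing by p turns
  y_0 into the extra generator of \<open>cells2\<close>, in degree D minus that digit.\<close>

lemma cells_bound:
  assumes p: "p \<ge> 3" and D: "D \<le> 2 * p - 2" "D > 0"
  shows "finite (cells p D N) \<and> card (cells p D N) \<le> fib D"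
proof (cases "N \<ge> 0")
  case False
  then have "cells p D N = {}" using wt_nonneg by (auto simp: cells_def)
  then show ?thesis by simp
next
  case True
  then obtain M where M: "N = int M" using nonneg_int_cases by blast
  let ?r = "M mod p"
  have sub: "cells p D N \<subseteq> (\<lambda>(a, t). case_nat (?r + 2 * a) t) ` cells2 p (D - ?r) (M div p)"
  proof
    fix e assume e: "e \<in> cells p D N"
    obtain h t where eq: "e = case_nat h t" by (rule cell_decomp)
    have t: "finite {i. t i \<noteq> 0}" using e eq by (simp add: cells_def finite_supp_case_nat del: neq0_conv)
    have deg: "h + deg t = D" using e eq by (simp add: cells_def deg_case_nat[OF t])
    have "int (h mod 2) + int p * (int (h div 2) + wt p t) = int M"
      using e eq M by (simp add: cells_def wt_case_nat[OF t])
    moreover obtain w where w: "wt p t = int w" using wt_nonneg[of p t] nonneg_int_cases by blast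
    ultimately have "int (h mod 2 + p * (h div 2 + w)) = int M" by simp
    then have Meq: "h mod 2 + p * (h div 2 + w) = M" by (simp only: of_nat_eq_iff)
    have "h mod 2 < 2" by simp
    then have "h mod 2 < p" using p by linarith
    then have *: "?r = h mod 2" "M div p = h div 2 + w" by (simp_all flip: Meq)
    have "(h div 2, t) \<in> cells2 p (D - ?r) (M div p)"
      using deg t w minus_mod_eq_mult_div[of h 2] mod_less_eq_dividend[of h 2] unfolding * cells2_def
      by auto
    moreover have "e = case_nat (?r + 2 * (h div 2)) t" unfolding * eq by simp
    ultimately show "e \<in> (\<lambda>(a, t). case_nat (?r + 2 * a) t) ` cells2 p (D - ?r) (M div p)" by force
  qed
  have "finite (cells2 p (D - ?r) (M div p)) \<and> card (cells2 p (D - ?r) (M div p)) \<le> (if D - ?r = 0 then 1 else fib (D - ?r))"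
    by (rule cells2_bound[OF p]) (use D in simp)
  moreover have "(if D - ?r = 0 then 1 else fib (D - ?r)) \<le> fib D"
    using fib_mono[of "D - ?r" D] fib_mono[of 1 D] D by auto
  ultimately show ?thesis using fin_card_image_le[OF _ _ sub] by (meson le_trans)
qed

section \<open>Dimension shifting\<close>

text \<open>Replaces the target by the image, so that the maps of the resolution become surjections
  onto the next kernels.\<close>

lemma bmodule_hom_image:
  assumes "bmodule_hom C U H C' U' H' f 0"
  shows "bmodule_hom C U H (f ` C) U' H' f 0"
proof -
  interpret bmodule_hom C U H C' U' H' f 0 by fact
  have sub: "f ` C \<subseteq> C'" using f_C by blast
  interpret I: bmodule "f ` C" U' H'
  proof
    show "fun_space.subspace (f ` C)" by (rule subspace_image[OF Y.C_sub f_lin])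
    show "lin_on (f ` C) (U' t)" for t by (rule lin_on_subset[OF Z.U_lin sub])
    show "lin_on (f ` C) (H' s)" if "s \<noteq> 0" for s by (rule lin_on_subset[OF Z.H_lin[OF that] sub])
    fix z assume "z \<in> f ` C"
    then obtain v where v: "v \<in> C" "z = f v" by blast
    obtain N w where w: "\<And>n. w n \<in> C" "\<And>n. n \<ge> N \<Longrightarrow> w n = 0" "\<And>t. U t v = (\<Sum>n<N. fscale (t ^ n) (w n))"
      using Y.U_poly[OF v(1)] by metis
    have "U' t z = (\<Sum>n<N. fscale (t ^ n) (f (w n)))" for t
      unfolding v(2) f_U[OF v(1), symmetric] w(3) by (rule lin_on_sum_scale[OF Y.C_sub f_lin w(1)])
    moreover have "\<forall>n\<ge>N. f (w n) = 0" using w(2) lin_on_0[OF Y.C_sub f_lin] by simp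
    moreover have "\<forall>n. f (w n) \<in> f ` C" using w(1) by blast
    ultimately show "\<exists>N w. (\<forall>n. w n \<in> f ` C) \<and> (\<forall>n\<ge>N. w n = 0) \<and> (\<forall>t. U' t z = (\<Sum>n<N. fscale (t ^ n) (w n)))"
      by (intro exI[of _ N] exI[of _ "\<lambda>n. f (w n)"]) blast
    obtain A a where a: "finite A" "\<And>i. i \<in> A \<Longrightarrow> a i \<in> C"
      "\<And>s. s \<noteq> 0 \<Longrightarrow> H s v = (\<Sum>i\<in>A. fscale (s powi i) (a i))"
      using Y.H_poly[OF v(1)] by metis
    have "H' s z = (\<Sum>i\<in>A. fscale (s powi i) (f (a i)))" if s: "s \<noteq> 0" for s
    proof -
      have "H' s z = f (H s v)" using f_H[OF v(1) s] v(2) by simp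
      also have "\<dots> = (\<Sum>i\<in>A. fscale (s powi i) (f (a i)))"
        unfolding a(3)[OF s] by (rule lin_on_sum_scale[OF Y.C_sub f_lin a(2)])
      finally show ?thesis .
    qed
    moreover have "\<forall>i\<in>A. f (a i) \<in> f ` C" using a(2) by blast
    ultimately show "\<exists>A a. finite A \<and> (\<forall>i\<in>A. a i \<in> f ` C) \<and> (\<forall>s. s \<noteq> 0 \<longrightarrow> H' s z = (\<Sum>i\<in>A. fscale (s powi i) (a i)))"
      using a(1) by (intro exI[of _ A] exI[of _ "\<lambda>i. f (a i)"]) blast
  qed (auto simp: f_C Z.U_0 Z.U_add Z.H_1 Z.H_mult Z.H_U)
  show ?thesis
    by standard (use f_lin f_U f_H in auto)
qed

lemma transport_inv_bmodule_hom:
  fixes M :: "('k::alg_closed_field, 'i) gmodule" and \<kappa> :: "('i \<Rightarrow> 'k) \<Rightarrow> ('j \<Rightarrow> 'k)"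
  assumes M: "rational_module M" and \<kappa>: "lin_on (gcarrier M) \<kappa>" "inj_on \<kappa> (gcarrier M)"
  shows "bmodule_hom (gcarrier (transport \<kappa> M)) (MU (transport \<kappa> M)) (MH (transport \<kappa> M))
    (gcarrier M) (MU M) (MH M) (inv_into (gcarrier M) \<kappa>) 0"
proof -
  interpret rational M by standard fact
  interpret Y: bmodule C "MU M" "MH M" by (rule rational_bmodule[OF M])
  interpret Z: bmodule "gcarrier (transport \<kappa> M)" "MU (transport \<kappa> M)" "MH (transport \<kappa> M)"
    by (rule rational_bmodule[OF rational_transport[OF \<kappa>]])
  let ?r = "inv_into C \<kappa>"
  have r: "?r (\<kappa> v) = v" if "v \<in> C" for v using \<kappa>(2) that by simp
  show ?thesis
  proof
    show "lin_on (gcarrier (transport \<kappa> M)) ?r"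
      unfolding lin_on_def transport_carrier[OF \<kappa>]
      using r fun_space.subspace_add[OF C_sub] fun_space.subspace_scale[OF C_sub]
      by (auto simp: lin_on_add[OF C_sub \<kappa>(1), symmetric] lin_on_scale[OF C_sub \<kappa>(1), symmetric])
  qed (auto simp: transport_carrier[OF \<kappa>] transport_act[OF \<kappa>] r act_C)
qed

text \<open>Weyl modules do not live on k^nat; in positive degrees they are retracts of their
  encoded copies, and degree 0 is direct.\<close>

lemma weight_1_acyclic_encoded:
  fixes M :: "('k::alg_closed_field, 'i) gmodule" and \<kappa> :: "('i \<Rightarrow> 'k) \<Rightarrow> (nat \<Rightarrow> 'k)"
  assumes p: "prime p" "CHAR('k) = p" "odd p" and M: "rational_module M"
    and \<kappa>: "lin_on (gcarrier M) \<kappa>" "inj_on \<kappa> (gcarrier M)"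
  shows "acyclic_at p (dX p (MU M)) (wsp (gcarrier M) (MH M)) n 1"
proof (cases n)
  case 0
  then show ?thesis using acyclic_0_weight_1[OF p M] by simp
next
  case (Suc l)
  interpret rational M by standard fact
  let ?T = "transport \<kappa> M"
  have h1: "xmodule_hom p (dX p (MU M)) (wsp C (MH M)) (dX p (MU ?T)) (wsp (gcarrier ?T) (MH ?T)) \<kappa> 0"
    using bmodule_hom.xmodule_hom[OF transport_bmodule_hom[OF M \<kappa>] p(1,2,3)] by simp
  have h2: "xmodule_hom p (dX p (MU ?T)) (wsp (gcarrier ?T) (MH ?T)) (dX p (MU M)) (wsp C (MH M)) (inv_into C \<kappa>) 0"
    using bmodule_hom.xmodule_hom[OF transport_inv_bmodule_hom[OF M \<kappa>] p(1,2,3)] by simp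
  show ?thesis
    unfolding Suc
  proof (rule acyclic_retract[OF h1, OF h2])
    show "inv_into C \<kappa> (\<kappa> v) = v" if "v \<in> wsp C (MH M) w" for v w
      using that \<kappa>(2) by (simp add: wsp_def)
  qed (rule weight_1_acyclic[OF p rational_transport[OF \<kappa>]])
qed

text \<open>There are b + 1 vectors in a space of dimension at most b. A repeated vector is treated
  apart, since dependence of sets does not see repetitions.\<close>

lemma supported_relation:
  fixes x :: "nat \<Rightarrow> 'i \<Rightarrow> 'k::field"
  assumes S: "finite S" "card S \<le> b" and supp: "\<And>i e. i \<le> b \<Longrightarrow> e \<notin> S \<Longrightarrow> x i e = 0"
  obtains c where "\<exists>i\<le>b. c i \<noteq> 0" "(\<Sum>i\<le>b. fscale (c i) (x i)) = 0"
proof (cases "inj_on x {..b}")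
  case False
  then obtain i j where ij: "i \<le> b" "j \<le> b" "i \<noteq> j" "x i = x j" by (auto simp: inj_on_def)
  let ?c = "\<lambda>l. if l = i then 1 else if l = j then - 1 else (0::'k)"
  have "(\<Sum>l\<le>b. fscale (?c l) (x l)) = (\<Sum>l\<in>{i, j}. fscale (?c l) (x l))"
    using ij by (intro sum.mono_neutral_right) auto
  also have "\<dots> = 0" using ij by simp
  finally have 1: "(\<Sum>l\<le>b. fscale (?c l) (x l)) = 0" .
  have 2: "\<exists>l\<le>b. ?c l \<noteq> 0" using ij(1) by (intro exI[of _ i]) simp
  show ?thesis by (rule that[OF 2 1])
next
  case True
  let ?T = "(\<lambda>s e. if e = s then 1 else (0::'k)) ` S"
  have "fun_space.dependent (x ` {..b})"
  proof (rule ccontr)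
    assume ind: "fun_space.independent (x ` {..b})"
    have "x ` {..b} \<subseteq> fun_space.span ?T"
    proof
      fix y assume "y \<in> x ` {..b}"
      then have y: "y e = 0" if "e \<notin> S" for e using supp that by auto
      have "y = (\<Sum>s\<in>S. fscale (y s) (\<lambda>e. if e = s then 1 else 0))"
        using y S(1) by (auto simp: fun_eq_iff sum_fun_apply fscale_def if_distrib cong: if_cong)
      also have "\<dots> \<in> fun_space.span ?T"
        by (intro fun_space.span_sum fun_space.span_scale fun_space.span_base) auto
      finally show "y \<in> fun_space.span ?T" .
    qed
    then have "card (x ` {..b}) \<le> card ?T"
      using fun_space.independent_span_bound[of ?T "x ` {..b}"] ind S(1) by simp
    also have "\<dots> \<le> b" using card_image_le[OF S(1)] S(2) le_trans by blast
    finally show False using card_image[OF True] by simp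
  qed
  then obtain u where u: "\<exists>v\<in>x ` {..b}. u v \<noteq> 0" "(\<Sum>v\<in>x ` {..b}. fscale (u v) v) = 0"
    using fun_space.dependent_finite[of "x ` {..b}"] by auto
  show ?thesis
    by (rule that[of "\<lambda>i. u (x i)"]) (use u sum.reindex[OF True, of "\<lambda>v. fscale (u v) v"] in auto)
qed

text \<open>The kernel is a line of one weight, so a cochain is determined by the values of its
  coefficients at d^(m+1), and these sit on the cells counted by \<open>cells_bound\<close>. A
  relation among the values makes the combination of cochains itself zero.\<close>

lemma weyl_kernel_dep:
  fixes m :: nat and f :: "(('k::alg_closed_field sl2 \<Rightarrow> 'k) \<Rightarrow> 'k) \<Rightarrow> ('j \<Rightarrow> 'k)"
  defines "V \<equiv> weyl_module (Suc m) :: ('k, 'k sl2 \<Rightarrow> 'k) gmodule"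
  assumes p: "p \<ge> 3" and D: "D \<le> 2 * p - 2" "D > 0"
    and X: "xmodule p X (\<lambda>w. {v \<in> wsp (gcarrier V) (MH V) w. f v = 0})"
    and f: "\<And>\<psi>. \<psi> \<in> gcarrier V \<Longrightarrow> f \<psi> = 0 \<Longrightarrow> weyl_down m \<psi> = 0"
  shows "dep_at p X (\<lambda>w. {v \<in> wsp (gcarrier V) (MH V) w. f v = 0}) D 1 (fib D)"
  unfolding dep_at_def
proof (intro allI impI)
  interpret xmodule p X "\<lambda>w. {v \<in> wsp (gcarrier V) (MH V) w. f v = 0}" by fact
  fix z assume z: "\<forall>i\<le>fib D. z i \<in> K D 1 \<and> \<delta> (z i) = 0"
  define b0 where "b0 = (bas (Suc m) 0 :: 'k sl2 \<Rightarrow> 'k)"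
  \<comment> \<open>From 1 - 2 wt = -(m + 1). For odd m no cell satisfies this, and the rounded
    value is harmless.\<close>
  define S where "S = cells p D (int (m + 2) div 2)"
  have zK: "z i \<in> K D 1" if "i \<le> fib D" for i using z that by blast
  have S: "finite S \<and> card S \<le> fib D" unfolding S_def by (rule cells_bound[OF p D])
  have supp: "z i e b0 = 0" if i: "i \<le> fib D" and e: "e \<notin> S" for i e
  proof (rule ccontr)
    assume "z i e b0 \<noteq> 0"
    then have nz: "z i e \<noteq> 0" by auto
    have *: "z i e \<in> wsp (gcarrier V) (MH V) (1 - 2 * wt p e)" "f (z i e) = 0"
      using K_W[OF zK[OF i], of e] by simp_all
    have "weyl_down m (z i e) = 0" by (rule f) (use * in \<open>auto simp: wsp_def\<close>)
    then have "1 - 2 * wt p e = - int (Suc m)"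
      using weyl_down_kernel_weight[OF *(1)[unfolded V_def]] nz by blast
    then have "wt p e = int (m + 2) div 2" by simp
    then show False using e K_D[OF zK[OF i] nz] by (simp add: S_def cells_def)
  qed
  obtain c where c: "\<exists>i\<le>fib D. c i \<noteq> 0" "(\<Sum>i\<le>fib D. fscale (c i) (\<lambda>e. z i e b0)) = 0"
    by (rule supported_relation[of S "fib D" "\<lambda>i e. z i e b0"]) (use S supp in auto)
  define y where "y = (\<lambda>e. \<Sum>i\<le>fib D. fscale (c i) (z i e))"
  have yK: "y \<in> K D 1" unfolding y_def by (rule K_lincomb) (use zK in auto)
  have "y e = 0" for e
  proof -
    have *: "y e \<in> gcarrier V" "f (y e) = 0" using K_W[OF yK, of e] by (simp_all add: wsp_def)
    have "y e b0 = (\<Sum>i\<le>fib D. fscale (c i) (\<lambda>e. z i e b0)) e"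
      by (simp add: y_def sum_fun_apply fscale_def)
    then have "y e b0 = 0" unfolding c(2) by simp
    then show ?thesis
      using weyl_down_kernel[OF *(1)[unfolded V_def] f[OF *]] by (simp add: b0_def)
  qed
  then have "y = \<delta> 0" by (simp add: fun_eq_iff)
  then have "y \<in> \<delta> ` K (D - 1) 1" by (rule image_eqI[OF _ K_0])
  then have "y \<in> cobounds p X (\<lambda>w. {v \<in> wsp (gcarrier V) (MH V) w. f v = 0}) D 1"
    using D(2) by (simp add: cobounds_def)
  then show "\<exists>c. (\<exists>i\<le>fib D. c i \<noteq> 0) \<and> (\<lambda>e. \<Sum>i\<le>fib D. fscale (c i) (z i e)) \<in>
      cobounds p X (\<lambda>w. {v \<in> wsp (gcarrier V) (MH V) w. f v = 0}) D 1"
    using c(1) unfolding y_def by blast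
qed

text \<open>The bound enters at the kernel of V(m + 1) -> V(m) in degree n + 1 and climbs the
  resolution, losing one degree at each surjection I q -> Z (q + 1), until it reaches invariants in
  Z n.\<close>

lemma resolution_relation:
  fixes p n m :: nat
    and \<epsilon> :: "(('k::alg_closed_field sl2 \<Rightarrow> 'k) \<Rightarrow> 'k) \<Rightarrow> (nat \<Rightarrow> 'k)"
    and I :: "nat \<Rightarrow> ('k, nat) gmodule" and z :: "nat \<Rightarrow> nat \<Rightarrow> 'k"
  assumes p: "prime p" "CHAR('k) = p" "odd p" and n: "n \<le> 2 * p - 3"
    and res: "injective_resolution (weyl_module m) \<epsilon> I d"
    and z: "\<And>i. i \<le> fib (Suc n) \<Longrightarrow> z i \<in> gcarrier (I n)" "\<And>i. i \<le> fib (Suc n) \<Longrightarrow> d n (z i) = 0"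
      "\<And>i g. i \<le> fib (Suc n) \<Longrightarrow> gact (I n) g (z i) = z i"
  shows "\<exists>c. (\<exists>i\<le>fib (Suc n). c i \<noteq> 0) \<and>
    (if n = 0 then (\<Sum>i\<le>fib (Suc n). fscale (c i) (z i)) = 0
     else \<exists>y\<in>gcarrier (I (n - 1)). (\<forall>g. gact (I (n - 1)) g y = y) \<and>
       d (n - 1) y = (\<Sum>i\<le>fib (Suc n). fscale (c i) (z i)))"
proof -
  define b where "b = fib (Suc n)"
  define WI where "WI q = wsp (gcarrier (I q)) (MH (I q))" for q
  define XI where "XI q = dX p (MU (I q))" for q
  define Z where "Z q = {v \<in> gcarrier (I q). d q v = 0}" for q
  define WZ where "WZ q w = {v \<in> WI q w. d q v = 0}" for q w
  have wZ: "wsp (Z q) (MH (I q)) = WZ q" for q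
    by (auto simp: Z_def WZ_def WI_def wsp_def fun_eq_iff)
  have inj: "injective_module (I q)" and \<epsilon>: "\<epsilon> \<in> Hom_G (weyl_module m) (I 0)" "inj_on \<epsilon> (weyl m)"
    and dH: "d q \<in> Hom_G (I q) (I (Suc q))" and \<epsilon>Z: "\<epsilon> ` weyl m = Z 0"
    and dZ: "d q ` gcarrier (I q) = Z (Suc q)" for q
    using res by (simp_all add: injective_resolution_def Z_def)
  have rat: "rational_module (I q)" for q using inj[of q] by (simp add: injective_module_def)
  have p3: "p \<ge> 3" using prime_ge_2_nat[OF p(1)] p(3) by (cases "p = 2") auto

  have d: "bmodule_hom (gcarrier (I q)) (MU (I q)) (MH (I q)) (Z (Suc q)) (MU (I (Suc q))) (MH (I (Suc q))) (d q) 0" for q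
    using bmodule_hom_image[OF Hom_G_bmodule_hom[OF rat rat dH]] unfolding dZ .
  have epi: "xmodule_epi p (XI q) (WI q) (XI (Suc q)) (WZ (Suc q)) (d q) 0" for q
    using bmodule_hom.xmodule_epi[OF d p, of q] dZ[of q] by (simp add: XI_def WI_def wZ)
  have ker: "xmodule_epi.kerW (WI q) (d q) = WZ q" for q
    by (rule ext) (simp add: xmodule_epi.kerW_def[OF epi] WZ_def)

  let ?V = "weyl_module (Suc m) :: ('k, 'k sl2 \<Rightarrow> 'k) gmodule"
  let ?f = "\<epsilon> \<circ> weyl_down m"
  have \<epsilon>h: "bmodule_hom (weyl m) (MU (weyl_module m)) (MH (weyl_module m)) (Z 0) (MU (I 0)) (MH (I 0)) \<epsilon> 0"
    using bmodule_hom_image[OF Hom_G_bmodule_hom[OF rational_weyl rat \<epsilon>(1)]] unfolding \<epsilon>Z .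
  have fsurj: "Z 0 \<subseteq> ?f ` gcarrier ?V"
    using weyl_down_surj[where 'k = 'k] unfolding \<epsilon>Z[symmetric] image_comp[symmetric] by blast
  \<comment> \<open>V(m) is replaced by its image Z 0 in I 0. The shift by 1 turns weight 1 on V(m +
    1) into weight 0.\<close>
  interpret F: xmodule_epi p "dX p (MU ?V)" "wsp (gcarrier ?V) (MH ?V)" "XI 0" "WZ 0" ?f "int 1"
    using bmodule_hom.xmodule_epi[OF bmodule_hom_comp[OF weyl_down_bmodule_hom \<epsilon>h] p fsurj]
    unfolding XI_def wZ .
  have Fker: "F.kerW = (\<lambda>w. {v \<in> wsp (gcarrier ?V) (MH ?V) w. ?f v = 0})"
    by (rule ext) (simp add: F.kerW_def)
  have fker: "weyl_down m \<psi> = 0" if \<psi>: "\<psi> \<in> gcarrier ?V" "?f \<psi> = 0" for \<psi>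
  proof -
    interpret D: bmodule_hom "gcarrier ?V" "MU ?V" "MH ?V" "weyl m" "MU (weyl_module m)" "MH (weyl_module m)" "weyl_down m" 1
      by (rule weyl_down_bmodule_hom)
    interpret E: bmodule_hom "weyl m" "MU (weyl_module m)" "MH (weyl_module m)" "Z 0" "MU (I 0)" "MH (I 0)" \<epsilon> 0
      by (rule \<epsilon>h)
    have "\<epsilon> 0 = 0" by (rule lin_on_0[OF D.Z.C_sub E.f_lin])
    then show ?thesis
      using inj_onD[OF \<epsilon>(2), of "weyl_down m \<psi>" 0] \<psi> D.f_C fun_space.subspace_0[OF D.Z.C_sub] by simp
  qed
  obtain \<kappa> :: "(('k sl2 \<Rightarrow> 'k) \<Rightarrow> 'k) \<Rightarrow> (nat \<Rightarrow> 'k)" where \<kappa>: "\<And>V. lin_on V \<kappa>" "inj_on \<kappa> (gcarrier ?V)"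
    using weyl_encode by blast
  have dep0: "dep_at p (XI 0) (WZ 0) n 0 b"
  proof -
    have "dep_at p (dX p (MU ?V)) F.kerW (Suc n) 1 b"
      unfolding Fker b_def using F.xmodule_kerW n p3
      by (intro weyl_kernel_dep fker) (auto simp: Fker)
    from F.dep_transfer[OF this weight_1_acyclic_encoded[OF p rational_weyl \<kappa>]] show ?thesis by simp
  qed
  \<comment> \<open>The condition q < n keeps the degree n - q positive, where I (q - 1) is
    acyclic.\<close>
  have dep: "dep_at p (XI q) (WZ q) (n - q) 0 b" if "q = 0 \<or> q < n" for q
    using that
  proof (induction q)
    case 0
    then show ?case using dep0 by simp
  next
    case (Suc q)
    interpret E: xmodule_epi p "XI q" "WI q" "XI (Suc q)" "WZ (Suc q)" "d q" 0 by (rule epi)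
    define l where "l = n - Suc (Suc q)"
    have l: "n - q = Suc (Suc l)" "n - Suc q = Suc l" using Suc.prems by (simp_all add: l_def)
    have "dep_at p (XI q) E.kerW (Suc (Suc l)) 0 b" using Suc l unfolding ker by simp
    from E.dep_transfer[OF this] show ?case
      using injective_acyclic[OF p inj, of q l] unfolding l XI_def WI_def by simp
  qed

  interpret N: xmodule p "XI n" "WZ n"
    using xmodule_epi.xmodule_kerW[OF epi, of n] unfolding ker .
  have zW: "z i \<in> WZ n 0" and zX: "XI n j (z i) = 0" if "i \<le> b" for i j
  proof -
    interpret In: bmodule "gcarrier (I n)" "MU (I n)" "MH (I n)" by (rule rational_bmodule[OF rat])
    show "z i \<in> WZ n 0" using z that by (simp add: WZ_def WI_def wsp_def b_def)
    show "XI n j (z i) = 0"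
      unfolding XI_def by (rule In.dX_invariant[OF p(1,2)]) (use z(3) that in \<open>simp add: b_def\<close>)
  qed
  have zK: "N.cochain0 (z i) \<in> N.K 0 0" "N.\<delta> (N.cochain0 (z i)) = 0" if "i \<le> b" for i
    by (rule N.cochain0_K[OF zW[OF that]], rule N.dl_cochain0[OF zW[OF that] zX[OF that]])
  have eval: "(\<lambda>e. \<Sum>i\<le>b. fscale (c i) (N.cochain0 (z i) e)) zero_cell = (\<Sum>i\<le>b. fscale (c i) (z i))" for c
    by (simp add: N.cochain0_def)
  show ?thesis
  proof (cases n)
    case 0
    have "\<forall>i\<le>b. N.cochain0 (z i) \<in> cochains p (WZ n) n 0 \<and> dl p (XI n) (N.cochain0 (z i)) = 0"
      using zK 0 by blast
    from dep0[folded 0, unfolded dep_at_def, THEN spec, THEN mp, OF this]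
    obtain c where c: "(\<exists>i\<le>b. c i \<noteq> 0) \<and>
      (\<lambda>e. \<Sum>i\<le>b. fscale (c i) (N.cochain0 (z i) e)) \<in> cobounds p (XI n) (WZ n) n 0"
      by (elim exE)
    from conjunct2[OF this] have "(\<lambda>e. \<Sum>i\<le>b. fscale (c i) (N.cochain0 (z i) e)) = 0" using 0 by (simp only: cobounds_def if_True simp_thms singleton_iff)
    from fun_cong[OF this, of zero_cell] have "(\<Sum>i\<le>b. fscale (c i) (z i)) = 0" unfolding eval by simp
    then show ?thesis using conjunct1[OF c] 0 by (auto simp: b_def)
  next
    case (Suc l)
    \<comment> \<open>The last step uses \<open>connecting\<close> only: in degree 0 the module I l
      may have cohomology, and its invariants are what the coboundaries of Ext are made
      from.\<close>
    interpret E: xmodule_epi p "XI l" "WI l" "XI n" "WZ n" "d l" 0 unfolding Suc by (rule epi)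
    have "dep_at p (XI l) E.kerW (Suc 0) 0 b" using dep[of l] Suc unfolding ker by simp
    from E.connecting[OF this, of "\<lambda>i. N.cochain0 (z i)"]
    have "\<exists>c. (\<exists>i\<le>b. c i \<noteq> 0) \<and> (\<exists>y\<in>E.Y.K 0 0. E.Y.\<delta> y = 0 \<and>
        (\<lambda>e. d l (y e)) = (\<lambda>e. \<Sum>i\<le>b. fscale (c i) (N.cochain0 (z i) e)))"
      using zK by simp
    then obtain c where c: "(\<exists>i\<le>b. c i \<noteq> 0) \<and> (\<exists>y\<in>E.Y.K 0 0. E.Y.\<delta> y = 0 \<and>
        (\<lambda>e. d l (y e)) = (\<lambda>e. \<Sum>i\<le>b. fscale (c i) (N.cochain0 (z i) e)))"
      by (elim exE)
    then obtain y where y: "y \<in> E.Y.K 0 0" "E.Y.\<delta> y = 0"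
      "(\<lambda>e. d l (y e)) = (\<lambda>e. \<Sum>i\<le>b. fscale (c i) (N.cochain0 (z i) e))"
      by (elim conjE bexE)
    have yW: "y zero_cell \<in> WI l 0" by (rule E.Y.K_0_W[OF y(1)])
    \<comment> \<open>A degree 0 cocycle of weight 0 is B-invariant, hence G-invariant.\<close>
    have "gact (I l) g (y zero_cell) = y zero_cell" for g
      by (rule fixed_points(1)[OF p rat yW[unfolded WI_def] E.Y.K_0_cocycle[OF y(1,2), unfolded XI_def]]) simp
    moreover have "d l (y zero_cell) = (\<Sum>i\<le>b. fscale (c i) (z i))"
      using fun_cong[OF y(3), of zero_cell] unfolding eval .
    moreover have "y zero_cell \<in> gcarrier (I l)" using yW by (simp add: WI_def wsp_def)
    ultimately show ?thesis using conjunct1[OF c] Suc unfolding b_def by auto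
  qed
qed

section \<open>Ext groups of the trivial module\<close>

text \<open>An independent set whose span meets B trivially has at most b elements by the relation
  hypothesis; a largest one is a \<open>quotient_basis\<close>. Every finite
  \<open>quotient_basis\<close> obeys the same bound, in particular the chosen one.\<close>

lemma quotient_dim_le:
  fixes Z B :: "(('j \<Rightarrow> 'k::field) \<Rightarrow> ('i \<Rightarrow> 'k)) set"
  assumes Z: "hom_space.subspace Z" and BZ: "B \<subseteq> Z"
    and rel: "\<And>z :: nat \<Rightarrow> ('j \<Rightarrow> 'k) \<Rightarrow> ('i \<Rightarrow> 'k). (\<And>i. i \<le> b \<Longrightarrow> z i \<in> Z) \<Longrightarrow>
      \<exists>c. (\<exists>i\<le>b. c i \<noteq> 0) \<and> (\<Sum>i\<le>b. hom_scale (c i) (z i)) \<in> B"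
  shows "quotient_dim Z B \<le> enat b"
proof -
  define good where "good S \<longleftrightarrow> finite S \<and> S \<subseteq> Z \<and> hom_space.independent S \<and> hom_space.span S \<inter> B \<subseteq> {0}" for S
  have card: "card S \<le> b" if S: "good S" for S
  proof (rule ccontr)
    assume "\<not> card S \<le> b"
    then obtain z :: "nat \<Rightarrow> ('j \<Rightarrow> 'k) \<Rightarrow> ('i \<Rightarrow> 'k)" where z: "z ` {..b} \<subseteq> S" "inj_on z {..b}"
      using card_le_inj[of "{..b}" S] S by (auto simp: good_def)
    obtain c where c: "\<exists>i\<le>b. c i \<noteq> 0" "(\<Sum>i\<le>b. hom_scale (c i) (z i)) \<in> B"
      using rel[of z] z(1) S by (auto simp: good_def)
    have "(\<Sum>i\<le>b. hom_scale (c i) (z i)) \<in> hom_space.span S"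
      using z(1) by (intro hom_space.span_sum hom_space.span_scale hom_space.span_base) auto
    then have 0: "(\<Sum>i\<le>b. hom_scale (c i) (z i)) = 0" using S c(2) by (auto simp: good_def)
    define u where "u v = c (inv_into {..b} z v)" for v
    have u: "u (z i) = c i" if "i \<le> b" for i using z(2) that by (simp add: u_def)
    have "(\<Sum>v\<in>z ` {..b}. hom_scale (u v) v) = 0"
      using 0 by (simp add: sum.reindex[OF z(2)] u)
    moreover have "hom_space.independent (z ` {..b})"
      using S z(1) hom_space.independent_mono by (auto simp: good_def)
    ultimately have "u v = 0" if "v \<in> z ` {..b}" for v
      using hom_space.independentD[of "z ` {..b}" "z ` {..b}" u v] that by simp
    then show False using c(1) u by force
  qed
  have "good {}" by (auto simp: good_def hom_space.independent_empty)
  then have "\<exists>S. good S \<and> (\<forall>T. good T \<longrightarrow> card T \<le> card S)"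
    using card by (intro ex_has_greatest_nat[where b = "Suc b"]) (auto simp: less_Suc_eq_le)
  then obtain S where S: "good S" and max: "\<And>T. good T \<Longrightarrow> card T \<le> card S" by blast
  \<comment> \<open>Applied to the zero family; the span has to meet B in exactly 0.\<close>
  have zero: "0 \<in> B"
  proof -
    obtain c where "(\<Sum>i\<le>b. hom_scale (c i) 0) \<in> B" using rel[of "\<lambda>_. 0"] hom_space.subspace_0[OF Z] by auto
    then show ?thesis by simp
  qed
  have "Z \<subseteq> hom_space.span (S \<union> B)"
  proof
    fix v assume v: "v \<in> Z"
    show "v \<in> hom_space.span (S \<union> B)"
    proof (rule ccontr)
      assume nv: "v \<notin> hom_space.span (S \<union> B)"
      then have nS: "v \<notin> hom_space.span S" using hom_space.span_mono[of S "S \<union> B"] by blast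
      \<comment> \<open>A nonzero coefficient of v in an element of B would put v into the span of S
        and B.\<close>
      have "hom_space.span (insert v S) \<inter> B \<subseteq> {0}"
      proof
        fix x assume x: "x \<in> hom_space.span (insert v S) \<inter> B"
        then obtain k where k: "x - hom_scale k v \<in> hom_space.span S"
          by (auto simp: hom_space.span_breakdown_eq)
        have "k = 0"
        proof (rule ccontr)
          assume "k \<noteq> 0"
          have "x - (x - hom_scale k v) \<in> hom_space.span (S \<union> B)"
          proof (rule hom_space.span_diff)
            show "x \<in> hom_space.span (S \<union> B)" using x by (intro hom_space.span_base) simp
            show "x - hom_scale k v \<in> hom_space.span (S \<union> B)"
              using k hom_space.span_mono[of S "S \<union> B"] by blast
          qed
          then have "hom_scale (inverse k) (hom_scale k v) \<in> hom_space.span (S \<union> B)"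
            using hom_space.span_scale[of "hom_scale k v" "S \<union> B" "inverse k"] by simp
          then show False using nv \<open>k \<noteq> 0\<close> by simp
        qed
        then show "x \<in> {0}" using k x S by (auto simp: good_def)
      qed
      moreover have "hom_space.independent (insert v S)"
        using S nS hom_space.independent_insertI by (auto simp: good_def)
      ultimately have "good (insert v S)" using S v by (simp add: good_def)
      moreover have "v \<notin> S" using nS hom_space.span_base by blast
      ultimately show False using max[of "insert v S"] S by (simp add: good_def)
    qed
  qed
  moreover have "hom_space.span (S \<union> B) \<subseteq> Z"
    using S BZ by (intro hom_space.span_minimal Z) (auto simp: good_def)
  ultimately have ex: "\<exists>S. finite S \<and> quotient_basis Z B S"
    using S zero hom_space.span_zero[of S] by (intro exI[of _ S]) (auto simp: good_def quotient_basis_def)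
  let ?S = "SOME S. finite S \<and> quotient_basis Z B S"
  have "good ?S" using someI_ex[OF ex] by (auto simp: good_def quotient_basis_def)
  then show ?thesis using ex card by (simp add: quotient_dim_def)
qed

abbreviation "one_vec \<equiv> (\<lambda>_::unit. 1)"

text \<open>Homomorphisms from k correspond to invariant vectors, through the value at
  \<open>one_vec\<close>.\<close>

lemma Hom_trivial:
  fixes \<phi> :: "(unit \<Rightarrow> 'k::field) \<Rightarrow> ('i \<Rightarrow> 'k)"
  assumes \<phi>: "\<phi> \<in> Hom_G trivial_module N"
  shows "\<phi> v = fscale (v ()) (\<phi> one_vec)" "\<phi> one_vec \<in> gcarrier N" "gact N g (\<phi> one_vec) = \<phi> one_vec"
proof -
  have "v = fscale (v ()) one_vec" by (auto simp: fscale_def)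
  then have "\<phi> v = \<phi> (fscale (v ()) one_vec)" by (rule arg_cong)
  then show "\<phi> v = fscale (v ()) (\<phi> one_vec)" using \<phi> by (simp add: Hom_G_def trivial_module_def)
  show "\<phi> one_vec \<in> gcarrier N" "gact N g (\<phi> one_vec) = \<phi> one_vec"
    using \<phi> by (auto simp: Hom_G_def trivial_module_def)
qed

lemma Hom_trivialI:
  fixes y :: "'i \<Rightarrow> 'k::field"
  assumes N: "rational_module N" and y: "y \<in> gcarrier N" "\<And>g. gact N g y = y"
  shows "(\<lambda>v. fscale (v ()) y) \<in> Hom_G trivial_module N"
proof -
  interpret rational N by standard fact
  show ?thesis
    using fun_space.subspace_scale[OF C_sub y(1)] y(2)
    by (simp add: Hom_G_def trivial_module_def lin_on_scale[OF C_sub act_lin y(1)]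
        fun_space.scale_left_distrib) (simp add: fscale_def mult.assoc)
qed

text \<open>Under evaluation at \<open>one_vec\<close> the complex defining Ext becomes that of
  invariants of the resolution, so \<open>quotient_dim_le\<close> reduces the bound to
  \<open>resolution_relation\<close>.\<close>

theorem proposition4p8:
  fixes p n m :: nat
    and \<epsilon> :: "(('k::alg_closed_field sl2 \<Rightarrow> 'k) \<Rightarrow> 'k) \<Rightarrow> (nat \<Rightarrow> 'k)"
    and I :: "nat \<Rightarrow> ('k, nat) gmodule"
    and d :: "nat \<Rightarrow> (nat \<Rightarrow> 'k) \<Rightarrow> (nat \<Rightarrow> 'k)"
  assumes "prime p" and "odd p" and "CHAR('k) = p"
    and "n \<le> 2 * p - 3"
    and "injective_resolution (weyl_module m) \<epsilon> I d"
  shows "cohomology_dim I d n \<le> enat (fib (n + 1))"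
proof -
  note p = assms(1,3,2) and res = assms(5)
  let ?L = "trivial_module :: ('k, unit) gmodule"
  have rat: "rational_module (I q)" and dH: "d q \<in> Hom_G (I q) (I (Suc q))"
    and dd: "v \<in> gcarrier (I q) \<Longrightarrow> d (Suc q) (d q v) = 0" for q v
  proof -
    show "rational_module (I q)" and "d q \<in> Hom_G (I q) (I (Suc q))"
      using res by (simp_all add: injective_resolution_def injective_module_def)
    show "d (Suc q) (d q v) = 0" if "v \<in> gcarrier (I q)"
    proof -
      have "d q ` gcarrier (I q) = {v \<in> gcarrier (I (Suc q)). d (Suc q) v = 0}"
        using res by (simp add: injective_resolution_def)
      then show ?thesis using that by blast
    qed
  qed
  have sub: "fun_space.subspace (gcarrier (I q))" for q using rat[of q] by (simp add: rational_module_def)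
  have lin: "lin_on (gcarrier (I q)) (d q)" for q using dH[of q] by (simp add: Hom_G_def lin_on_def)
  have act: "lin_on (gcarrier (I q)) (gact (I q) g)" for q g using rat[of q] by (simp add: rational_module_def lin_on_def)
  define Z where "Z = Ext_cocycles ?L I d n"
  define B where "B = Ext_coboundaries ?L I d n"
  have Z_iff: "\<phi> \<in> Z \<longleftrightarrow> \<phi> \<in> Hom_G ?L (I n) \<and> (\<forall>v. d n (\<phi> v) = 0)" for \<phi>
    by (auto simp: Z_def Ext_cocycles_def fun_eq_iff)
  have "hom_space.subspace Z"
    unfolding hom_space.subspace_def Z_iff
  proof (intro conjI ballI allI)
    show "0 \<in> Hom_G ?L (I n)" "d n (0 v) = 0" for v
      using fun_space.subspace_0[OF sub] lin_on_0[OF sub lin] lin_on_0[OF sub act]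
      by (simp_all add: Hom_G_def trivial_module_def)
  next
    fix \<phi> \<psi> assume "\<phi> \<in> Z" "\<psi> \<in> Z"
    then have *: "\<phi> \<in> Hom_G ?L (I n)" "\<psi> \<in> Hom_G ?L (I n)" "\<And>v. \<phi> v \<in> gcarrier (I n)" "\<And>v. \<psi> v \<in> gcarrier (I n)"
      "\<And>v. d n (\<phi> v) = 0" "\<And>v. d n (\<psi> v) = 0"
      by (auto simp: Z_iff Hom_G_def trivial_module_def)
    show "\<phi> + \<psi> \<in> Hom_G ?L (I n)"
      using *(1,2) fun_space.subspace_add[OF sub *(3,4)] lin_on_add[OF sub act *(3,4)]
      by (simp add: Hom_G_def trivial_module_def fun_space.scale_right_distrib add_ac)
    show "d n ((\<phi> + \<psi>) v) = 0" for v
      using lin_on_add[OF sub lin *(3,4)] *(5,6) by simp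
  next
    fix c \<phi> assume "\<phi> \<in> Z"
    then have *: "\<phi> \<in> Hom_G ?L (I n)" "\<And>v. \<phi> v \<in> gcarrier (I n)" "\<And>v. d n (\<phi> v) = 0"
      by (auto simp: Z_iff Hom_G_def trivial_module_def)
    show "hom_scale c \<phi> \<in> Hom_G ?L (I n)"
      using *(1) fun_space.subspace_scale[OF sub *(2)] lin_on_scale[OF sub act *(2)]
      by (simp add: Hom_G_def trivial_module_def hom_scale_def fun_space.scale_right_distrib mult.commute)
    show "d n (hom_scale c \<phi> v) = 0" for v
      using lin_on_scale[OF sub lin *(2)] *(3) by (simp add: hom_scale_def)
  qed
  moreover have "B \<subseteq> Z"
  proof (cases n)
    case 0
    then show ?thesis using hom_space.subspace_0[OF \<open>hom_space.subspace Z\<close>] by (simp add: B_def)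
  next
    case (Suc l)
    show ?thesis
    proof
      fix \<psi> assume "\<psi> \<in> B"
      then obtain \<phi> where \<phi>: "\<phi> \<in> Hom_G ?L (I l)" "\<psi> = d l \<circ> \<phi>" by (auto simp: B_def Suc)
      then have "\<And>v. \<phi> v \<in> gcarrier (I l)" "\<And>g v. gact (I l) g (\<phi> v) = \<phi> v"
        by (auto simp: Hom_G_def trivial_module_def)
      moreover from this have "gact (I (Suc l)) g (d l (\<phi> v)) = d l (\<phi> v)" for g v
        using dH[of l] unfolding Hom_G_def by (metis (mono_tags, lifting) mem_Collect_eq)
      ultimately show "\<psi> \<in> Z"
        using \<phi> dH[of l] dd[of _ l] by (simp add: Z_iff Suc Hom_G_def trivial_module_def)
    qed
  qed
  moreover have "\<exists>c. (\<exists>i\<le>fib (n + 1). c i \<noteq> 0) \<and> (\<Sum>i\<le>fib (n + 1). hom_scale (c i) (z i)) \<in> B"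
    if z: "\<And>i. i \<le> fib (n + 1) \<Longrightarrow> z i \<in> Z" for z
  proof -
    let ?b = "fib (Suc n)"
    have zH: "z i \<in> Hom_G ?L (I n)" "d n (z i one_vec) = 0" if "i \<le> ?b" for i using z that by (auto simp: Z_iff)
    obtain c where c: "(\<exists>i\<le>?b. c i \<noteq> 0) \<and>
      (if n = 0 then (\<Sum>i\<le>?b. fscale (c i) (z i one_vec)) = 0
       else \<exists>y\<in>gcarrier (I (n - 1)). (\<forall>g. gact (I (n - 1)) g y = y) \<and>
         d (n - 1) y = (\<Sum>i\<le>?b. fscale (c i) (z i one_vec)))"
      using resolution_relation[OF p assms(4) res, of "\<lambda>i. z i one_vec"] zH Hom_trivial(2,3)[OF zH(1)] by blast
    have ev: "(\<Sum>i\<le>?b. hom_scale (c i) (z i)) = (\<lambda>v. fscale (v ()) (\<Sum>i\<le>?b. fscale (c i) (z i one_vec)))"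
    proof
      fix v
      have "(\<Sum>i\<le>?b. hom_scale (c i) (z i)) v = (\<Sum>i\<le>?b. fscale (c i) (z i v))"
        by (simp add: sum_fun_apply hom_scale_def)
      also have "\<dots> = (\<Sum>i\<le>?b. fscale (v ()) (fscale (c i) (z i one_vec)))"
        by (intro sum.cong refl) (subst Hom_trivial(1)[OF zH(1)], simp_all add: mult.commute)
      finally show "(\<Sum>i\<le>?b. hom_scale (c i) (z i)) v = fscale (v ()) (\<Sum>i\<le>?b. fscale (c i) (z i one_vec))"
        by (simp add: fun_space.scale_sum_right)
    qed
    have "(\<Sum>i\<le>?b. hom_scale (c i) (z i)) \<in> B"
    proof (cases n)
      case 0
      then have "(\<Sum>i\<le>?b. fscale (c i) (z i one_vec)) = 0" using c by simp
      then have "(\<Sum>i\<le>?b. hom_scale (c i) (z i)) = 0" unfolding ev by (simp add: fscale_def fun_eq_iff)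
      then show ?thesis using 0 by (simp add: B_def del: sum.atMost_Suc fib.simps)
    next
      case (Suc l)
      then obtain y where y: "y \<in> gcarrier (I l)" "\<And>g. gact (I l) g y = y"
        "d l y = (\<Sum>i\<le>?b. fscale (c i) (z i one_vec))" using c by auto
      have "(\<Sum>i\<le>?b. hom_scale (c i) (z i)) = d l \<circ> (\<lambda>v. fscale (v ()) y)"
        unfolding ev y(3)[symmetric] by (auto simp: lin_on_scale[OF sub lin y(1)])
      then show ?thesis
        using Hom_trivialI[OF rat y(1,2)] unfolding B_def Suc by auto
    qed
    then show ?thesis using c by auto
  qed
  ultimately show ?thesis
    unfolding cohomology_dim_def Ext_dim_def Z_def[symmetric] B_def[symmetric] by (rule quotient_dim_le)
qed

end
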